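(* Let $[a,b]\subset\mathbb{R}$ be a compact interval, let $m\geq1$, $r\geq2$, $n\geq0$ be integers, let $0<\alpha\leq1$, and let $\varepsilon_0>0$. For each $\varepsilon\in[0,\varepsilon_0)$ let $A_{r-j}(\cdot,\varepsilon)\in(C^{n,\alpha})^{m\times m}$ for $j=1,\dots,r$, let $f(\cdot,\varepsilon)\in(C^{n,\alpha})^{m}$, let $c(\varepsilon)\in\mathbb{C}^{rm}$, and let $B(\varepsilon):(C^{n+r,\alpha})^{m}\to\mathbb{C}^{rm}$ be a continuous linear operator (no regularity in $\varepsilon$ is assumed). Consider the parameter-dependent boundary-value problem $$L(\varepsilon)y(t,\varepsilon)\equiv y^{(r)}(t,\varepsilon)+\sum_{j=1}^{r}A_{r-j}(t,\varepsilon)y^{(r-j)}(t,\varepsilon)=f(t,\varepsilon),\quad a\leq t\leq b,\qquad B(\varepsilon)y(\cdot,\varepsilon)=c(\varepsilon),$$ with unknown $y(\cdot,\varepsilon)\in(C^{n+r,\alpha})^{m}$. Then the solution to this problem depends continuously on the parameter $\varepsilon$ at $\varepsilon=0$ (in the sense defined in the context) if and only if the following three conditions hold: (0) the homogeneous problem $L(0)y=0$ on $[a,b]$, $B(0)y=0$, has only the trivial solution $y=0$ in $(C^{n+r,\alpha})^{m}$; (I) $A_{r-j}(\cdot,\varepsilon)\to A_{r-j}(\cdot,0)$ in $(C^{n,\alpha})^{m\times m}$ as $\varepsilon\to0+$, for each $j\in\{1,\dots,r\}$; (II) $B(\varepsilon)y\to B(0)y$ in $\mathbb{C}^{rm}$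 as $\varepsilon\to0+$, for every $y\in(C^{n+r,\alpha})^{m}$.
   Context: $C^{n,\alpha}$ denotes the complex Hölder space of all $n$ times continuously differentiable functions $x:[a,b]\to\mathbb{C}$ with $\|x\|'_{n,\alpha}:=\sup_{a\leq t_1<t_2\leq b}|x^{(n)}(t_2)-x^{(n)}(t_1)|/|t_2-t_1|^{\alpha}<\infty$, normed by $\|x\|_{n,\alpha}:=\sum_{j=0}^{n}\max_{[a,b]}|x^{(j)}|+\|x\|'_{n,\alpha}$. $(C^{n,\alpha})^{m}$ and $(C^{n,\alpha})^{m\times m}$ are the spaces of $m$-column vector-valued and $m\times m$ matrix-valued functions on $[a,b]$ with entries in $C^{n,\alpha}$, normed by the sum of the norms of the entries. Definition: the solution to the problem depends continuously on $\varepsilon$ at $\varepsilon=0$ if ( * ) there is $\varepsilon_1\in(0,\varepsilon_0)$ such that for every $\varepsilon\in[0,\varepsilon_1)$ and arbitrary $f(\cdot,\varepsilon)\in(C^{n,\alpha})^{m}$, $c(\varepsilon)\in\mathbb{C}^{rm}$ the problem has a unique solution $y(\cdot,\varepsilon)\in(C^{n+r,\alpha})^{m}$; and ( ** ) whenever $f(\cdot,\varepsilon)\to f(\cdot,0)$ in $(C^{n,\alpha})^{m}$ and $c(\varepsilon)\to c(0)$ in $\mathbb{C}^{rm}$ as $\varepsilon\to0+$, it follows that $y(\cdot,\varepsilon)\to y(\cdot,0)$ in $(C^{n+r,\alpha})^{m}$ as $\varepsilon\to0+$. *)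

theory Defs
  imports "HOL-Analysis.Analysis"
begin

text \<open>Scalar functions on [a,b] are modelled as complex-valued functions on the reals
that vanish outside [a,b] (canonical representatives). Vector / matrix valued functions
are indexed by natural numbers, entries with indices out of range being 0.
Vectors of C^N are functions nat => complex vanishing at indices >= N.\<close>

fun dern :: "real \<Rightarrow> real \<Rightarrow> nat \<Rightarrow> (real \<Rightarrow> complex) \<Rightarrow> real \<Rightarrow> complex" where
  "dern a b 0 x = x"
| "dern a b (Suc k) x = (\<lambda>t. vector_derivative (dern a b k x) (at t within {a..b}))"

definition hoelder_semi :: "nat \<Rightarrow> real \<Rightarrow> real \<Rightarrow> real \<Rightarrow> (real \<Rightarrow> complex) \<Rightarrow> real" where
  "hoelder_semi n \<alpha> a b x =
     Sup {cmod (dern a b n x t2 - dern a b n x t1) / \<bar>t2 - t1\<bar> powr \<alpha> | t1 t2. a \<le> t1 \<and> t1 < t2 \<and> t2 \<le> b}"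

definition Hoelder :: "nat \<Rightarrow> real \<Rightarrow> real \<Rightarrow> real \<Rightarrow> (real \<Rightarrow> complex) set" where
  "Hoelder n \<alpha> a b = {x.
     (\<forall>t. t \<notin> {a..b} \<longrightarrow> x t = 0) \<and>
     (\<forall>k\<le>n. continuous_on {a..b} (dern a b k x)) \<and>
     (\<forall>k<n. \<forall>t\<in>{a..b}. (dern a b k x has_vector_derivative dern a b (Suc k) x t) (at t within {a..b})) \<and>
     bdd_above {cmod (dern a b n x t2 - dern a b n x t1) / \<bar>t2 - t1\<bar> powr \<alpha> | t1 t2. a \<le> t1 \<and> t1 < t2 \<and> t2 \<le> b}}"

definition hoelder_norm :: "nat \<Rightarrow> real \<Rightarrow> real \<Rightarrow> real \<Rightarrow> (real \<Rightarrow> complex) \<Rightarrow> real" where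
  "hoelder_norm n \<alpha> a b x =
     (\<Sum>j\<le>n. Sup ((\<lambda>t. cmod (dern a b j x t)) ` {a..b})) + hoelder_semi n \<alpha> a b x"

definition VHoelder :: "nat \<Rightarrow> nat \<Rightarrow> real \<Rightarrow> real \<Rightarrow> real \<Rightarrow> (nat \<Rightarrow> real \<Rightarrow> complex) set" where
  "VHoelder m n \<alpha> a b = {y. (\<forall>i<m. y i \<in> Hoelder n \<alpha> a b) \<and> (\<forall>i\<ge>m. y i = (\<lambda>t. 0))}"

definition vnorm :: "nat \<Rightarrow> nat \<Rightarrow> real \<Rightarrow> real \<Rightarrow> real \<Rightarrow> (nat \<Rightarrow> real \<Rightarrow> complex) \<Rightarrow> real" where
  "vnorm m n \<alpha> a b y = (\<Sum>i<m. hoelder_norm n \<alpha> a b (y i))"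

definition MHoelder :: "nat \<Rightarrow> nat \<Rightarrow> real \<Rightarrow> real \<Rightarrow> real \<Rightarrow> (nat \<Rightarrow> nat \<Rightarrow> real \<Rightarrow> complex) set" where
  "MHoelder m n \<alpha> a b = {M. (\<forall>i<m. \<forall>l<m. M i l \<in> Hoelder n \<alpha> a b) \<and>
       (\<forall>i l. (m \<le> i \<or> m \<le> l) \<longrightarrow> M i l = (\<lambda>t. 0))}"

definition mnorm :: "nat \<Rightarrow> nat \<Rightarrow> real \<Rightarrow> real \<Rightarrow> real \<Rightarrow> (nat \<Rightarrow> nat \<Rightarrow> real \<Rightarrow> complex) \<Rightarrow> real" where
  "mnorm m n \<alpha> a b M = (\<Sum>i<m. \<Sum>l<m. hoelder_norm n \<alpha> a b (M i l))"

definition cvec :: "nat \<Rightarrow> (nat \<Rightarrow> complex) set" where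
  "cvec N = {v. \<forall>i\<ge>N. v i = 0}"

definition cnorm :: "nat \<Rightarrow> (nat \<Rightarrow> complex) \<Rightarrow> real" where
  "cnorm N v = (\<Sum>i<N. cmod (v i))"

definition cont_lin_op :: "nat \<Rightarrow> nat \<Rightarrow> real \<Rightarrow> real \<Rightarrow> real \<Rightarrow> nat
    \<Rightarrow> ((nat \<Rightarrow> real \<Rightarrow> complex) \<Rightarrow> (nat \<Rightarrow> complex)) \<Rightarrow> bool" where
  "cont_lin_op m k \<alpha> a b N T \<longleftrightarrow>
     (\<forall>y\<in>VHoelder m k \<alpha> a b. T y \<in> cvec N) \<and>
     (\<forall>y\<in>VHoelder m k \<alpha> a b. \<forall>z\<in>VHoelder m k \<alpha> a b. \<forall>s t::complex.
         T (\<lambda>i u. s * y i u + t * z i u) = (\<lambda>i. s * T y i + t * T z i)) \<and>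
     (\<forall>y\<in>VHoelder m k \<alpha> a b. \<forall>e>0. \<exists>d>0. \<forall>z\<in>VHoelder m k \<alpha> a b.
         vnorm m k \<alpha> a b (\<lambda>i u. z i u - y i u) < d \<longrightarrow> cnorm N (\<lambda>i. T z i - T y i) < e)"

definition Lop :: "real \<Rightarrow> real \<Rightarrow> nat \<Rightarrow> nat
    \<Rightarrow> (nat \<Rightarrow> real \<Rightarrow> nat \<Rightarrow> nat \<Rightarrow> real \<Rightarrow> complex) \<Rightarrow> real
    \<Rightarrow> (nat \<Rightarrow> real \<Rightarrow> complex) \<Rightarrow> (nat \<Rightarrow> real \<Rightarrow> complex)" where
  "Lop a b m r A \<epsilon> y = (\<lambda>i t. if i < m \<and> t \<in> {a..b} then
      dern a b r (y i) t + (\<Sum>j\<in>{1..r}. \<Sum>l<m. A (r - j) \<epsilon> i l t * dern a b (r - j) (y l) t)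
    else 0)"

definition cont_dep :: "real \<Rightarrow> real \<Rightarrow> nat \<Rightarrow> nat \<Rightarrow> nat \<Rightarrow> real \<Rightarrow> real
    \<Rightarrow> (nat \<Rightarrow> real \<Rightarrow> nat \<Rightarrow> nat \<Rightarrow> real \<Rightarrow> complex)
    \<Rightarrow> (real \<Rightarrow> (nat \<Rightarrow> real \<Rightarrow> complex) \<Rightarrow> (nat \<Rightarrow> complex)) \<Rightarrow> bool" where
  "cont_dep a b m r n \<alpha> \<epsilon>0 A B \<longleftrightarrow>
    (\<exists>\<epsilon>1. 0 < \<epsilon>1 \<and> \<epsilon>1 < \<epsilon>0 \<and>
      (\<forall>\<epsilon>\<in>{0..<\<epsilon>1}. \<forall>f\<in>VHoelder m n \<alpha> a b. \<forall>c\<in>cvec (r * m).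
         \<exists>!y. y \<in> VHoelder m (n + r) \<alpha> a b \<and> Lop a b m r A \<epsilon> y = f \<and> B \<epsilon> y = c) \<and>
      (\<forall>f c y. (\<forall>\<epsilon>\<in>{0..<\<epsilon>1}. f \<epsilon> \<in> VHoelder m n \<alpha> a b \<and> c \<epsilon> \<in> cvec (r * m) \<and>
                  y \<epsilon> \<in> VHoelder m (n + r) \<alpha> a b \<and>
                  Lop a b m r A \<epsilon> (y \<epsilon>) = f \<epsilon> \<and> B \<epsilon> (y \<epsilon>) = c \<epsilon>) \<longrightarrow>
         ((\<lambda>\<epsilon>. vnorm m n \<alpha> a b (\<lambda>i t. f \<epsilon> i t - f 0 i t)) \<longlongrightarrow> 0) (at_right 0) \<longrightarrow>
         ((\<lambda>\<epsilon>. cnorm (r * m) (\<lambda>i. c \<epsilon> i - c 0 i)) \<longlongrightarrow> 0) (at_right 0) \<longrightarrow>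
         ((\<lambda>\<epsilon>. vnorm m (n + r) \<alpha> a b (\<lambda>i t. y \<epsilon> i t - y 0 i t)) \<longlongrightarrow> 0) (at_right 0)))"

end

theory Submission
  imports Defs
begin

text \<open>
  The Volterra form of the Cauchy problem is solved by a Neumann series that converges in an
  exponentially weighted sup norm; bootstrapping regularity gives the a priori bound of a function by its
  image under L and its Cauchy data in the Hoelder norms.

  Sufficiency: condition (I) means that L(\<epsilon>) tends to L(0) in operator norm, and by the
  Banach--Steinhaus theorem condition (II) makes B(\<epsilon>) bounded near 0. On the finite-dimensional
  kernel of L(0) strong convergence is norm convergence, so (0) yields the estimate of y by
  L(\<epsilon>)y and B(\<epsilon>)y with a constant independent of small \<epsilon>; unique solvability and
  continuity follow from it.

  Necessity: if z is a vector of monomials, the solution y(\<epsilon>) with the data of z at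
  \<epsilon> = 0 tends to z, and L(\<epsilon>)z - L(0)z = L(\<epsilon>)(z - y(\<epsilon>)). The Wronski matrix of the
  monomials is unipotent, so this controls the coefficients and gives (I). For (II), the solution
  y(\<epsilon>) with data L(\<epsilon>)z, B(0)z tends to z, and the coordinates of z - y(\<epsilon>) with respect to the
  homogeneous solutions dual to B(\<epsilon>) are exactly B(\<epsilon>)z - B(0)z.
\<close>

section \<open>Finite linear systems\<close>

text \<open>Condition (II) gives only strong convergence, which on an infinite-dimensional space
  does not yield norm convergence; so the pair (L, B) cannot be treated as a small perturbation of
  its value at 0. This is why y is split by means of its Cauchy data: the part with zero data asks
  only for a uniform bound of the boundary operators, and the other part lies in a kernel of
  dimension r * m. Constants from the Volterra equation depend on the coefficients, so the a priori
  bound is invoked at \<epsilon> = 0, and the other parameters are reached by absorbing an error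
  proportional to the norm of y. Towards necessity, no bound of L(\<epsilon>) is available when (I)
  is proved, and none of B(\<epsilon>) when (II) is proved. The quantity to be estimated is
  therefore allowed to reappear on the right with a factor tending to 0 and is then moved to the
  left. The spaces are sets of functions with explicit norms. Completeness enters as a statement
  about absolutely summable series, which serves both the Neumann series and the gliding
  hump.\<close>

lemma underdetermined_nontrivial_kernel:
  fixes v :: "'s \<Rightarrow> 'i \<Rightarrow> 'f::field"
  assumes "finite I" "finite S" "card I < card S"
  shows "\<exists>q. (\<exists>s\<in>S. q s \<noteq> 0) \<and> (\<forall>i\<in>I. (\<Sum>s\<in>S. q s * v s i) = 0)"
  using assms
proof (induction I arbitrary: S v rule: finite_induct)
  case empty
  then show ?case by (intro exI[of _ "\<lambda>_. 1"]) (auto simp: card_gt_0_iff)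
next
  case (insert i0 I)
  show ?case
  proof (cases "\<forall>s\<in>S. v s i0 = 0")
    case True
    have "card I < card S" using insert by simp
    then obtain q where "\<exists>s\<in>S. q s \<noteq> 0" "\<forall>i\<in>I. (\<Sum>s\<in>S. q s * v s i) = 0"
      using insert.IH[OF insert.prems(1)] by blast
    then show ?thesis using True by (intro exI[of _ q]) auto
  next
    case False
    then obtain p where p: "p \<in> S" "v p i0 \<noteq> 0" by blast
    define S' where "S' = S - {p}"
    have S': "finite S'" "card I < card S'" "S = insert p S'" "p \<notin> S'"
      using insert p by (auto simp: S'_def)
    obtain q' where q': "\<exists>s\<in>S'. q' s \<noteq> 0"
      "\<forall>i\<in>I. (\<Sum>s\<in>S'. q' s * (v s i - v s i0 / v p i0 * v p i)) = 0"
      using insert.IH[OF S'(1,2), of "\<lambda>s i. v s i - v s i0 / v p i0 * v p i"] by blast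
    \<comment> \<open>Elimination with pivot p: the coefficient of p is the one that solves equation
      i0, and in every other equation it reproduces the reduced columns for which \<open>q'\<close>
      was obtained.\<close>
    define q where "q = q'(p := - (\<Sum>s\<in>S'. q' s * v s i0) / v p i0)"
    have sum: "(\<Sum>s\<in>S. q s * v s i) = (\<Sum>s\<in>S'. q' s * (v s i - v s i0 / v p i0 * v p i))" for i
    proof -
      have "(\<Sum>s\<in>S. q s * v s i) = q p * v p i + (\<Sum>s\<in>S'. q' s * v s i)"
        unfolding S'(3) sum.insert[OF S'(1,4)] using S'(4)
        by (intro arg_cong2[where f = "(+)"] sum.cong refl) (auto simp: q_def)
      also have "q p * v p i = - (\<Sum>s\<in>S'. q' s * (v s i0 / v p i0 * v p i))"
        by (simp add: q_def sum_distrib_right sum_divide_distrib sum_negf mult.assoc)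
      finally show ?thesis by (simp add: right_diff_distrib sum_subtractf)
    qed
    have "\<exists>s\<in>S. q s \<noteq> 0" using q'(1) S'(3,4) by (auto simp: q_def)
    moreover have "(\<Sum>s\<in>S. q s * v s i) = 0" if "i \<in> insert i0 I" for i
      unfolding sum using q'(2) that p by (cases "i = i0") (auto simp: field_simps)
    ultimately show ?thesis by blast
  qed
qed

text \<open>The right side c is appended as an extra column. The resulting N equations in N + 1
  unknowns have a nontrivial relation, and injectivity forces its coefficient at c to be nonzero, so
  one can divide by it.\<close>

lemma injective_system_solvable:
  fixes v :: "nat \<Rightarrow> nat \<Rightarrow> complex"
  assumes inj: "\<forall>q\<in>cvec N. (\<forall>i<N. (\<Sum>s<N. q s * v s i) = 0) \<longrightarrow> q = (\<lambda>s. 0)"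
  shows "\<exists>q\<in>cvec N. \<forall>i<N. (\<Sum>s<N. q s * v s i) = c i"
proof -
  obtain q where q: "\<exists>s\<in>{..N}. q s \<noteq> 0"
    "\<And>i. i < N \<Longrightarrow> (\<Sum>s\<in>{..N}. q s * (if s < N then v s i else c i)) = 0"
    using underdetermined_nontrivial_kernel[of "{..<N}" "{..N}" "\<lambda>s i. if s < N then v s i else c i"] by auto
  have eq: "(\<Sum>s<N. q s * v s i) + q N * c i = 0" if "i < N" for i
    using q(2)[OF that] by (simp flip: lessThan_Suc_atMost)
  have "q N \<noteq> 0"
  proof
    assume "q N = 0"
    have "(\<lambda>s. if s < N then q s else 0) = (\<lambda>s. 0)"
      by (rule inj[rule_format]) (use eq \<open>q N = 0\<close> in \<open>auto simp: cvec_def\<close>)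
    then have "q s = 0" if "s < N" for s using that by (metis (full_types))
    then show False using q(1) \<open>q N = 0\<close> by (metis atMost_iff le_neq_implies_less)
  qed
  define p where "p = (\<lambda>s. if s < N then - q s / q N else 0)"
  have "(\<Sum>s<N. p s * v s i) = c i" if "i < N" for i
  proof -
    have "(\<Sum>s<N. p s * v s i) = - (\<Sum>s<N. q s * v s i) / q N"
      by (simp add: p_def sum_divide_distrib sum_negf)
    also have "(\<Sum>s<N. q s * v s i) = - (q N * c i)" using eq[OF that] by (simp add: eq_neg_iff_add_eq_0)
    finally show ?thesis using \<open>q N \<noteq> 0\<close> by simp
  qed
  then show ?thesis by (intro bexI[of _ p]) (auto simp: p_def cvec_def)
qed

lemma cnorm_lincomb: "cnorm N (\<lambda>i. p * c i + q * d i) \<le> cmod p * cnorm N c + cmod q * cnorm N d"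
  unfolding cnorm_def sum_distrib_left sum.distrib[symmetric]
  by (intro sum_mono order_trans[OF norm_triangle_ineq]) (simp add: norm_mult)

lemma cnorm_ge_0: "0 \<le> cnorm N c"
  unfolding cnorm_def by (intro sum_nonneg) auto

lemma norm_le_cnorm: "s < N \<Longrightarrow> cmod (q s) \<le> cnorm N q"
  unfolding cnorm_def by (rule member_le_sum) auto

lemma cnorm_diff_comm: "cnorm N (\<lambda>i. c i - d i) = cnorm N (\<lambda>i. d i - c i)"
  by (simp add: cnorm_def norm_minus_commute)

lemma cnorm_triangle: "cnorm N c \<le> cnorm N d + cnorm N (\<lambda>i. c i - d i)"
  using cnorm_lincomb[of N 1 d 1 "\<lambda>i. c i - d i"] by simp

text \<open>Solving for the unit vectors produces the columns \<open>Q j\<close> of the inverse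
  matrix, and injectivity identifies q with the combination of these columns. The sum of the column
  norms serves as \<kappa>. Later this makes B(0) quantitatively injective on the kernel of
  L(0).\<close>

lemma injective_system_bound:
  fixes v :: "nat \<Rightarrow> nat \<Rightarrow> complex"
  assumes inj: "\<forall>q\<in>cvec N. (\<forall>i<N. (\<Sum>s<N. q s * v s i) = 0) \<longrightarrow> q = (\<lambda>s. 0)"
  shows "\<exists>\<kappa>\<ge>0. \<forall>q\<in>cvec N. cnorm N q \<le> \<kappa> * cnorm N (\<lambda>i. \<Sum>s<N. q s * v s i)"
proof -
  have "\<forall>j. \<exists>q\<in>cvec N. \<forall>i<N. (\<Sum>s<N. q s * v s i) = (if i = j then 1 else 0)"
    by (intro allI injective_system_solvable inj)
  then obtain Q where Q: "\<And>j. Q j \<in> cvec N" "\<And>j i. i < N \<Longrightarrow> (\<Sum>s<N. Q j s * v s i) = (if i = j then 1 else 0)"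
    by metis
  have "cnorm N q \<le> (\<Sum>j<N. cnorm N (Q j)) * cnorm N (\<lambda>i. \<Sum>s<N. q s * v s i)" if q: "q \<in> cvec N" for q
  proof -
    define c where "c i = (\<Sum>s<N. q s * v s i)" for i
    have "(\<lambda>s. q s - (\<Sum>j<N. c j * Q j s)) = (\<lambda>s. 0)"
    proof (rule inj[rule_format])
      show "(\<lambda>s. q s - (\<Sum>j<N. c j * Q j s)) \<in> cvec N" using q Q(1) by (simp add: cvec_def)
      fix i assume i: "i < N"
      have "(\<Sum>s<N. (\<Sum>j<N. c j * Q j s) * v s i) = (\<Sum>s<N. \<Sum>j<N. c j * (Q j s * v s i))"
        by (simp add: sum_distrib_right mult.assoc)
      also have "\<dots> = (\<Sum>j<N. \<Sum>s<N. c j * (Q j s * v s i))" by (rule sum.swap)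
      also have "\<dots> = (\<Sum>j<N. c j * (if i = j then 1 else 0))"
        using Q(2)[OF i] by (simp add: sum_distrib_left[symmetric])
      also have "\<dots> = c i" using i by (simp add: if_distrib[of "\<lambda>x. _ * x"] cong: if_cong)
      finally show "(\<Sum>s<N. (q s - (\<Sum>j<N. c j * Q j s)) * v s i) = 0"
        by (simp add: left_diff_distrib sum_subtractf c_def)
    qed
    then have q_eq: "q s = (\<Sum>j<N. c j * Q j s)" for s by (metis eq_iff_diff_eq_0)
    have "cnorm N q \<le> (\<Sum>s<N. \<Sum>j<N. cmod (c j * Q j s))"
      unfolding cnorm_def q_eq by (intro sum_mono norm_sum)
    also have "\<dots> = (\<Sum>j<N. \<Sum>s<N. cmod (c j * Q j s))" by (rule sum.swap)
    also have "\<dots> = (\<Sum>j<N. cmod (c j) * cnorm N (Q j))" by (simp add: cnorm_def sum_distrib_left norm_mult)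
    also have "\<dots> \<le> (\<Sum>j<N. cnorm N c * cnorm N (Q j))"
      unfolding cnorm_def[of N c]
      by (intro sum_mono mult_right_mono cnorm_ge_0 member_le_sum) auto
    finally show ?thesis by (simp add: sum_distrib_right mult.commute c_def[abs_def])
  qed
  then show ?thesis by (intro exI[of _ "\<Sum>j<N. cnorm N (Q j)"]) (auto intro: sum_nonneg cnorm_ge_0)
qed

section \<open>Scalar Hoelder functions on an interval\<close>

locale hoelder_interval =
  fixes a b \<alpha> :: real
  assumes a_less_b: "a < b" and exponent_pos: "0 < \<alpha>" and exponent_le: "\<alpha> \<le> 1"
begin

abbreviation "H n \<equiv> Hoelder n \<alpha> a b"
abbreviation "hnorm n \<equiv> hoelder_norm n \<alpha> a b"

text \<open>Set to 0 off the interval, in contrast to \<open>dern\<close>, so that derivatives of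
  canonical representatives are canonical again and the k-th derivative is the k-th power of a
  single operator.\<close>

definition D :: "(real \<Rightarrow> complex) \<Rightarrow> real \<Rightarrow> complex" where
  "D x = (\<lambda>t. if t \<in> {a..b} then vector_derivative x (at t within {a..b}) else 0)"

definition supnorm :: "(real \<Rightarrow> complex) \<Rightarrow> real" where
  "supnorm x = Sup ((\<lambda>t. cmod (x t)) ` {a..b})"

definition quotients :: "(real \<Rightarrow> complex) \<Rightarrow> real set" where
  "quotients x = {cmod (x t2 - x t1) / \<bar>t2 - t1\<bar> powr \<alpha> | t1 t2. a \<le> t1 \<and> t1 < t2 \<and> t2 \<le> b}"

definition seminorm :: "(real \<Rightarrow> complex) \<Rightarrow> real" where
  "seminorm x = Sup (quotients x)"

lemma vector_derivative_cong_Icc: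
  assumes "\<And>s. s \<in> {a..b} \<Longrightarrow> x s = y s" "t \<in> {a..b}"
  shows "vector_derivative x (at t within {a..b}) = vector_derivative y (at t within {a..b})"
  by (rule vector_derivative_cong_eq) (use assms in auto)

text \<open>\<open>dern\<close> adds each new derivative on the outside; here the first one is moved
  inside, which is the form that inductions on the order of smoothness require.\<close>

lemma dern_Suc:
  assumes "t \<in> {a..b}"
  shows "dern a b (Suc k) x t = dern a b k (D x) t"
  using assms
proof (induction k arbitrary: t)
  case 0
  then show ?case by (simp add: D_def)
next
  case (Suc k)
  have "dern a b (Suc (Suc k)) x t = vector_derivative (dern a b (Suc k) x) (at t within {a..b})"
    by simp
  also have "\<dots> = vector_derivative (dern a b k (D x)) (at t within {a..b})"
    by (rule vector_derivative_cong_Icc) (use Suc in auto)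
  finally show ?case by simp
qed

lemma dern_eq_funpow: "t \<in> {a..b} \<Longrightarrow> dern a b k x t = (D ^^ k) x t"
proof (induction k arbitrary: x)
  case (Suc k)
  then show ?case by (metis dern_Suc funpow_Suc_right o_apply)
qed simp

lemma D_outside: "t \<notin> {a..b} \<Longrightarrow> D x t = 0"
  by (auto simp: D_def)

lemma D_eqI:
  assumes "t \<in> {a..b}" "(x has_vector_derivative d) (at t within {a..b})"
  shows "D x t = d"
  unfolding D_def using vector_derivative_within_closed_interval[OF a_less_b assms] assms by simp

lemma D_eqI_fun:
  assumes "\<And>t. t \<notin> {a..b} \<Longrightarrow> d t = 0"
    and "\<And>t. t \<in> {a..b} \<Longrightarrow> (x has_vector_derivative d t) (at t within {a..b})"
  shows "D x = d"
proof
  fix t show "D x t = d t"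
    by (cases "t \<in> {a..b}") (use assms D_eqI D_outside in auto)
qed

lemma Hoelder_0_iff:
  "x \<in> H 0 \<longleftrightarrow> (\<forall>t. t \<notin> {a..b} \<longrightarrow> x t = 0) \<and> continuous_on {a..b} x \<and> bdd_above (quotients x)"
  by (simp add: Hoelder_def quotients_def)

lemma quotients_cong:
  assumes "\<And>t. t \<in> {a..b} \<Longrightarrow> x t = y t"
  shows "quotients x = quotients y"
proof -
  have "x t1 = y t1 \<and> x t2 = y t2" if "a \<le> t1" "t1 < t2" "t2 \<le> b" for t1 t2
    using assms that by auto
  then show ?thesis unfolding quotients_def by (intro Collect_cong) metis
qed

text \<open>Peels off the first derivative. Together with \<open>hnorm_Suc\<close> it reduces facts
  about \<open>H n\<close> to the case n = 0, where the Hoelder quotients are handled.\<close>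

lemma Hoelder_Suc_iff:
  "x \<in> H (Suc n) \<longleftrightarrow> (\<forall>t. t \<notin> {a..b} \<longrightarrow> x t = 0) \<and>
     (\<forall>t\<in>{a..b}. (x has_vector_derivative D x t) (at t within {a..b})) \<and> D x \<in> H n"
proof -
  have c: "continuous_on {a..b} (dern a b (Suc k) x) \<longleftrightarrow> continuous_on {a..b} (dern a b k (D x))" for k
    by (intro continuous_on_cong dern_Suc) auto
  have d: "(dern a b (Suc k) x has_vector_derivative dern a b (Suc (Suc k)) x t) (at t within {a..b})
      \<longleftrightarrow> (dern a b k (D x) has_vector_derivative dern a b (Suc k) (D x) t) (at t within {a..b})"
    if "t \<in> {a..b}" for k t
  proof -
    have e: "dern a b (Suc (Suc k)) x t = dern a b (Suc k) (D x) t"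
      using dern_Suc[OF that] .
    show ?thesis unfolding e
      using has_vector_derivative_transform[OF that] dern_Suc by metis
  qed
  have q: "quotients (dern a b (Suc n) x) = quotients (dern a b n (D x))"
    by (rule quotients_cong) (rule dern_Suc)
  have le: "(\<forall>k\<le>Suc n. P k) \<longleftrightarrow> P 0 \<and> (\<forall>k\<le>n. P (Suc k))" for P :: "nat \<Rightarrow> bool"
    by (metis Suc_le_mono le0 not0_implies_Suc)
  have less: "(\<forall>k<Suc n. P k) \<longleftrightarrow> P 0 \<and> (\<forall>k<n. P (Suc k))" for P :: "nat \<Rightarrow> bool"
    by (rule All_less_Suc2)
  have z: "dern a b (Suc 0) x t = D x t" if "t \<in> {a..b}" for t
    using dern_Suc[OF that, of 0] by simp
  have cont: "(\<forall>t\<in>{a..b}. (x has_vector_derivative D x t) (at t within {a..b})) \<Longrightarrow> continuous_on {a..b} x"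
    using has_vector_derivative_continuous continuous_on_eq_continuous_within by blast
  show ?thesis
    unfolding Hoelder_def mem_Collect_eq le less quotients_def[symmetric] q c
    using D_outside[of _ x] d z cont by (auto simp del: dern.simps(2))
qed

lemma hnorm_0: "hnorm 0 x = supnorm x + seminorm x"
  by (simp add: hoelder_norm_def hoelder_semi_def supnorm_def seminorm_def quotients_def)

lemma hnorm_Suc: "hnorm (Suc n) x = supnorm x + hnorm n (D x)"
proof -
  have q: "quotients (dern a b (Suc n) x) = quotients (dern a b n (D x))"
    by (rule quotients_cong) (rule dern_Suc)
  have s: "(\<lambda>t. cmod (dern a b (Suc j) x t)) ` {a..b} = (\<lambda>t. cmod (dern a b j (D x) t)) ` {a..b}" for j
    by (intro image_cong refl arg_cong[where f=cmod] dern_Suc)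
  show ?thesis
    unfolding hoelder_norm_def hoelder_semi_def quotients_def[symmetric] q s sum.atMost_Suc_shift
    by (simp add: supnorm_def)
qed

lemma Hoelder_outside: "x \<in> H n \<Longrightarrow> t \<notin> {a..b} \<Longrightarrow> x t = 0"
  by (simp add: Hoelder_def)

lemma Hoelder_continuous: "x \<in> H n \<Longrightarrow> continuous_on {a..b} x"
  unfolding Hoelder_def by (auto dest!: spec[of _ 0])

lemma supnorm_upper:
  assumes "continuous_on {a..b} x" "t \<in> {a..b}"
  shows "cmod (x t) \<le> supnorm x"
proof -
  have "compact ((\<lambda>t. cmod (x t)) ` {a..b})"
    by (intro compact_continuous_image continuous_intros assms) auto
  then show ?thesis unfolding supnorm_def
    by (intro cSup_upper) (use assms in \<open>auto intro: bounded_imp_bdd_above compact_imp_bounded\<close>)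
qed

lemma supnorm_least:
  assumes "\<And>t. t \<in> {a..b} \<Longrightarrow> cmod (x t) \<le> C"
  shows "supnorm x \<le> C"
  unfolding supnorm_def by (rule cSup_least) (use a_less_b assms in auto)

lemma supnorm_nonneg: "continuous_on {a..b} x \<Longrightarrow> 0 \<le> supnorm x"
  using supnorm_upper[of x a] a_less_b norm_ge_zero[of "x a"] by (smt (verit) atLeastAtMost_iff)

lemma seminorm_upper:
  assumes "bdd_above (quotients x)" "s \<in> {a..b}" "t \<in> {a..b}"
  shows "cmod (x t - x s) \<le> seminorm x * \<bar>t - s\<bar> powr \<alpha>"
proof -
  have *: "cmod (x t - x s) \<le> seminorm x * \<bar>t - s\<bar> powr \<alpha>" if "s < t" "s \<in> {a..b}" "t \<in> {a..b}" for s t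
  proof -
    have "cmod (x t - x s) / \<bar>t - s\<bar> powr \<alpha> \<le> seminorm x"
      unfolding seminorm_def using assms(1)
    proof (rule cSup_upper[rotated])
      show "cmod (x t - x s) / \<bar>t - s\<bar> powr \<alpha> \<in> quotients x"
        unfolding quotients_def mem_Collect_eq using that by - (rule exI[of _ s], rule exI[of _ t], auto)
    qed
    then show ?thesis using that by (simp add: pos_divide_le_eq)
  qed
  show ?thesis
    using *[of s t] *[of t s] assms(2,3)
    by (cases s t rule: linorder_cases) (auto simp: norm_minus_commute abs_minus_commute)
qed

lemma quotients_le:
  assumes "\<And>s t. a \<le> s \<Longrightarrow> s < t \<Longrightarrow> t \<le> b \<Longrightarrow> cmod (x t - x s) \<le> C * (t - s) powr \<alpha>"
    and "q \<in> quotients x"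
  shows "q \<le> C"
  using assms unfolding quotients_def by (force simp: pos_divide_le_eq)

lemma seminormI:
  assumes "\<And>s t. a \<le> s \<Longrightarrow> s < t \<Longrightarrow> t \<le> b \<Longrightarrow> cmod (x t - x s) \<le> C * (t - s) powr \<alpha>"
  shows "bdd_above (quotients x)" "seminorm x \<le> C"
proof -
  show "bdd_above (quotients x)"
    using quotients_le[OF assms] by (meson bdd_aboveI)
  have "quotients x \<noteq> {}" using a_less_b by (auto simp: quotients_def)
  then show "seminorm x \<le> C"
    unfolding seminorm_def using quotients_le[OF assms] by (intro cSup_least) auto
qed

lemma seminorm_nonneg:
  assumes "bdd_above (quotients x)"
  shows "0 \<le> seminorm x"
proof -
  have "0 \<le> seminorm x * \<bar>b - a\<bar> powr \<alpha>"
    using seminorm_upper[OF assms, of a b] a_less_b by (auto intro: order_trans[OF norm_ge_zero])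
  then show ?thesis using a_less_b by (auto simp: zero_le_mult_iff)
qed

lemma Hoelder_0I:
  assumes "\<And>t. t \<notin> {a..b} \<Longrightarrow> x t = 0" "continuous_on {a..b} x"
    and "\<And>t. t \<in> {a..b} \<Longrightarrow> cmod (x t) \<le> C1"
    and "\<And>s t. a \<le> s \<Longrightarrow> s < t \<Longrightarrow> t \<le> b \<Longrightarrow> cmod (x t - x s) \<le> C2 * (t - s) powr \<alpha>"
  shows "x \<in> H 0" "hnorm 0 x \<le> C1 + C2"
  using assms(1,2) seminormI[of x C2, OF assms(4)] supnorm_least[of x C1, OF assms(3)]
  by (auto simp: Hoelder_0_iff hnorm_0)

lemma Hoelder_SucI:
  assumes "\<And>t. t \<notin> {a..b} \<Longrightarrow> x t = 0"
    and "\<And>t. t \<in> {a..b} \<Longrightarrow> (x has_vector_derivative d t) (at t within {a..b})"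
    and "d \<in> H n"
    and "\<And>t. t \<in> {a..b} \<Longrightarrow> cmod (x t) \<le> C1" "hnorm n d \<le> C2"
  shows "x \<in> H (Suc n)" "D x = d" "hnorm (Suc n) x \<le> C1 + C2"
proof -
  show d: "D x = d" using assms(1-3) Hoelder_outside by (intro D_eqI_fun) auto
  show "x \<in> H (Suc n)" using assms d by (auto simp: Hoelder_Suc_iff)
  show "hnorm (Suc n) x \<le> C1 + C2" using assms(5) supnorm_least[of x C1] assms(4) by (simp add: hnorm_Suc d)
qed

lemma Hoelder_Suc_deriv:
  "x \<in> H (Suc n) \<Longrightarrow> t \<in> {a..b} \<Longrightarrow> (x has_vector_derivative D x t) (at t within {a..b})"
  by (simp add: Hoelder_Suc_iff)

lemma Hoelder_D: "x \<in> H (Suc n) \<Longrightarrow> D x \<in> H n"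
  by (simp add: Hoelder_Suc_iff)

lemma hnorm_nonneg: "x \<in> H n \<Longrightarrow> 0 \<le> hnorm n x"
proof (induction n arbitrary: x)
  case 0
  then show ?case
    using supnorm_nonneg seminorm_nonneg by (auto simp: Hoelder_0_iff hnorm_0)
next
  case (Suc n)
  then show ?case
    using supnorm_nonneg[OF Hoelder_continuous[OF Suc.prems]] Suc.IH[of "D x"] by (auto simp: Hoelder_D hnorm_Suc)
qed

lemma supnorm_le_hnorm: "x \<in> H n \<Longrightarrow> supnorm x \<le> hnorm n x"
  by (cases n) (auto simp: Hoelder_0_iff hnorm_0 seminorm_nonneg hnorm_Suc hnorm_nonneg Hoelder_D)

lemma norm_le_hnorm: "x \<in> H n \<Longrightarrow> cmod (x t) \<le> hnorm n x"
  using supnorm_le_hnorm[of x n] supnorm_upper[of x t] Hoelder_continuous[of x n]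
    Hoelder_outside[of x n t] hnorm_nonneg[of x n] by (cases "t \<in> {a..b}") auto

lemma Hoelder_zero: "(\<lambda>t. 0) \<in> H n" "hnorm n (\<lambda>t. 0) = 0"
proof -
  have "(\<lambda>t. 0) \<in> H n \<and> hnorm n (\<lambda>t. 0) \<le> 0"
  proof (induction n)
    case 0
    show ?case using Hoelder_0I[of "\<lambda>t. 0" 0 0] by auto
  next
    case (Suc n)
    then show ?case using Hoelder_SucI[of "\<lambda>t. 0" "\<lambda>t. 0" n 0 0] by auto
  qed
  then show "(\<lambda>t. 0) \<in> H n" "hnorm n (\<lambda>t. 0) = 0"
    using hnorm_nonneg by (auto intro: antisym)
qed

lemma Hoelder_lincomb:
  assumes "x \<in> H n" "y \<in> H n"
  shows "(\<lambda>t. p * x t + q * y t) \<in> H n"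
    and "hnorm n (\<lambda>t. p * x t + q * y t) \<le> cmod p * hnorm n x + cmod q * hnorm n y"
proof -
  have sup: "cmod (p * x t + q * y t) \<le> cmod p * supnorm x + cmod q * supnorm y"
    if "continuous_on {a..b} x" "continuous_on {a..b} y" "t \<in> {a..b}" for x y t
    using supnorm_upper[OF that(1,3)] supnorm_upper[OF that(2,3)]
    by (intro order_trans[OF norm_triangle_ineq] add_mono) (auto simp: norm_mult mult_left_mono)
  have "(\<lambda>t. p * x t + q * y t) \<in> H n \<and>
      hnorm n (\<lambda>t. p * x t + q * y t) \<le> cmod p * hnorm n x + cmod q * hnorm n y"
    using assms
  proof (induction n arbitrary: x y)
    case 0
    have x: "continuous_on {a..b} x" "bdd_above (quotients x)"
      and y: "continuous_on {a..b} y" "bdd_above (quotients y)"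
      using 0 by (auto simp: Hoelder_0_iff)
    have semi: "cmod (p * x t + q * y t - (p * x s + q * y s)) \<le>
        (cmod p * seminorm x + cmod q * seminorm y) * (t - s) powr \<alpha>" if "a \<le> s" "s < t" "t \<le> b" for s t
    proof -
      have "cmod (p * x t + q * y t - (p * x s + q * y s)) = cmod (p * (x t - x s) + q * (y t - y s))"
        by (simp add: algebra_simps)
      also have "\<dots> \<le> cmod p * cmod (x t - x s) + cmod q * cmod (y t - y s)"
        by (metis norm_mult norm_triangle_ineq)
      also have "\<dots> \<le> cmod p * (seminorm x * \<bar>t - s\<bar> powr \<alpha>) + cmod q * (seminorm y * \<bar>t - s\<bar> powr \<alpha>)"
        using that by (intro add_mono mult_left_mono seminorm_upper x y) auto
      finally show ?thesis using that by (simp add: algebra_simps)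
    qed
    have out: "p * x t + q * y t = 0" if "t \<notin> {a..b}" for t
      using Hoelder_outside[OF 0(1) that] Hoelder_outside[OF 0(2) that] by simp
    have cont: "continuous_on {a..b} (\<lambda>t. p * x t + q * y t)" by (intro continuous_intros x y)
    show ?case
      unfolding hnorm_0[of x] hnorm_0[of y] distrib_left
      using Hoelder_0I[OF _ _ sup[OF x(1) y(1)] semi] out cont by simp
  next
    case (Suc n)
    have c: "continuous_on {a..b} x" "continuous_on {a..b} y" using Suc.prems Hoelder_continuous by auto
    have d: "((\<lambda>t. p * x t + q * y t) has_vector_derivative p * D x t + q * D y t) (at t within {a..b})"
      if "t \<in> {a..b}" for t
      by (intro derivative_intros Hoelder_Suc_deriv[OF Suc.prems(1)] Hoelder_Suc_deriv[OF Suc.prems(2)] that)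
    have IH: "(\<lambda>t. p * D x t + q * D y t) \<in> H n"
      "hnorm n (\<lambda>t. p * D x t + q * D y t) \<le> cmod p * hnorm n (D x) + cmod q * hnorm n (D y)"
      using Suc.IH[of "D x" "D y"] Suc.prems Hoelder_D by auto
    show ?case
      using Hoelder_SucI[OF _ d IH(1) sup[OF c] IH(2)] Hoelder_outside[OF Suc.prems(1)] Hoelder_outside[OF Suc.prems(2)]
      by (auto simp: hnorm_Suc algebra_simps)
  qed
  then show "(\<lambda>t. p * x t + q * y t) \<in> H n"
    and "hnorm n (\<lambda>t. p * x t + q * y t) \<le> cmod p * hnorm n x + cmod q * hnorm n y" by auto
qed

lemma D_lincomb:
  assumes "x \<in> H (Suc n)" "y \<in> H (Suc n)"
  shows "D (\<lambda>t. p * x t + q * y t) = (\<lambda>t. p * D x t + q * D y t)"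
  by (intro D_eqI_fun derivative_intros Hoelder_Suc_deriv[OF assms(1)] Hoelder_Suc_deriv[OF assms(2)])
     (auto simp: D_outside)

section \<open>Embeddings between Hoelder spaces\<close>

lemma deriv_bound_imp_lipschitz:
  assumes "\<And>t. t \<in> {a..b} \<Longrightarrow> (x has_vector_derivative d t) (at t within {a..b})"
    and "\<And>t. t \<in> {a..b} \<Longrightarrow> cmod (d t) \<le> C" "a \<le> s" "s < t" "t \<le> b"
  shows "cmod (x t - x s) \<le> C * (t - s)"
proof -
  have "cmod (x t - x s) \<le> C * norm (t - s)"
  proof (rule differentiable_bound[where S = "{a..b}" and f = x])
    show "(x has_derivative (\<lambda>h. h *\<^sub>R d u)) (at u within {a..b})" if "u \<in> {a..b}" for u
      using assms(1)[OF that] by (simp add: has_vector_derivative_def)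
    show "onorm (\<lambda>h. h *\<^sub>R d u) \<le> C" if "u \<in> {a..b}" for u
      using assms(2)[OF that] by (intro onorm_le) (simp add: mult.commute[of C] mult_left_mono)
  qed (use assms in auto)
  then show ?thesis using assms by simp
qed

text \<open>The increment t - s is the product of its powers with exponents 1 - \<alpha> and
  \<alpha>; the first factor is bounded by the length of the interval, which is where \<alpha> \<le>
  1 enters.\<close>

lemma lipschitz_imp_hoelder:
  assumes "0 \<le> C" "a \<le> s" "s < t" "t \<le> b"
  shows "C * (t - s) \<le> C * (b - a) powr (1 - \<alpha>) * (t - s) powr \<alpha>"
proof -
  have "t - s = (t - s) powr (1 - \<alpha>) * (t - s) powr \<alpha>"
    using assms by (simp flip: powr_add)
  also have "\<dots> \<le> (b - a) powr (1 - \<alpha>) * (t - s) powr \<alpha>"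
    using assms exponent_le by (intro mult_right_mono powr_mono2) auto
  finally show ?thesis using assms(1) by (metis mult.assoc mult_left_mono)
qed

definition embed_const :: real where "embed_const = 1 + (b - a) powr (1 - \<alpha>)"

lemma embed_const_ge: "1 \<le> embed_const"
  by (simp add: embed_const_def)

lemma Hoelder_0_of_deriv:
  assumes "\<And>t. t \<notin> {a..b} \<Longrightarrow> x t = 0"
    and "\<And>t. t \<in> {a..b} \<Longrightarrow> (x has_vector_derivative d t) (at t within {a..b})"
    and "\<And>t. t \<in> {a..b} \<Longrightarrow> cmod (d t) \<le> C" "\<And>t. t \<in> {a..b} \<Longrightarrow> cmod (x t) \<le> C1" "0 \<le> C"
  shows "x \<in> H 0" "hnorm 0 x \<le> C1 + C * (b - a) powr (1 - \<alpha>)"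
proof -
  have c: "continuous_on {a..b} x"
    using assms(2) has_vector_derivative_continuous continuous_on_eq_continuous_within by blast
  have *: "cmod (x t - x s) \<le> C * (b - a) powr (1 - \<alpha>) * (t - s) powr \<alpha>" if "a \<le> s" "s < t" "t \<le> b" for s t
    using lipschitz_imp_hoelder[OF assms(5) that] deriv_bound_imp_lipschitz[OF assms(2,3) that] by linarith
  show "x \<in> H 0" "hnorm 0 x \<le> C1 + C * (b - a) powr (1 - \<alpha>)"
    using Hoelder_0I[OF assms(1) c assms(4) *] by auto
qed

text \<open>\<open>hnorm\<close> is not monotone in n, because the lower norm contains a Hoelder
  quotient that the higher one lacks. At n = 0 the mean value inequality bounds this quotient by the
  sup of the derivative, at the cost of \<open>(b - a) powr (1 - \<alpha>)\<close>; the induction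
  step passes to \<open>D x\<close>.\<close>

lemma Hoelder_Suc_subset:
  "x \<in> H (Suc n) \<Longrightarrow> x \<in> H n \<and> hnorm n x \<le> embed_const * hnorm (Suc n) x"
proof (induction n arbitrary: x)
  case 0
  have c: "continuous_on {a..b} x" "continuous_on {a..b} (D x)"
    using Hoelder_continuous[OF 0] Hoelder_continuous[OF Hoelder_D[OF 0]] by auto
  have "x \<in> H 0" "hnorm 0 x \<le> supnorm x + supnorm (D x) * (b - a) powr (1 - \<alpha>)"
    using Hoelder_0_of_deriv[OF Hoelder_outside[OF 0] Hoelder_Suc_deriv[OF 0] supnorm_upper[OF c(2)]
        supnorm_upper[OF c(1)] supnorm_nonneg[OF c(2)]] by auto
  moreover have "supnorm (D x) \<le> hnorm 0 (D x)"
    using supnorm_le_hnorm Hoelder_D[OF 0] by simp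
  moreover have "supnorm x + hnorm 0 (D x) * (b - a) powr (1 - \<alpha>) \<le> embed_const * hnorm (Suc 0) x"
    using supnorm_nonneg[OF c(1)] hnorm_nonneg[OF Hoelder_D[OF 0]]
    by (simp add: hnorm_Suc embed_const_def algebra_simps)
  ultimately show ?case by (smt (verit) mult_right_mono powr_ge_zero)
next
  case (Suc n)
  have IH: "D x \<in> H n" "hnorm n (D x) \<le> embed_const * hnorm (Suc n) (D x)"
    using Suc.IH[of "D x"] Hoelder_D[OF Suc.prems] by auto
  have "x \<in> H (Suc n)" using Suc.prems IH(1) by (auto simp: Hoelder_Suc_iff[of x])
  moreover have "hnorm (Suc n) x \<le> embed_const * hnorm (Suc (Suc n)) x"
    using IH(2) embed_const_ge supnorm_nonneg[OF Hoelder_continuous[OF Suc.prems]]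
      mult_right_mono[of 1 embed_const "supnorm x"]
    unfolding hnorm_Suc[of n x] hnorm_Suc[of "Suc n" x] by (simp add: distrib_left)
  ultimately show ?case by simp
qed

lemma Hoelder_le_subset:
  assumes "n \<le> k" "x \<in> H k"
  shows "x \<in> H n" "hnorm n x \<le> embed_const ^ (k - n) * hnorm k x"
proof -
  have "x \<in> H (n + j) \<Longrightarrow> x \<in> H n \<and> hnorm n x \<le> embed_const ^ j * hnorm (n + j) x" for j
  proof (induction j)
    case (Suc j)
    then have "x \<in> H (n + j)" "hnorm (n + j) x \<le> embed_const * hnorm (n + Suc j) x"
      using Hoelder_Suc_subset by auto
    moreover from this have "embed_const ^ j * hnorm (n + j) x \<le> embed_const ^ j * (embed_const * hnorm (n + Suc j) x)"
      using embed_const_ge by (intro mult_left_mono) auto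
    ultimately show ?case using Suc.IH by (auto simp: mult_ac)
  qed simp
  from this[of "k - n"] show "x \<in> H n" "hnorm n x \<le> embed_const ^ (k - n) * hnorm k x" using assms by auto
qed

section \<open>Products of Hoelder functions\<close>

primrec mult_const :: "nat \<Rightarrow> real" where
  "mult_const 0 = 1"
| "mult_const (Suc n) = 1 + 2 * mult_const n * embed_const"

lemma mult_const_ge: "1 \<le> mult_const n"
  by (induction n) (use embed_const_ge in auto)

text \<open>The recursion of \<open>mult_const\<close> is the Leibniz rule: two products of order n,
  in each of which the undifferentiated factor is measured in the lower norm at the price of
  \<open>embed_const\<close>, and 1 for the sup of the product itself.\<close>

lemma Hoelder_mult:
  assumes "x \<in> H n" "y \<in> H n"
  shows "(\<lambda>t. x t * y t) \<in> H n"
    and "hnorm n (\<lambda>t. x t * y t) \<le> mult_const n * hnorm n x * hnorm n y"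
proof -
  have sup: "cmod (x t * y t) \<le> supnorm x * supnorm y"
    if "continuous_on {a..b} x" "continuous_on {a..b} y" "t \<in> {a..b}" for x y t
    using supnorm_upper[OF that(1,3)] supnorm_upper[OF that(2,3)] supnorm_nonneg[OF that(1)]
    by (auto simp: norm_mult intro!: mult_mono)
  have "(\<lambda>t. x t * y t) \<in> H n \<and> hnorm n (\<lambda>t. x t * y t) \<le> mult_const n * hnorm n x * hnorm n y"
    using assms
  proof (induction n arbitrary: x y)
    case 0
    have x: "continuous_on {a..b} x" "bdd_above (quotients x)"
      and y: "continuous_on {a..b} y" "bdd_above (quotients y)"
      using 0 by (auto simp: Hoelder_0_iff)
    have semi: "cmod (x t * y t - x s * y s) \<le>
        (supnorm x * seminorm y + seminorm x * supnorm y) * (t - s) powr \<alpha>" if "a \<le> s" "s < t" "t \<le> b" for s t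
    proof -
      have "cmod (x t * y t - x s * y s) = cmod (x t * (y t - y s) + (x t - x s) * y s)"
        by (simp add: algebra_simps)
      also have "\<dots> \<le> cmod (x t) * cmod (y t - y s) + cmod (x t - x s) * cmod (y s)"
        by (metis norm_mult norm_triangle_ineq)
      also have "\<dots> \<le> supnorm x * (seminorm y * \<bar>t - s\<bar> powr \<alpha>) + seminorm x * \<bar>t - s\<bar> powr \<alpha> * supnorm y"
        using that
        by (intro add_mono mult_mono seminorm_upper supnorm_upper x y)
           (auto simp: supnorm_nonneg seminorm_nonneg x y)
      finally show ?thesis using that by (simp add: algebra_simps)
    qed
    have "(\<lambda>t. x t * y t) \<in> H 0" "hnorm 0 (\<lambda>t. x t * y t) \<le>
        supnorm x * supnorm y + (supnorm x * seminorm y + seminorm x * supnorm y)"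
      using Hoelder_0I[OF _ _ sup[OF x(1) y(1)] semi] x(1) y(1) Hoelder_outside[OF 0(1)]
      by (auto intro!: continuous_intros)
    \<comment> \<open>The one term by which the product of the two norms exceeds the bound just
      obtained; hence the constant 1 at n = 0.\<close>
    moreover have "0 \<le> seminorm x * seminorm y" using x y seminorm_nonneg by simp
    ultimately show ?case by (simp add: hnorm_0 algebra_simps)
  next
    case (Suc n)
    have c: "continuous_on {a..b} x" "continuous_on {a..b} y" using Suc.prems Hoelder_continuous by auto
    have d: "((\<lambda>t. x t * y t) has_vector_derivative 1 * (x t * D y t) + 1 * (D x t * y t)) (at t within {a..b})"
      if "t \<in> {a..b}" for t
      using has_vector_derivative_mult[OF Hoelder_Suc_deriv[OF Suc.prems(1) that]
          Hoelder_Suc_deriv[OF Suc.prems(2) that]] by simp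
    have x: "x \<in> H n" "hnorm n x \<le> embed_const * hnorm (Suc n) x" "D x \<in> H n" "0 \<le> hnorm n (D x)"
      and y: "y \<in> H n" "hnorm n y \<le> embed_const * hnorm (Suc n) y" "D y \<in> H n" "0 \<le> hnorm n (D y)"
      using Suc.prems Hoelder_Suc_subset Hoelder_D hnorm_nonneg by auto
    have s: "0 \<le> supnorm x" "0 \<le> supnorm y" using c supnorm_nonneg by auto
    define X Y where "X = hnorm (Suc n) x" and "Y = hnorm (Suc n) y"
    have XY: "supnorm x \<le> X" "supnorm y \<le> Y" "hnorm n (D x) \<le> X" "hnorm n (D y) \<le> Y" "0 \<le> X" "0 \<le> Y"
      using s x y by (auto simp: X_def Y_def hnorm_Suc)
    have IH1: "(\<lambda>t. x t * D y t) \<in> H n" "hnorm n (\<lambda>t. x t * D y t) \<le> mult_const n * hnorm n x * hnorm n (D y)"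
      using Suc.IH x y by auto
    have IH2: "(\<lambda>t. D x t * y t) \<in> H n" "hnorm n (\<lambda>t. D x t * y t) \<le> mult_const n * hnorm n (D x) * hnorm n y"
      using Suc.IH x y by auto
    have b1: "mult_const n * hnorm n x * hnorm n (D y) \<le> mult_const n * (embed_const * X) * Y"
      using x y XY mult_const_ge[of n] embed_const_ge hnorm_nonneg[OF x(1)]
      by (intro mult_mono) (auto simp: X_def)
    have b2: "mult_const n * hnorm n (D x) * hnorm n y \<le> mult_const n * X * (embed_const * Y)"
      using x y XY mult_const_ge[of n] embed_const_ge hnorm_nonneg[OF y(1)]
      by (intro mult_mono) (auto simp: Y_def)
    have dd: "(\<lambda>t. 1 * (x t * D y t) + 1 * (D x t * y t)) \<in> H n"
      "hnorm n (\<lambda>t. 1 * (x t * D y t) + 1 * (D x t * y t)) \<le>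
        mult_const n * (embed_const * X) * Y + mult_const n * X * (embed_const * Y)"
      using Hoelder_lincomb[OF IH1(1) IH2(1), of 1 1] IH1(2) IH2(2) b1 b2 unfolding norm_one mult_1 by linarith+
    have b3: "supnorm x * supnorm y \<le> X * Y" using XY s by (intro mult_mono) auto
    show ?case
      using Hoelder_SucI[OF _ d dd(1) sup[OF c] dd(2)] Hoelder_outside[OF Suc.prems(1)] b3
      unfolding X_def[symmetric] Y_def[symmetric] by (auto simp: algebra_simps)
  qed
  then show "(\<lambda>t. x t * y t) \<in> H n"
    and "hnorm n (\<lambda>t. x t * y t) \<le> mult_const n * hnorm n x * hnorm n y" by auto
qed

section \<open>Integration from the left end point\<close>

definition integ :: "(real \<Rightarrow> complex) \<Rightarrow> real \<Rightarrow> complex" where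
  "integ x = (\<lambda>t. if t \<in> {a..b} then integral {a..t} x else 0)"

lemma integ_outside: "t \<notin> {a..b} \<Longrightarrow> integ x t = 0"
  by (auto simp: integ_def)

lemma integ_start: "integ x a = 0"
  using a_less_b by (simp add: integ_def)

lemma integ_deriv:
  assumes "continuous_on {a..b} x" "t \<in> {a..b}"
  shows "(integ x has_vector_derivative x t) (at t within {a..b})"
  by (rule has_vector_derivative_transform[OF assms(2) _ integral_has_vector_derivative[OF assms]])
     (auto simp: integ_def)

lemma D_integ: "x \<in> H n \<Longrightarrow> D (integ x) = x"
  by (intro D_eqI_fun integ_deriv Hoelder_continuous Hoelder_outside)

lemma integ_bound:
  assumes "continuous_on {a..b} x" "\<And>t. t \<in> {a..b} \<Longrightarrow> cmod (x t) \<le> C" "0 \<le> C"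
  shows "cmod (integ x t) \<le> C * (b - a)"
proof (cases "t \<in> {a..b}")
  case True
  have "cmod (integral {a..t} x) \<le> C * (t - a)"
    by (rule integral_bound) (use assms True in \<open>auto intro: continuous_on_subset\<close>)
  also have "\<dots> \<le> C * (b - a)" using True assms by (intro mult_left_mono) auto
  finally show ?thesis using True by (simp add: integ_def)
qed (use assms a_less_b in \<open>auto simp: integ_def\<close>)

lemma integ_Hoelder:
  assumes "x \<in> H n"
  shows "integ x \<in> H (Suc n)" "hnorm (Suc n) (integ x) \<le> (1 + (b - a)) * hnorm n x"
proof -
  have "integ x \<in> H (Suc n)" "hnorm (Suc n) (integ x) \<le> hnorm n x * (b - a) + hnorm n x"
    using Hoelder_SucI[OF integ_outside integ_deriv[OF Hoelder_continuous[OF assms]] assms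
      integ_bound[OF Hoelder_continuous[OF assms] norm_le_hnorm[OF assms] hnorm_nonneg[OF assms]], of "hnorm n x"]
    by auto
  then show "integ x \<in> H (Suc n)" "hnorm (Suc n) (integ x) \<le> (1 + (b - a)) * hnorm n x"
    by (auto simp: algebra_simps)
qed

text \<open>The bound involves the sup of x but not its Hoelder quotients, since the primitive is
  Lipschitz with that sup as constant. This is the passage from sup estimates to estimates in
  \<open>H 0\<close>.\<close>

lemma integ_Hoelder_0:
  assumes "x \<in> H 0" "\<And>t. t \<in> {a..b} \<Longrightarrow> cmod (x t) \<le> C" "0 \<le> C"
  shows "integ x \<in> H 0" "hnorm 0 (integ x) \<le> C * (embed_const + (b - a))"
  using Hoelder_0_of_deriv[OF integ_outside integ_deriv[OF Hoelder_continuous[OF assms(1)]] assms(2)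
      integ_bound[OF Hoelder_continuous[OF assms(1)] assms(2,3)] assms(3)] assms(3)
  by (auto simp: algebra_simps embed_const_def)

text \<open>Integration reproduces the exponential weight up to the factor 1 / \<kappa>, so a large
  \<kappa> makes integration small on the whole interval at once. The contribution of the lower
  limit is non-positive and is dropped.\<close>

lemma integ_weighted:
  assumes "continuous_on {a..b} x" "\<And>t. t \<in> {a..b} \<Longrightarrow> cmod (x t) \<le> Q * exp (\<kappa> * (t - a))"
    "t \<in> {a..b}" "0 < \<kappa>" "0 \<le> Q"
  shows "cmod (integ x t) \<le> Q / \<kappa> * exp (\<kappa> * (t - a))"
proof -
  have i: "((\<lambda>s. Q * exp (\<kappa> * (s - a))) has_integral
      (Q / \<kappa> * exp (\<kappa> * (t - a)) - Q / \<kappa> * exp (\<kappa> * (a - a)))) {a..t}"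
    using assms
    by (intro fundamental_theorem_of_calculus)
       (auto intro!: derivative_eq_intros simp: has_real_derivative_iff_has_vector_derivative[symmetric])
  have "cmod (integral {a..t} x) \<le> integral {a..t} (\<lambda>s. Q * exp (\<kappa> * (s - a)))"
    using assms i by (intro integral_norm_bound_integral integrable_continuous_real)
       (auto intro: continuous_on_subset intro!: continuous_intros)
  also have "\<dots> \<le> Q / \<kappa> * exp (\<kappa> * (t - a))"
    unfolding integral_unique[OF i] using assms by simp
  finally show ?thesis using assms by (simp add: integ_def)
qed

lemma integ_lincomb:
  assumes "x \<in> H n" "y \<in> H n"
  shows "integ (\<lambda>t. p * x t + q * y t) = (\<lambda>t. p * integ x t + q * integ y t)"
proof
  fix t
  show "integ (\<lambda>t. p * x t + q * y t) t = p * integ x t + q * integ y t"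
  proof (cases "t \<in> {a..b}")
    case True
    have "x integrable_on {a..t}" "y integrable_on {a..t}"
      using True assms Hoelder_continuous
      by (auto intro!: integrable_continuous_real intro: continuous_on_subset[of "{a..b}"])
    then show ?thesis using True by (simp add: integ_def integral_add integrable_on_mult_right)
  qed (auto simp: integ_def)
qed

lemma integ_D:
  assumes "x \<in> H (Suc n)" "x a = 0"
  shows "integ (D x) = x"
proof
  fix t
  show "integ (D x) t = x t"
  proof (cases "t \<in> {a..b}")
    case True
    have "(D x has_integral x t - x a) {a..t}"
      using True by (intro fundamental_theorem_of_calculus)
        (auto intro: has_vector_derivative_within_subset[OF Hoelder_Suc_deriv[OF assms(1)]])
    then show ?thesis using True assms by (simp add: integ_def integral_unique)
  qed (use Hoelder_outside[OF assms(1)] in \<open>auto simp: integ_def\<close>)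
qed

text \<open>Completeness in the form of absolutely summable series. At n = 0 the series is uniformly
  convergent and Hoelder quotients are summed termwise; the induction step differentiates
  termwise.\<close>

lemma Hoelder_series:
  assumes "\<And>k. x k \<in> H n" "\<And>k. hnorm n (x k) \<le> g k" "summable g"
  shows "(\<lambda>t. \<Sum>k. x k t) \<in> H n" "hnorm n (\<lambda>t. \<Sum>k. x k t) \<le> suminf g"
proof -
  \<comment> \<open>The three auxiliary facts are stated for arbitrary \<open>x\<close>,
    \<open>g\<close> and \<open>n\<close>, because the induction replaces the terms by their
    derivatives and the majorant by the norms of these.\<close>
  have pw: "summable (\<lambda>k. cmod (x k t))" if "\<And>k. x k \<in> H n" "\<And>k. hnorm n (x k) \<le> g k" "summable g"
    for t x g n
    using norm_le_hnorm[OF that(1)] that(2) by (intro summable_comparison_test'[OF that(3)]) (auto intro: order_trans)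
  have sup: "summable (\<lambda>k. supnorm (x k)) \<and>
      (\<forall>t\<in>{a..b}. cmod (\<Sum>k. x k t) \<le> (\<Sum>k. supnorm (x k)))"
    if "\<And>k. x k \<in> H n" "\<And>k. hnorm n (x k) \<le> g k" "summable g" for x g n
  proof -
    note pw_x = pw[OF that] and cont_x = Hoelder_continuous[OF that(1)]
    have s: "summable (\<lambda>k. supnorm (x k))"
      using supnorm_le_hnorm[OF that(1)] that(2) supnorm_nonneg[OF Hoelder_continuous[OF that(1)]]
      by (intro summable_comparison_test'[OF that(3)]) (auto intro: order_trans)
    have "cmod (\<Sum>k. x k t) \<le> (\<Sum>k. supnorm (x k))" if t: "t \<in> {a..b}" for t
    proof -
      have "cmod (\<Sum>k. x k t) \<le> (\<Sum>k. cmod (x k t))" by (intro summable_norm pw_x)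
      also have "\<dots> \<le> (\<Sum>k. supnorm (x k))"
        by (intro suminf_le supnorm_upper cont_x t pw_x s)
      finally show ?thesis .
    qed
    then show ?thesis using s by auto
  qed
  have unif: "uniform_limit {a..b} (\<lambda>N t. \<Sum>k<N. x k t) (\<lambda>t. \<Sum>k. x k t) sequentially"
    if "\<And>k. x k \<in> H n" "\<And>k. hnorm n (x k) \<le> g k" "summable g" for x g n
    using norm_le_hnorm[OF that(1)] that(2) by (intro Weierstrass_m_test[OF _ that(3)]) (auto intro: order_trans)
  have "(\<lambda>t. \<Sum>k. x k t) \<in> H n \<and> hnorm n (\<lambda>t. \<Sum>k. x k t) \<le> suminf g"
    using assms
  proof (induction n arbitrary: x g)
    case 0
    have q: "bdd_above (quotients (x k))" for k using 0 by (auto simp: Hoelder_0_iff)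
    have sn: "seminorm (x k) \<ge> 0" for k using q seminorm_nonneg by simp
    have s: "summable (\<lambda>k. seminorm (x k))"
      using 0(2) supnorm_nonneg[OF Hoelder_continuous[OF 0(1)]] seminorm_nonneg[OF q]
      by (intro summable_comparison_test'[OF 0(3)]) (smt (verit) hnorm_0 real_norm_def)
    have c: "continuous_on {a..b} (\<lambda>t. \<Sum>k. x k t)"
      using Hoelder_continuous[OF 0(1)]
      by (intro uniform_limit_theorem[OF _ unif[OF 0]] always_eventually allI continuous_on_sum) auto
    have semi: "cmod ((\<Sum>k. x k t) - (\<Sum>k. x k u)) \<le> (\<Sum>k. seminorm (x k)) * (t - u) powr \<alpha>"
      if "a \<le> u" "u < t" "t \<le> b" for t u
    proof -
      have le: "cmod (x k t - x k u) \<le> seminorm (x k) * (t - u) powr \<alpha>" for k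
        using seminorm_upper[OF q[of k], of u t] that by auto
      have s2: "summable (\<lambda>k. seminorm (x k) * (t - u) powr \<alpha>)" by (intro summable_mult2 s)
      have s3: "summable (\<lambda>k. cmod (x k t - x k u))"
        by (rule summable_comparison_test'[OF s2]) (use le in auto)
      have "cmod ((\<Sum>k. x k t) - (\<Sum>k. x k u)) = cmod (\<Sum>k. x k t - x k u)"
        using pw[OF 0] by (simp add: suminf_diff summable_norm_cancel)
      also have "\<dots> \<le> (\<Sum>k. cmod (x k t - x k u))" by (intro summable_norm s3)
      also have "\<dots> \<le> (\<Sum>k. seminorm (x k) * (t - u) powr \<alpha>)" by (intro suminf_le le s2 s3)
      finally show ?thesis using s by (simp add: suminf_mult2)
    qed
    have "(\<Sum>k. supnorm (x k)) + (\<Sum>k. seminorm (x k)) = (\<Sum>k. hnorm 0 (x k))"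
      using s sup[OF 0] by (simp add: hnorm_0 suminf_add)
    also have "\<dots> \<le> suminf g"
      using s sup[OF 0] by (intro suminf_le 0) (simp add: hnorm_0 summable_add)
    finally show ?case
      using Hoelder_0I[OF _ c _ semi] sup[OF 0] Hoelder_outside[OF 0(1)] by fastforce
  next
    case (Suc n)
    have s: "summable (\<lambda>k. supnorm (x k))" using sup[OF Suc.prems] by simp
    have s2: "summable (\<lambda>k. hnorm n (D (x k)))"
    proof (rule summable_comparison_test'[OF Suc.prems(3)])
      show "norm (hnorm n (D (x k))) \<le> g k" for k
        using Suc.prems(2)[of k] hnorm_nonneg[OF Hoelder_D[OF Suc.prems(1)[of k]]]
          supnorm_nonneg[OF Hoelder_continuous[OF Suc.prems(1)[of k]]] by (simp add: hnorm_Suc)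
    qed
    note IH = Suc.IH[of "\<lambda>k. D (x k)", OF Hoelder_D[OF Suc.prems(1)] order_refl s2]
    \<comment> \<open>Termwise differentiation: the series converges at a, and the series of
      derivatives converges uniformly.\<close>
    have "\<exists>G. \<forall>t\<in>{a..b}. (\<lambda>k. x k t) sums G t \<and>
       (G has_derivative (\<lambda>h. h *\<^sub>R (\<Sum>k. D (x k) t))) (at t within {a..b})"
    proof (rule has_derivative_series)
      show "(x k has_derivative (\<lambda>h. h *\<^sub>R D (x k) t)) (at t within {a..b})" if "t \<in> {a..b}" for k t
        using Hoelder_Suc_deriv[OF Suc.prems(1) that] by (simp add: has_vector_derivative_def)
      show "(\<lambda>k. x k a) sums (\<Sum>k. x k a)" by (intro summable_sums summable_norm_cancel[OF pw[OF Suc.prems]])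
      show "a \<in> {a..b}" using a_less_b by simp
      fix e :: real assume "0 < e"
      then have "\<forall>\<^sub>F N in sequentially. \<forall>t\<in>{a..b}. dist (\<Sum>k<N. D (x k) t) (\<Sum>k. D (x k) t) < e"
        using unif[of "\<lambda>k. D (x k)", OF Hoelder_D[OF Suc.prems(1)] order_refl s2]
        by (simp add: uniform_limit_iff)
      then show "\<forall>\<^sub>F N in sequentially. \<forall>t\<in>{a..b}. \<forall>h.
        norm ((\<Sum>i<N. h *\<^sub>R D (x i) t) - h *\<^sub>R (\<Sum>k. D (x k) t)) \<le> e * norm h"
      proof (rule eventually_mono, intro ballI allI)
        fix N t h assume *: "\<forall>t\<in>{a..b}. dist (\<Sum>k<N. D (x k) t) (\<Sum>k. D (x k) t) < e" "t \<in> {a..b}"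
        have "norm ((\<Sum>i<N. h *\<^sub>R D (x i) t) - h *\<^sub>R (\<Sum>k. D (x k) t))
          = norm h * norm ((\<Sum>k<N. D (x k) t) - (\<Sum>k. D (x k) t))"
          by (simp flip: scaleR_sum_right scaleR_right_diff_distrib)
        also have "\<dots> \<le> norm h * e" using * by (intro mult_left_mono) (auto simp: dist_norm less_imp_le)
        finally show "norm ((\<Sum>i<N. h *\<^sub>R D (x i) t) - h *\<^sub>R (\<Sum>k. D (x k) t)) \<le> e * norm h"
          by (simp add: mult.commute)
      qed
    qed auto
    then obtain G where G: "\<And>t. t\<in>{a..b} \<Longrightarrow> (\<lambda>k. x k t) sums G t"
       "\<And>t. t\<in>{a..b} \<Longrightarrow> (G has_vector_derivative (\<Sum>k. D (x k) t)) (at t within {a..b})"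
      unfolding has_vector_derivative_def by blast
    have d: "((\<lambda>t. \<Sum>k. x k t) has_vector_derivative (\<Sum>k. D (x k) t)) (at t within {a..b})"
      if "t \<in> {a..b}" for t
      by (rule has_vector_derivative_transform[OF that _ G(2)[OF that]]) (rule sums_unique[symmetric], rule G(1))
    have "(\<Sum>k. supnorm (x k)) + (\<Sum>k. hnorm n (D (x k))) = (\<Sum>k. hnorm (Suc n) (x k))"
      using s s2 by (simp add: hnorm_Suc suminf_add)
    also have "\<dots> \<le> suminf g"
      using s s2 by (intro suminf_le Suc.prems) (simp add: hnorm_Suc summable_add)
    finally show ?case
      using Hoelder_SucI[OF _ d conjunct1[OF IH] _ conjunct2[OF IH]] sup[OF Suc.prems] Hoelder_outside[OF Suc.prems(1)]
      by fastforce
  qed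
  then show "(\<lambda>t. \<Sum>k. x k t) \<in> H n" "hnorm n (\<lambda>t. \<Sum>k. x k t) \<le> suminf g" by auto
qed

lemma Hoelder_sum:
  assumes "finite S" "\<And>s. s \<in> S \<Longrightarrow> x s \<in> H n"
  shows "(\<lambda>t. \<Sum>s\<in>S. x s t) \<in> H n" "hnorm n (\<lambda>t. \<Sum>s\<in>S. x s t) \<le> (\<Sum>s\<in>S. hnorm n (x s))"
proof -
  have "(\<lambda>t. \<Sum>s\<in>S. x s t) \<in> H n \<and> hnorm n (\<lambda>t. \<Sum>s\<in>S. x s t) \<le> (\<Sum>s\<in>S. hnorm n (x s))"
    using assms
  proof (induction S rule: finite_induct)
    case empty
    then show ?case by (simp add: Hoelder_zero)
  next
    case (insert s S)
    then show ?case using Hoelder_lincomb[of "x s" n "\<lambda>t. \<Sum>s\<in>S. x s t" 1 1] by fastforce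
  qed
  then show "(\<lambda>t. \<Sum>s\<in>S. x s t) \<in> H n" "hnorm n (\<lambda>t. \<Sum>s\<in>S. x s t) \<le> (\<Sum>s\<in>S. hnorm n (x s))" by auto
qed

section \<open>Iterated derivatives and integrals\<close>

lemma funpow_D_Hoelder:
  "x \<in> H (n + k) \<Longrightarrow> (D ^^ k) x \<in> H n \<and> hnorm n ((D ^^ k) x) \<le> hnorm (n + k) x"
proof (induction k arbitrary: x)
  case (Suc k)
  have "D x \<in> H (n + k)" "hnorm (n + k) (D x) \<le> hnorm (n + Suc k) x"
    using Suc.prems supnorm_nonneg[OF Hoelder_continuous[OF Suc.prems]] by (auto simp: Hoelder_D hnorm_Suc)
  then show ?case using Suc.IH[of "D x"] by (auto simp: funpow_swap1)
qed simp

lemma funpow_D_lincomb: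
  "x \<in> H (n + k) \<Longrightarrow> y \<in> H (n + k) \<Longrightarrow>
    (D ^^ k) (\<lambda>t. p * x t + q * y t) = (\<lambda>t. p * (D ^^ k) x t + q * (D ^^ k) y t)"
proof (induction k arbitrary: x y)
  case (Suc k)
  have "(D ^^ Suc k) (\<lambda>t. p * x t + q * y t) = (D ^^ k) (\<lambda>t. p * D x t + q * D y t)"
    using D_lincomb[of x "n + k" y p q] Suc.prems by (simp add: funpow_swap1)
  also have "\<dots> = (\<lambda>t. p * (D ^^ k) (D x) t + q * (D ^^ k) (D y) t)"
    using Suc.IH[of "D x" "D y"] Suc.prems by (simp add: Hoelder_D)
  finally show ?case by (simp add: funpow_swap1)
qed simp

lemma funpow_D_zero: "(D ^^ k) (\<lambda>t. 0) = (\<lambda>t. 0)"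
proof (induction k)
  case (Suc k)
  have "D (\<lambda>t. 0) = (\<lambda>t. 0)" by (rule D_eqI_fun) auto
  then show ?case using Suc by (simp add: funpow_swap1)
qed simp

lemma funpow_integ_Hoelder:
  assumes "x \<in> H n"
  shows "(integ ^^ j) x \<in> H (n + j) \<and> hnorm (n + j) ((integ ^^ j) x) \<le> (1 + (b - a)) ^ j * hnorm n x"
proof (induction j)
  case (Suc j)
  have "hnorm (n + Suc j) ((integ ^^ Suc j) x) \<le> (1 + (b - a)) * hnorm (n + j) ((integ ^^ j) x)"
    using integ_Hoelder[of "(integ ^^ j) x" "n + j"] Suc by simp
  also have "\<dots> \<le> (1 + (b - a)) * ((1 + (b - a)) ^ j * hnorm n x)"
    using Suc a_less_b by (intro mult_left_mono) auto
  finally show ?case using integ_Hoelder[of "(integ ^^ j) x" "n + j"] Suc by (simp add: mult_ac)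
qed (use assms in simp)

lemma funpow_integ_lincomb:
  assumes "x \<in> H n" "y \<in> H n"
  shows "(integ ^^ j) (\<lambda>t. p * x t + q * y t) = (\<lambda>t. p * (integ ^^ j) x t + q * (integ ^^ j) y t)"
proof (induction j)
  case (Suc j)
  then show ?case
    using integ_lincomb[of "(integ ^^ j) x" "n + j" "(integ ^^ j) y" p q] funpow_integ_Hoelder assms by simp
qed simp

lemma funpow_integ_weighted:
  assumes "x \<in> H n" "\<And>t. t \<in> {a..b} \<Longrightarrow> cmod (x t) \<le> Q * exp (\<kappa> * (t - a))" "0 < \<kappa>" "0 \<le> Q" "t \<in> {a..b}"
  shows "cmod ((integ ^^ j) x t) \<le> Q / \<kappa> ^ j * exp (\<kappa> * (t - a))"
  using assms(5)
proof (induction j arbitrary: t)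
  case (Suc j)
  have "continuous_on {a..b} ((integ ^^ j) x)"
    using funpow_integ_Hoelder[OF assms(1)] Hoelder_continuous by blast
  from integ_weighted[OF this Suc.IH Suc.prems assms(3)] assms show ?case by (simp add: mult.commute)
qed (use assms in simp)

text \<open>The first j - 1 integrations propagate a sup bound, and the last one turns it into
  control of the Hoelder quotient; this is why j must be positive.\<close>

lemma funpow_integ_bound:
  assumes "x \<in> H 0" "\<And>t. t \<in> {a..b} \<Longrightarrow> cmod (x t) \<le> C" "0 \<le> C" "0 < j"
  shows "(integ ^^ j) x \<in> H 0" "hnorm 0 ((integ ^^ j) x) \<le> C * (embed_const + (b - a)) ^ j"
proof -
  let ?c = "embed_const + (b - a)"
  have c: "0 \<le> ?c" using embed_const_ge a_less_b by simp
  have *: "(integ ^^ j) x \<in> H 0 \<and> (\<forall>t\<in>{a..b}. cmod ((integ ^^ j) x t) \<le> C * ?c ^ j)" for j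
  proof (induction j)
    case (Suc j)
    then have "integ ((integ ^^ j) x) \<in> H 0" "hnorm 0 (integ ((integ ^^ j) x)) \<le> C * ?c ^ j * ?c"
      using integ_Hoelder_0[of "(integ ^^ j) x" "C * ?c ^ j"] assms c by auto
    then show ?case using norm_le_hnorm[of "integ ((integ ^^ j) x)" 0] by (auto simp: mult_ac intro: order_trans)
  qed (use assms in simp)
  obtain j' where j: "j = Suc j'" using assms(4) by (cases j) auto
  show "(integ ^^ j) x \<in> H 0" using * by simp
  show "hnorm 0 ((integ ^^ j) x) \<le> C * ?c ^ j"
    using integ_Hoelder_0[of "(integ ^^ j') x" "C * ?c ^ j'"] *[of j'] assms c by (auto simp: j mult_ac)
qed

end

section \<open>Vector-valued Hoelder functions\<close>

locale hoelder_system = hoelder_interval +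
  fixes m r :: nat
begin

abbreviation "VH n \<equiv> VHoelder m n \<alpha> a b"
abbreviation "vn n \<equiv> vnorm m n \<alpha> a b"
abbreviation "MH n \<equiv> MHoelder m n \<alpha> a b"
abbreviation "mn n \<equiv> mnorm m n \<alpha> a b"

definition lincomb :: "complex \<Rightarrow> (nat \<Rightarrow> real \<Rightarrow> complex) \<Rightarrow> complex \<Rightarrow> (nat \<Rightarrow> real \<Rightarrow> complex) \<Rightarrow> nat \<Rightarrow> real \<Rightarrow> complex"
  where "lincomb p y q z = (\<lambda>i t. p * y i t + q * z i t)"

abbreviation "zerov \<equiv> (\<lambda>i t. 0 :: complex) :: nat \<Rightarrow> real \<Rightarrow> complex"
abbreviation "diffv y z \<equiv> lincomb 1 y (-1) z"

lemma diffv_eq: "diffv y z = (\<lambda>i t. y i t - z i t)"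
  by (simp add: lincomb_def)

lemma VH_I: "(\<And>i. i < m \<Longrightarrow> y i \<in> H n) \<Longrightarrow> (\<And>i. m \<le> i \<Longrightarrow> y i = (\<lambda>t. 0)) \<Longrightarrow> y \<in> VH n"
  by (auto simp: VHoelder_def)

lemma VH_component: "y \<in> VH n \<Longrightarrow> y i \<in> H n"
  by (cases "i < m") (auto simp: VHoelder_def Hoelder_zero)

lemma VH_beyond: "y \<in> VH n \<Longrightarrow> m \<le> i \<Longrightarrow> y i = (\<lambda>t. 0)"
  by (auto simp: VHoelder_def)

lemma VH_zero: "zerov \<in> VH n" "vn n zerov = 0"
  by (auto simp: VHoelder_def Hoelder_zero vnorm_def)

lemma VH_lincomb:
  assumes "y \<in> VH n" "z \<in> VH n"
  shows "lincomb p y q z \<in> VH n" "vn n (lincomb p y q z) \<le> cmod p * vn n y + cmod q * vn n z"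
proof -
  show "lincomb p y q z \<in> VH n"
    using Hoelder_lincomb assms by (auto simp: VHoelder_def lincomb_def)
  have "vn n (lincomb p y q z) \<le> (\<Sum>i<m. cmod p * hnorm n (y i) + cmod q * hnorm n (z i))"
    unfolding vnorm_def lincomb_def by (intro sum_mono Hoelder_lincomb VH_component[OF assms(1)] VH_component[OF assms(2)])
  also have "\<dots> = cmod p * vn n y + cmod q * vn n z"
    by (simp add: vnorm_def sum.distrib sum_distrib_left)
  finally show "vn n (lincomb p y q z) \<le> cmod p * vn n y + cmod q * vn n z" .
qed

lemma vn_nonneg: "y \<in> VH n \<Longrightarrow> 0 \<le> vn n y"
  unfolding vnorm_def by (intro sum_nonneg hnorm_nonneg VH_component)

lemma hnorm_le_vn: "y \<in> VH n \<Longrightarrow> hnorm n (y i) \<le> vn n y"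
proof (cases "i < m")
  case True
  assume y: "y \<in> VH n"
  show ?thesis unfolding vnorm_def
    by (rule member_le_sum) (use True hnorm_nonneg[OF VH_component[OF y]] in auto)
qed (simp add: VH_beyond Hoelder_zero vn_nonneg)

lemma norm_le_vn: "y \<in> VH n \<Longrightarrow> cmod (y i t) \<le> vn n y"
  using hnorm_le_vn norm_le_hnorm VH_component order_trans by meson

lemma vn_eq_0D: "y \<in> VH n \<Longrightarrow> vn n y \<le> 0 \<Longrightarrow> y = zerov"
  using norm_le_vn by (metis norm_le_zero_iff order_trans ext)

lemma vn_triangle:
  assumes "y \<in> VH n" "z \<in> VH n"
  shows "vn n y \<le> vn n z + vn n (diffv y z)"
proof -
  have "y = lincomb 1 z 1 (diffv y z)" by (simp add: lincomb_def)
  then show ?thesis using VH_lincomb(2)[OF assms(2) VH_lincomb(1)[OF assms, of 1 "-1"], of 1 1] by simp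
qed

lemma vn_diff_comm:
  assumes "y \<in> VH n" "z \<in> VH n"
  shows "vn n (diffv y z) = vn n (diffv z y)"
proof -
  have *: "vn n (diffv y z) \<le> vn n (diffv z y)" if "y \<in> VH n" "z \<in> VH n" for y z
  proof -
    have "diffv y z = lincomb (-1) (diffv z y) 0 zerov" by (simp add: lincomb_def)
    then show ?thesis
      using VH_lincomb(2)[OF VH_lincomb(1)[OF that(2,1), of 1 "-1"] VH_zero(1), of "-1" 0] by simp
  qed
  show ?thesis using *[OF assms] *[OF assms(2,1)] by simp
qed

lemma VH_le_subset:
  assumes "n \<le> k" "y \<in> VH k"
  shows "y \<in> VH n" "vn n y \<le> embed_const ^ (k - n) * vn k y"
proof -
  show "y \<in> VH n" using assms Hoelder_le_subset by (auto simp: VHoelder_def)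
  show "vn n y \<le> embed_const ^ (k - n) * vn k y"
    unfolding vnorm_def sum_distrib_left
    by (intro sum_mono Hoelder_le_subset(2) assms(1) VH_component[OF assms(2)])
qed

lemma VH_sum:
  assumes "finite S" "\<And>s. s \<in> S \<Longrightarrow> x s \<in> VH n"
  shows "(\<lambda>i t. \<Sum>s\<in>S. x s i t) \<in> VH n" "vn n (\<lambda>i t. \<Sum>s\<in>S. x s i t) \<le> (\<Sum>s\<in>S. vn n (x s))"
proof -
  show "(\<lambda>i t. \<Sum>s\<in>S. x s i t) \<in> VH n"
    using assms Hoelder_sum(1)[OF assms(1)] by (auto simp: VHoelder_def)
  have "vn n (\<lambda>i t. \<Sum>s\<in>S. x s i t) \<le> (\<Sum>i<m. \<Sum>s\<in>S. hnorm n (x s i))"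
    unfolding vnorm_def by (intro sum_mono Hoelder_sum assms VH_component)
  also have "\<dots> = (\<Sum>s\<in>S. vn n (x s))" unfolding vnorm_def by (rule sum.swap)
  finally show "vn n (\<lambda>i t. \<Sum>s\<in>S. x s i t) \<le> (\<Sum>s\<in>S. vn n (x s))" .
qed

text \<open>Completeness of the vector-valued space, with the error of the partial sums measured by
  the tail of the majorant. It supplies the limit of the Neumann series and that of the gliding
  hump.\<close>

lemma VH_series:
  fixes g :: "nat \<Rightarrow> real"
  assumes "\<And>k. x k \<in> VH n" "\<And>k. vn n (x k) \<le> g k" "summable g"
  obtains w where "w \<in> VH n" "\<And>N. vn n (diffv w (\<lambda>i t. \<Sum>k<N. x k i t)) \<le> (\<Sum>k. g (k + N))"
proof
  let ?w = "\<lambda>i t. \<Sum>k. x k i t"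
  have le: "hnorm n (x k i) \<le> g k" for k i
    using hnorm_le_vn[OF assms(1)] assms(2) order_trans by blast
  show "?w \<in> VH n"
    using Hoelder_series(1)[OF VH_component[OF assms(1)] le assms(3)] VH_beyond[OF assms(1)]
    by (intro VH_I) auto
  fix N
  have s: "summable (\<lambda>k. x k i t)" for i t
    using order_trans[OF norm_le_vn[OF assms(1)] assms(2)]
    by (intro summable_norm_cancel[OF summable_comparison_test'[OF assms(3), of 0]]) auto
  have sh: "summable (\<lambda>k. hnorm n (x (k + N) i))" for i
    using le hnorm_nonneg[OF VH_component[OF assms(1)]]
    by (intro summable_comparison_test'[OF summable_ignore_initial_segment[OF assms(3), of N], of 0]) auto
  have "diffv ?w (\<lambda>i t. \<Sum>k<N. x k i t) i = (\<lambda>t. \<Sum>k. x (k + N) i t)" for i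
    using suminf_minus_initial_segment[OF s] by (simp add: lincomb_def)
  then have "vn n (diffv ?w (\<lambda>i t. \<Sum>k<N. x k i t)) = (\<Sum>i<m. hnorm n (\<lambda>t. \<Sum>k. x (k + N) i t))"
    by (simp add: vnorm_def)
  also have "\<dots> \<le> (\<Sum>i<m. \<Sum>k. hnorm n (x (k + N) i))"
    by (intro sum_mono Hoelder_series(2) VH_component[OF assms(1)] order_refl sh)
  also have "\<dots> = (\<Sum>k. vn n (x (k + N)))"
    unfolding vnorm_def by (rule suminf_sum[symmetric]) (rule sh)
  also have "\<dots> \<le> (\<Sum>k. g (k + N))"
  proof (rule suminf_le)
    show "summable (\<lambda>k. vn n (x (k + N)))" unfolding vnorm_def by (intro summable_sum sh)
  qed (use assms(2) summable_ignore_initial_segment[OF assms(3)] in auto)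
  finally show "vn n (diffv ?w (\<lambda>i t. \<Sum>k<N. x k i t)) \<le> (\<Sum>k. g (k + N))" .
qed

section \<open>Multiplication by matrix functions\<close>

definition mv :: "(nat \<Rightarrow> nat \<Rightarrow> real \<Rightarrow> complex) \<Rightarrow> (nat \<Rightarrow> real \<Rightarrow> complex) \<Rightarrow> nat \<Rightarrow> real \<Rightarrow> complex" where
  "mv M x = (\<lambda>i t. if i < m then \<Sum>l<m. M i l t * x l t else 0)"

lemma MH_component: "M \<in> MH n \<Longrightarrow> M i l \<in> H n"
  by (cases "i < m \<and> l < m") (auto simp: MHoelder_def Hoelder_zero)

lemma mn_nonneg: "M \<in> MH n \<Longrightarrow> 0 \<le> mn n M"
  unfolding mnorm_def by (intro sum_nonneg hnorm_nonneg MH_component)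

lemma MH_le_subset: "n \<le> k \<Longrightarrow> M \<in> MH k \<Longrightarrow> M \<in> MH n"
  using Hoelder_le_subset(1) by (auto simp: MHoelder_def)

lemma MH_diff:
  assumes "M \<in> MH n" "M' \<in> MH n"
  shows "(\<lambda>i l t. M i l t - M' i l t) \<in> MH n"
    "mn n (\<lambda>i l t. M i l t - M' i l t) \<le> mn n M + mn n M'"
proof -
  have *: "(\<lambda>t. M i l t - M' i l t) \<in> H n" "hnorm n (\<lambda>t. M i l t - M' i l t) \<le> hnorm n (M i l) + hnorm n (M' i l)" for i l
    using Hoelder_lincomb[OF MH_component[OF assms(1)] MH_component[OF assms(2)], where p = 1 and q = "-1"] by auto
  show "(\<lambda>i l t. M i l t - M' i l t) \<in> MH n" using * assms by (auto simp: MHoelder_def)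
  show "mn n (\<lambda>i l t. M i l t - M' i l t) \<le> mn n M + mn n M'"
    unfolding mnorm_def sum.distrib[symmetric] by (intro sum_mono *)
qed

lemma mv_VH:
  assumes "M \<in> MH n" "x \<in> VH n"
  shows "mv M x \<in> VH n" "vn n (mv M x) \<le> mult_const n * mn n M * vn n x"
proof -
  have h: "(\<lambda>t. \<Sum>l<m. M i l t * x l t) \<in> H n" for i
    by (intro Hoelder_sum Hoelder_mult MH_component[OF assms(1)] VH_component[OF assms(2)]) auto
  then show "mv M x \<in> VH n"
    by (intro VH_I) (auto simp: mv_def)
  have "vn n (mv M x) \<le> (\<Sum>i<m. \<Sum>l<m. mult_const n * hnorm n (M i l) * vn n x)"
    unfolding vnorm_def[of _ _ _ _ _ "mv M x"]
  proof (intro sum_mono)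
    fix i assume "i \<in> {..<m}"
    have "hnorm n (\<lambda>t. \<Sum>l<m. M i l t * x l t) \<le> (\<Sum>l<m. hnorm n (\<lambda>t. M i l t * x l t))"
      by (intro Hoelder_sum Hoelder_mult MH_component[OF assms(1)] VH_component[OF assms(2)]) auto
    also have "\<dots> \<le> (\<Sum>l<m. mult_const n * hnorm n (M i l) * hnorm n (x l))"
      by (intro sum_mono Hoelder_mult MH_component[OF assms(1)] VH_component[OF assms(2)])
    also have "\<dots> \<le> (\<Sum>l<m. mult_const n * hnorm n (M i l) * vn n x)"
      using mult_const_ge[of n]
      by (intro sum_mono mult_left_mono hnorm_le_vn assms mult_nonneg_nonneg hnorm_nonneg MH_component[OF assms(1)]) auto
    finally show "hnorm n (mv M x i) \<le> (\<Sum>l<m. mult_const n * hnorm n (M i l) * vn n x)"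
      using \<open>i \<in> {..<m}\<close> by (simp add: mv_def)
  qed
  also have "\<dots> = mult_const n * mn n M * vn n x"
    by (simp add: mnorm_def sum_distrib_left sum_distrib_right mult_ac)
  finally show "vn n (mv M x) \<le> mult_const n * mn n M * vn n x" .
qed

lemma mv_lincomb: "mv M (lincomb p x q y) = lincomb p (mv M x) q (mv M y)"
  by (auto simp: mv_def lincomb_def fun_eq_iff sum.distrib sum_distrib_left algebra_simps)

lemma mv_norm_le:
  assumes "M \<in> MH n" "\<And>l. l < m \<Longrightarrow> cmod (x l t) \<le> C" "0 \<le> C"
  shows "cmod (mv M x i t) \<le> mn n M * C"
proof (cases "i < m")
  case True
  have "cmod (mv M x i t) \<le> (\<Sum>l<m. cmod (M i l t * x l t))"
    using True norm_sum by (simp add: mv_def)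
  also have "\<dots> \<le> (\<Sum>l<m. hnorm n (M i l) * C)"
    unfolding norm_mult using assms
    by (intro sum_mono mult_mono norm_le_hnorm MH_component hnorm_nonneg) auto
  also have "\<dots> = (\<Sum>l<m. hnorm n (M i l)) * C" by (simp add: sum_distrib_right)
  also have "\<dots> \<le> mn n M * C" unfolding mnorm_def
    using True by (intro mult_right_mono assms member_le_sum[of i "{..<m}" "\<lambda>i. \<Sum>l<m. hnorm n (M i l)"] sum_nonneg hnorm_nonneg MH_component) auto
  finally show ?thesis .
qed (use mn_nonneg[OF assms(1)] assms in \<open>auto simp: mv_def\<close>)

section \<open>The Volterra operator\<close>

text \<open>For a system with vanishing Cauchy data at the left end point, the highest derivative
  v of a solution satisfies the Volterra equation v + K A v = f.\<close>

definition K :: "(nat \<Rightarrow> nat \<Rightarrow> nat \<Rightarrow> real \<Rightarrow> complex) \<Rightarrow> (nat \<Rightarrow> real \<Rightarrow> complex) \<Rightarrow> nat \<Rightarrow> real \<Rightarrow> complex" where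
  "K A v = (\<lambda>i t. \<Sum>k<r. mv (A k) (\<lambda>l. (integ ^^ (r - k)) (v l)) i t)"

lemma integ_zero: "(integ ^^ j) (\<lambda>t. 0) = (\<lambda>t. 0)"
  using funpow_integ_lincomb[OF Hoelder_zero(1) Hoelder_zero(1), of j 0 0] by simp

lemma funpow_integ_VH:
  assumes "v \<in> VH n"
  shows "(\<lambda>l. (integ ^^ j) (v l)) \<in> VH (n + j)"
    "vn (n + j) (\<lambda>l. (integ ^^ j) (v l)) \<le> (1 + (b - a)) ^ j * vn n v"
proof -
  show "(\<lambda>l. (integ ^^ j) (v l)) \<in> VH (n + j)"
    using funpow_integ_Hoelder[OF VH_component[OF assms]] VH_beyond[OF assms]
    by (intro VH_I) (auto simp: integ_zero)
  show "vn (n + j) (\<lambda>l. (integ ^^ j) (v l)) \<le> (1 + (b - a)) ^ j * vn n v"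
    unfolding vnorm_def sum_distrib_left
    using funpow_integ_Hoelder[OF VH_component[OF assms]] by (intro sum_mono) auto
qed

lemma K_lincomb:
  assumes "v \<in> VH n" "w \<in> VH n"
  shows "K A (lincomb p v q w) = lincomb p (K A v) q (K A w)"
proof -
  have "(\<lambda>l. (integ ^^ j) (lincomb p v q w l)) = lincomb p (\<lambda>l. (integ ^^ j) (v l)) q (\<lambda>l. (integ ^^ j) (w l))" for j
    unfolding lincomb_def
    using funpow_integ_lincomb[OF VH_component[OF assms(1)] VH_component[OF assms(2)]] by auto
  then show ?thesis unfolding K_def
    by (simp only: mv_lincomb) (simp add: lincomb_def sum.distrib sum_distrib_left)
qed

text \<open>In every term r - k is at least 1, so \<open>K A\<close> gains a derivative. Where more
  is gained, the regularity of the coefficients caps the result at \<open>Suc n\<close>, and the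
  powers of \<open>embed_const\<close> discard the surplus.\<close>

lemma K_regularity:
  assumes "\<forall>k<r. A k \<in> MH (Suc n)"
  shows "\<exists>C\<ge>0. \<forall>v\<in>VH n. K A v \<in> VH (Suc n) \<and> vn (Suc n) (K A v) \<le> C * vn n v"
proof -
  note A = assms[rule_format]
  define C where "C k = mult_const (Suc n) * mn (Suc n) (A k) *
    (embed_const ^ (n + (r - k) - Suc n) * (1 + (b - a)) ^ (r - k))" for k
  have C: "0 \<le> C k" if "k < r" for k
    unfolding C_def using mult_const_ge[of "Suc n"] mn_nonneg[OF A[OF that]] embed_const_ge a_less_b by simp
  have *: "mv (A k) (\<lambda>l. (integ ^^ (r - k)) (v l)) \<in> VH (Suc n) \<and>
      vn (Suc n) (mv (A k) (\<lambda>l. (integ ^^ (r - k)) (v l))) \<le> C k * vn n v" if "k < r" "v \<in> VH n" for k v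
  proof -
    let ?u = "\<lambda>l. (integ ^^ (r - k)) (v l)"
    have le: "Suc n \<le> n + (r - k)" using that by simp
    note u = VH_le_subset[OF le funpow_integ_VH(1)[OF that(2)]]
    have "vn (Suc n) (mv (A k) ?u) \<le> mult_const (Suc n) * mn (Suc n) (A k) * vn (Suc n) ?u"
      by (intro mv_VH A that u)
    also have "\<dots> \<le> mult_const (Suc n) * mn (Suc n) (A k) *
      (embed_const ^ (n + (r - k) - Suc n) * ((1 + (b - a)) ^ (r - k) * vn n v))"
      using mult_const_ge[of "Suc n"] mn_nonneg[OF A[OF that(1)]] embed_const_ge
      by (intro mult_left_mono order_trans[OF u(2)] funpow_integ_VH that) auto
    also have "\<dots> = C k * vn n v" by (simp add: C_def mult_ac)
    finally show ?thesis using mv_VH(1)[OF A[OF that(1)] u(1)] by simp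
  qed
  have "K A v \<in> VH (Suc n) \<and> vn (Suc n) (K A v) \<le> (\<Sum>k<r. C k) * vn n v" if "v \<in> VH n" for v
  proof
    show "K A v \<in> VH (Suc n)" unfolding K_def using * that by (intro VH_sum) auto
    have "vn (Suc n) (K A v) \<le> (\<Sum>k<r. vn (Suc n) (mv (A k) (\<lambda>l. (integ ^^ (r - k)) (v l))))"
      unfolding K_def using * that by (intro VH_sum) auto
    also have "\<dots> \<le> (\<Sum>k<r. C k * vn n v)" using * that by (intro sum_mono) auto
    finally show "vn (Suc n) (K A v) \<le> (\<Sum>k<r. C k) * vn n v" by (simp add: sum_distrib_right)
  qed
  then show ?thesis using C by (intro exI[of _ "\<Sum>k<r. C k"]) (auto intro: sum_nonneg)
qed

text \<open>Since each term integrates at least once, the Hoelder norm of the image is controlled by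
  the sup of v. In this way decay in the sup norm becomes decay in \<open>vn 0\<close>.\<close>

lemma K_smoothing:
  assumes "\<forall>k<r. A k \<in> MH 0"
  shows "\<exists>C\<ge>0. \<forall>v\<in>VH 0. \<forall>S\<ge>0. (\<forall>i<m. \<forall>t\<in>{a..b}. cmod (v i t) \<le> S) \<longrightarrow> K A v \<in> VH 0 \<and> vn 0 (K A v) \<le> C * S"
proof -
  note A = assms[rule_format]
  define c where "c = embed_const + (b - a)"
  define C where "C k = mult_const 0 * mn 0 (A k) * (m * c ^ (r - k))" for k
  have c: "0 \<le> c" using embed_const_ge a_less_b by (simp add: c_def)
  have C: "0 \<le> C k" if "k < r" for k
    unfolding C_def using mult_const_ge[of 0] mn_nonneg[OF A[OF that]] c by simp
  have *: "mv (A k) (\<lambda>l. (integ ^^ (r - k)) (v l)) \<in> VH 0 \<and>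
      vn 0 (mv (A k) (\<lambda>l. (integ ^^ (r - k)) (v l))) \<le> C k * S"
    if "k < r" "v \<in> VH 0" "0 \<le> S" "\<And>i t. i < m \<Longrightarrow> t \<in> {a..b} \<Longrightarrow> cmod (v i t) \<le> S" for k v S
  proof -
    let ?u = "\<lambda>l. (integ ^^ (r - k)) (v l)"
    have u: "?u \<in> VH 0" using VH_le_subset(1)[OF _ funpow_integ_VH(1)[OF that(2)], of 0] by simp
    have "hnorm 0 (?u i) \<le> S * c ^ (r - k)" if "i < m" for i
      unfolding c_def
      using funpow_integ_bound(2)[OF VH_component[OF \<open>v \<in> VH 0\<close>] _ \<open>0 \<le> S\<close>] \<open>k < r\<close> that
        \<open>\<And>i t. i < m \<Longrightarrow> t \<in> {a..b} \<Longrightarrow> cmod (v i t) \<le> S\<close> by simp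
    then have "vn 0 ?u \<le> m * (S * c ^ (r - k))" unfolding vnorm_def
      using sum_bounded_above[of "{..<m}" "\<lambda>i. hnorm 0 (?u i)" "S * c ^ (r - k)"] by simp
    have "vn 0 (mv (A k) ?u) \<le> mult_const 0 * mn 0 (A k) * vn 0 ?u"
      by (intro mv_VH A that u)
    also have "\<dots> \<le> mult_const 0 * mn 0 (A k) * (m * (S * c ^ (r - k)))"
      using mn_nonneg[OF A[OF that(1)]] \<open>vn 0 ?u \<le> _\<close> by (intro mult_left_mono) auto
    also have "\<dots> = C k * S" by (simp add: C_def mult_ac)
    finally show ?thesis using mv_VH(1)[OF A[OF that(1)] u] by simp
  qed
  have "K A v \<in> VH 0 \<and> vn 0 (K A v) \<le> (\<Sum>k<r. C k) * S"
    if "v \<in> VH 0" "0 \<le> S" "\<forall>i<m. \<forall>t\<in>{a..b}. cmod (v i t) \<le> S" for v S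
  proof
    show "K A v \<in> VH 0" unfolding K_def using *[OF _ that(1,2)] that(3) by (intro VH_sum) auto
    have "vn 0 (K A v) \<le> (\<Sum>k<r. vn 0 (mv (A k) (\<lambda>l. (integ ^^ (r - k)) (v l))))"
      unfolding K_def using *[OF _ that(1,2)] that(3) by (intro VH_sum) auto
    also have "\<dots> \<le> (\<Sum>k<r. C k * S)" using *[OF _ that(1,2)] that(3) by (intro sum_mono) auto
    finally show "vn 0 (K A v) \<le> (\<Sum>k<r. C k) * S" by (simp add: sum_distrib_right)
  qed
  then show ?thesis using C by (intro exI[of _ "\<Sum>k<r. C k"]) (auto intro: sum_nonneg)
qed

text \<open>In the exponentially weighted sup norm the Volterra operator is a contraction.\<close>

lemma K_weighted:
  assumes "\<forall>k<r. A k \<in> MH 0"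
  obtains \<kappa> where "0 < \<kappa>" "\<And>v Q i t. v \<in> VH 0 \<Longrightarrow> 0 \<le> Q \<Longrightarrow>
    (\<And>i t. i < m \<Longrightarrow> t \<in> {a..b} \<Longrightarrow> cmod (v i t) \<le> Q * exp (\<kappa> * (t - a))) \<Longrightarrow>
    t \<in> {a..b} \<Longrightarrow> cmod (K A v i t) \<le> Q / 2 * exp (\<kappa> * (t - a))"
proof
  note A = assms[rule_format]
  define S where "S = (\<Sum>k<r. mn 0 (A k))"
  \<comment> \<open>The summand 2 * S makes S / \<kappa> at most 1 / 2; the summand 1 ensures
    \<kappa> \<ge> 1, so that a single integration is the worst case.\<close>
  define \<kappa> where "\<kappa> = 1 + 2 * S"
  have S: "0 \<le> S" unfolding S_def using A by (intro sum_nonneg mn_nonneg) auto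
  then show "0 < \<kappa>" by (simp add: \<kappa>_def)
  fix v Q i t assume v: "v \<in> VH 0" "0 \<le> Q" and t: "t \<in> {a..b}"
    and Q: "\<And>i t. i < m \<Longrightarrow> t \<in> {a..b} \<Longrightarrow> cmod (v i t) \<le> Q * exp (\<kappa> * (t - a))"
  have *: "cmod ((integ ^^ (r - k)) (v l) t) \<le> Q / \<kappa> * exp (\<kappa> * (t - a))" if "k < r" "l < m" for k l
  proof -
    have "\<kappa> ^ 1 \<le> \<kappa> ^ (r - k)" using that S by (intro power_increasing) (auto simp: \<kappa>_def)
    then have "Q / \<kappa> ^ (r - k) \<le> Q / \<kappa>" using \<open>0 < \<kappa>\<close> v by (intro divide_left_mono) auto
    moreover have "cmod ((integ ^^ (r - k)) (v l) t) \<le> Q / \<kappa> ^ (r - k) * exp (\<kappa> * (t - a))"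
      by (rule funpow_integ_weighted[OF VH_component[OF v(1)] Q[OF that(2)] \<open>0 < \<kappa>\<close> v(2) t])
    ultimately show ?thesis by (smt (verit) exp_ge_zero mult_right_mono)
  qed
  have "cmod (K A v i t) \<le> (\<Sum>k<r. cmod (mv (A k) (\<lambda>l. (integ ^^ (r - k)) (v l)) i t))"
    unfolding K_def by (rule norm_sum)
  also have "\<dots> \<le> (\<Sum>k<r. mn 0 (A k) * (Q / \<kappa> * exp (\<kappa> * (t - a))))"
    using \<open>0 < \<kappa>\<close> v * by (intro sum_mono mv_norm_le A) auto
  also have "\<dots> = S / \<kappa> * (Q * exp (\<kappa> * (t - a)))" by (simp add: S_def sum_distrib_right sum_divide_distrib)
  also have "\<dots> \<le> 1 / 2 * (Q * exp (\<kappa> * (t - a)))"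
    using S v by (intro mult_right_mono) (auto simp: \<kappa>_def divide_simps)
  finally show "cmod (K A v i t) \<le> Q / 2 * exp (\<kappa> * (t - a))" by simp
qed

section \<open>The Cauchy problem\<close>

lemma K_VH:
  assumes "\<forall>k<r. A k \<in> MH n" "v \<in> VH n"
  shows "K A v \<in> VH n"
proof -
  have "mv (A k) (\<lambda>l. (integ ^^ (r - k)) (v l)) \<in> VH n" if "k < r" for k
    by (intro mv_VH assms(1)[rule_format] that VH_le_subset(1)[OF _ funpow_integ_VH(1)[OF assms(2)]]) auto
  then show ?thesis unfolding K_def by (intro VH_sum) auto
qed

text \<open>Neumann series with terms (-K)^p g. The contraction holds for the weighted sup;
  \<open>K_smoothing\<close> transfers the geometric decay to \<open>vn 0\<close> with a delay of
  one index, and completeness of \<open>VH 0\<close> gives the sum.\<close>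

lemma volterra_solvable_0:
  assumes A: "\<forall>k<r. A k \<in> MH 0" and g: "g \<in> VH 0"
  shows "\<exists>v\<in>VH 0. lincomb 1 v 1 (K A v) = g"
proof -
  obtain \<kappa> where \<kappa>: "0 < \<kappa>" and contr: "\<And>v Q i t. v \<in> VH 0 \<Longrightarrow> 0 \<le> Q \<Longrightarrow>
    (\<And>i t. i < m \<Longrightarrow> t \<in> {a..b} \<Longrightarrow> cmod (v i t) \<le> Q * exp (\<kappa> * (t - a))) \<Longrightarrow>
    t \<in> {a..b} \<Longrightarrow> cmod (K A v i t) \<le> Q / 2 * exp (\<kappa> * (t - a))"
    using K_weighted[OF A] by blast
  obtain C where C: "0 \<le> C" "\<And>v S. v \<in> VH 0 \<Longrightarrow> 0 \<le> S \<Longrightarrow>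
      \<forall>i<m. \<forall>t\<in>{a..b}. cmod (v i t) \<le> S \<Longrightarrow> vn 0 (K A v) \<le> C * S"
    using K_smoothing[OF A] by blast
  \<comment> \<open>Combining with \<open>zerov\<close> merely expresses multiplication by -1
    through \<open>lincomb\<close>.\<close>
  define u where "u p = ((\<lambda>v. lincomb (-1) (K A v) 0 zerov) ^^ p) g" for p
  have u_Suc: "u (Suc p) = lincomb (-1) (K A (u p)) 0 zerov" for p by (simp add: u_def)
  have u: "u p \<in> VH 0" for p
  proof (induction p)
    case 0
    then show ?case using g by (simp add: u_def)
  next
    case (Suc p)
    then show ?case unfolding u_Suc by (intro VH_lincomb K_VH A VH_zero)
  qed
  define Q where "Q = vn 0 g"
  have Q: "0 \<le> Q" using vn_nonneg[OF g] by (simp add: Q_def)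
  have ub: "cmod (u p i t) \<le> Q / 2 ^ p * exp (\<kappa> * (t - a))" if "t \<in> {a..b}" for p i t
    using that
  proof (induction p arbitrary: i t)
    case 0
    have "1 \<le> exp (\<kappa> * (t - a))" using 0 \<kappa> by simp
    then have "Q * 1 \<le> Q * exp (\<kappa> * (t - a))" using Q by (intro mult_left_mono)
    then show ?case using norm_le_vn[OF g, of i t] by (simp add: u_def Q_def)
  next
    case (Suc p)
    have "cmod (K A (u p) i t) \<le> Q / 2 ^ p / 2 * exp (\<kappa> * (t - a))"
      by (rule contr[OF u]) (use Suc Q in auto)
    then show ?case unfolding u_Suc by (simp add: lincomb_def mult.commute)
  qed
  define E where "E = exp (\<kappa> * (b - a))"
  have ub': "cmod (u p i t) \<le> Q / 2 ^ p * E" if "t \<in> {a..b}" for p i t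
  proof -
    have "Q / 2 ^ p * exp (\<kappa> * (t - a)) \<le> Q / 2 ^ p * E"
      unfolding E_def using that \<kappa> Q by (intro mult_left_mono) auto
    then show ?thesis using ub[OF that, of p i] by linarith
  qed
  \<comment> \<open>The summand Q covers p = 0; in the other one the factor 2 compensates for
    bounding \<open>u p\<close> by the sup of its predecessor.\<close>
  define G where "G p = (Q + 2 * C * Q * E) * (1 / 2) ^ p" for p :: nat
  have uG: "vn 0 (u p) \<le> G p" for p
  proof (cases p)
    case 0
    then show ?thesis using C Q by (simp add: G_def u_def Q_def E_def)
  next
    case (Suc p')
    have "vn 0 (u p) \<le> vn 0 (K A (u p'))"
      unfolding Suc u_Suc using VH_lincomb(2)[OF K_VH[OF A u[of p']] VH_zero(1), of "-1" 0] by simp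
    also have "\<dots> \<le> C * (Q / 2 ^ p' * E)"
      using ub' Q by (intro C u) (auto simp: E_def)
    also have "\<dots> = 2 * C * Q * E * (1 / 2) ^ p" by (simp add: Suc field_simps)
    also have "\<dots> \<le> G p" unfolding G_def using Q by (intro mult_right_mono) auto
    finally show ?thesis .
  qed
  have sG: "summable G" unfolding G_def by (intro summable_mult summable_geometric) auto
  obtain w where w: "w \<in> VH 0" "\<And>N. vn 0 (diffv w (\<lambda>i t. \<Sum>k<N. u k i t)) \<le> (\<Sum>k. G (k + N))"
    using VH_series[OF u uG sG] by metis
  let ?S = "\<lambda>N i t. \<Sum>k<N. u k i t"
  have S: "?S N \<in> VH 0" for N by (intro VH_sum u) auto
  \<comment> \<open>Telescoping: the image of the N-th partial sum under I + K misses g by the term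
    \<open>u N\<close>.\<close>
  have KS: "lincomb 1 (?S N) 1 (K A (?S N)) = diffv (u 0) (u N)" for N
  proof (induction N)
    case 0
    have "K A zerov = zerov"
      using K_lincomb[OF VH_zero(1) VH_zero(1), of A 0 0] by (simp add: lincomb_def)
    then show ?case by (simp add: lincomb_def)
  next
    case (Suc N)
    have "?S (Suc N) = lincomb 1 (?S N) 1 (u N)" by (simp add: lincomb_def)
    then have "K A (?S (Suc N)) = lincomb 1 (K A (?S N)) 1 (K A (u N))"
      using K_lincomb[OF S u] by metis
    then show ?case using Suc by (simp add: lincomb_def u_Suc fun_eq_iff algebra_simps)
  qed
  define e where "e N = (\<Sum>k. G (k + N))" for N
  have e0: "e \<longlonglongrightarrow> 0" unfolding e_def
    using suminf_exist_split2[OF sG] by simp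
  have G0: "G \<longlonglongrightarrow> 0" using summable_LIMSEQ_zero[OF sG] .
  let ?R = "diffv (lincomb 1 w 1 (K A w)) g"
  have R: "?R \<in> VH 0" by (intro VH_lincomb w K_VH A g)
  \<comment> \<open>The residual is I + K applied to the error of the partial sum, minus
    \<open>u N\<close>. It does not depend on N, so a bound tending to 0 forces it to
    vanish.\<close>
  have "vn 0 ?R \<le> e N + C * e N + G N" for N
  proof -
    let ?d = "diffv w (?S N)"
    have d: "?d \<in> VH 0" by (intro VH_lincomb w S)
    have dle: "vn 0 ?d \<le> e N" using w(2) by (simp add: e_def)
    have "vn 0 (K A ?d) \<le> C * e N"
      using norm_le_vn[OF d] dle vn_nonneg[OF d] by (intro C d) (auto intro: order_trans)
    have g0: "g = u 0" by (simp add: u_def)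
    have Kd: "K A ?d = diffv (K A w) (K A (?S N))" using K_lincomb[OF w(1) S] .
    have "?R i t = lincomb 1 (lincomb 1 ?d 1 (K A ?d)) (-1) (u N) i t" for i t
    proof -
      have "?S N i t + K A (?S N) i t = u 0 i t - u N i t"
        using fun_cong[OF fun_cong[OF KS[of N], of i], of t] by (simp add: lincomb_def)
      then show ?thesis unfolding Kd by (simp add: g0 lincomb_def algebra_simps)
    qed
    then have R_eq: "?R = lincomb 1 (lincomb 1 ?d 1 (K A ?d)) (-1) (u N)" by (intro ext)
    have "vn 0 ?R \<le> vn 0 (lincomb 1 ?d 1 (K A ?d)) + vn 0 (u N)"
      unfolding R_eq using VH_lincomb(2)[OF VH_lincomb(1)[OF d K_VH[OF A d], of 1 1] u[of N], of 1 "-1"] by simp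
    also have "vn 0 (lincomb 1 ?d 1 (K A ?d)) \<le> vn 0 ?d + vn 0 (K A ?d)"
      using VH_lincomb(2)[OF d K_VH[OF A d], of 1 1] by simp
    finally show ?thesis using dle \<open>vn 0 (K A ?d) \<le> C * e N\<close> uG[of N] by linarith
  qed
  moreover have "(\<lambda>N. e N + C * e N + G N) \<longlonglongrightarrow> 0 + C * 0 + 0"
    by (intro tendsto_intros e0 G0)
  ultimately have "vn 0 ?R \<le> 0" by (intro LIMSEQ_le_const) auto
  then have R0: "?R = zerov" using vn_eq_0D[OF R] by simp
  have "lincomb 1 w 1 (K A w) i t = g i t" for i t
    using fun_cong[OF fun_cong[OF R0, of i], of t] by (simp add: lincomb_def)
  then show ?thesis using w(1) by (intro bexI[of _ w] ext)
qed

text \<open>With v = g - K v, a weighted sup bound Q for v improves to G + Q / 2, where G is the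
  norm of g. Iteration removes the initial bound, and smoothing of K v upgrades the resulting sup
  estimate to the Hoelder norm.\<close>

lemma volterra_bound_0:
  assumes A: "\<forall>k<r. A k \<in> MH 0"
  shows "\<exists>C\<ge>0. \<forall>v\<in>VH 0. vn 0 v \<le> C * vn 0 (lincomb 1 v 1 (K A v))"
proof -
  obtain \<kappa> where \<kappa>: "0 < \<kappa>" and contr: "\<And>v Q i t. v \<in> VH 0 \<Longrightarrow> 0 \<le> Q \<Longrightarrow>
    (\<And>i t. i < m \<Longrightarrow> t \<in> {a..b} \<Longrightarrow> cmod (v i t) \<le> Q * exp (\<kappa> * (t - a))) \<Longrightarrow>
    t \<in> {a..b} \<Longrightarrow> cmod (K A v i t) \<le> Q / 2 * exp (\<kappa> * (t - a))"
    using K_weighted[OF A] by blast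
  obtain C where C: "0 \<le> C" "\<And>v S. v \<in> VH 0 \<Longrightarrow> 0 \<le> S \<Longrightarrow>
      \<forall>i<m. \<forall>t\<in>{a..b}. cmod (v i t) \<le> S \<Longrightarrow> vn 0 (K A v) \<le> C * S"
    using K_smoothing[OF A] by blast
  define E where "E = exp (\<kappa> * (b - a))"
  have "vn 0 v \<le> (1 + C * (2 * E)) * vn 0 (lincomb 1 v 1 (K A v))" if v: "v \<in> VH 0" for v
  proof -
    let ?g = "lincomb 1 v 1 (K A v)"
    have g: "?g \<in> VH 0" by (intro VH_lincomb K_VH v A)
    define G where "G = vn 0 ?g"
    have G: "0 \<le> G" using vn_nonneg[OF g] by (simp add: G_def)
    have v_eq: "v i t = ?g i t - K A v i t" for i t by (simp add: lincomb_def)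
    have step: "cmod (v i t) \<le> (G + Q / 2) * exp (\<kappa> * (t - a))"
      if "t \<in> {a..b}" "0 \<le> Q" "\<And>i t. t \<in> {a..b} \<Longrightarrow> cmod (v i t) \<le> Q * exp (\<kappa> * (t - a))" for i t Q
    proof -
      have "1 \<le> exp (\<kappa> * (t - a))" using that \<kappa> by simp
      then have "G * 1 \<le> G * exp (\<kappa> * (t - a))" using G by (intro mult_left_mono)
      moreover have "cmod (v i t) \<le> cmod (?g i t) + cmod (K A v i t)"
        unfolding v_eq[of i t] by (rule norm_triangle_ineq4)
      moreover have "cmod (?g i t) \<le> G" using norm_le_vn[OF g] by (simp add: G_def)
      moreover have "cmod (K A v i t) \<le> Q / 2 * exp (\<kappa> * (t - a))"
        using that by (intro contr v) auto
      ultimately show ?thesis by (simp add: distrib_right)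
    qed
    \<comment> \<open>The map sending Q to G + Q / 2 has the fixed point 2 * G, and the distance of
      the bound from it is halved in every round.\<close>
    have iter: "cmod (v i t) \<le> (2 * G + vn 0 v / 2 ^ p) * exp (\<kappa> * (t - a))" if "t \<in> {a..b}" for p i t
      using that
    proof (induction p arbitrary: i t)
      case 0
      have "1 \<le> exp (\<kappa> * (t - a))" using 0 \<kappa> by simp
      then have "vn 0 v * 1 \<le> (2 * G + vn 0 v) * exp (\<kappa> * (t - a))"
        using G vn_nonneg[OF v] by (intro mult_mono) auto
      then show ?case using norm_le_vn[OF v, of i t] by simp
    next
      case (Suc p)
      have "cmod (v i t) \<le> (G + (2 * G + vn 0 v / 2 ^ p) / 2) * exp (\<kappa> * (t - a))"
        by (rule step) (use Suc G vn_nonneg[OF v] in auto)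
      then show ?case by (simp add: field_simps)
    qed
    have vb: "cmod (v i t) \<le> 2 * E * G" if t: "t \<in> {a..b}" for i t
    proof -
      have p0: "(\<lambda>p. vn 0 v / 2 ^ p) \<longlonglongrightarrow> 0"
        using tendsto_mult_right_zero[OF LIMSEQ_realpow_zero[of "1/2"], of "vn 0 v"] by (simp add: power_divide)
      have "(\<lambda>p. (2 * G + vn 0 v / 2 ^ p) * exp (\<kappa> * (t - a))) \<longlonglongrightarrow> (2 * G + 0) * exp (\<kappa> * (t - a))"
        by (intro tendsto_intros p0)
      then have "cmod (v i t) \<le> (2 * G + 0) * exp (\<kappa> * (t - a))"
        by (rule LIMSEQ_le_const) (use iter[OF t] in blast)
      also have "\<dots> \<le> 2 * G * E" unfolding E_def using t G \<kappa> by (intro mult_mono) auto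
      finally show ?thesis by (simp add: mult_ac)
    qed
    have "vn 0 (K A v) \<le> C * (2 * E * G)"
      using vb G by (intro C v) (auto simp: E_def)
    moreover have "vn 0 v \<le> G + vn 0 (K A v)"
    proof -
      have "v = diffv ?g (K A v)" by (simp add: lincomb_def)
      then show ?thesis using VH_lincomb(2)[OF g K_VH[OF A v], of 1 "-1"] by (simp add: G_def)
    qed
    ultimately show ?thesis by (simp add: G_def algebra_simps)
  qed
  then show ?thesis using C by (intro exI[of _ "1 + C * (2 * E)"]) (auto simp: E_def)
qed

text \<open>Bootstrapping: a solution found at level n equals g - K v, and K raises the level by
  one.\<close>

lemma volterra_solvable:
  assumes "\<forall>k<r. A k \<in> MH n" "g \<in> VH n"
  shows "\<exists>v\<in>VH n. lincomb 1 v 1 (K A v) = g"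
  using assms
proof (induction n)
  case 0
  then show ?case by (rule volterra_solvable_0)
next
  case (Suc n)
  have A: "\<forall>k<r. A k \<in> MH n" using MH_le_subset[of n "Suc n"] Suc.prems(1) by simp
  obtain v where v: "v \<in> VH n" "lincomb 1 v 1 (K A v) = g"
    using Suc.IH[OF A VH_le_subset(1)[OF _ Suc.prems(2), of n]] by auto
  have "K A v \<in> VH (Suc n)" using K_regularity[OF Suc.prems(1)] v by blast
  moreover have "v = diffv g (K A v)" unfolding v(2)[symmetric] by (simp add: lincomb_def)
  ultimately have "v \<in> VH (Suc n)" using VH_lincomb(1) Suc.prems(2) by metis
  then show ?case using v by blast
qed

text \<open>The identity v = g - K v once more, now with norms: the lower norm of v is bounded by
  induction, and \<open>embed_const\<close> compares the lower norm of the right side with the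
  higher one.\<close>

lemma volterra_bound:
  assumes "\<forall>k<r. A k \<in> MH n"
  shows "\<exists>C\<ge>0. \<forall>v\<in>VH n. vn n v \<le> C * vn n (lincomb 1 v 1 (K A v))"
  using assms
proof (induction n)
  case 0
  then show ?case by (rule volterra_bound_0)
next
  case (Suc n)
  have A: "\<forall>k<r. A k \<in> MH n" using MH_le_subset[of n "Suc n"] Suc.prems by simp
  obtain C where C: "0 \<le> C" "\<And>v. v \<in> VH n \<Longrightarrow> vn n v \<le> C * vn n (lincomb 1 v 1 (K A v))"
    using Suc.IH[OF A] by auto
  obtain C' where C': "0 \<le> C'" "\<And>v. v \<in> VH n \<Longrightarrow> K A v \<in> VH (Suc n)"
    "\<And>v. v \<in> VH n \<Longrightarrow> vn (Suc n) (K A v) \<le> C' * vn n v"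
    using K_regularity[OF Suc.prems] by blast
  have "vn (Suc n) v \<le> (1 + C' * (C * embed_const)) * vn (Suc n) (lincomb 1 v 1 (K A v))" if v: "v \<in> VH (Suc n)" for v
  proof -
    let ?g = "lincomb 1 v 1 (K A v)"
    have v': "v \<in> VH n" using VH_le_subset(1)[OF _ v, of n] by simp
    have g: "?g \<in> VH (Suc n)" by (intro VH_lincomb v C' v')
    have "v = diffv ?g (K A v)" by (simp add: lincomb_def)
    then have "vn (Suc n) v \<le> vn (Suc n) ?g + vn (Suc n) (K A v)"
      using VH_lincomb(2)[OF g C'(2)[OF v'], of 1 "-1"] by simp
    moreover have "vn (Suc n) (K A v) \<le> C' * (C * (embed_const * vn (Suc n) ?g))"
      using VH_le_subset(2)[OF _ g, of n] C C'
      by (intro order_trans[OF C'(3)[OF v']] mult_left_mono order_trans[OF C(2)[OF v']]) auto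
    ultimately show ?thesis by (simp add: algebra_simps)
  qed
  then show ?case using C C' embed_const_ge
    by (intro exI[of _ "1 + C' * (C * embed_const)"]) auto
qed

section \<open>The differential operator\<close>

definition L :: "(nat \<Rightarrow> nat \<Rightarrow> nat \<Rightarrow> real \<Rightarrow> complex) \<Rightarrow> (nat \<Rightarrow> real \<Rightarrow> complex) \<Rightarrow> nat \<Rightarrow> real \<Rightarrow> complex" where
  "L A y = lincomb 1 (\<lambda>i. (D ^^ r) (y i)) 1 (\<lambda>i t. \<Sum>k<r. mv (A k) (\<lambda>l. (D ^^ k) (y l)) i t)"

lemma funpow_D_VH:
  assumes "y \<in> VH (n + r)" "k \<le> r"
  shows "(\<lambda>l. (D ^^ k) (y l)) \<in> VH n" "vn n (\<lambda>l. (D ^^ k) (y l)) \<le> embed_const ^ r * vn (n + r) y"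
proof -
  have eq: "n + r = (n + (r - k)) + k" using assms by simp
  have *: "(D ^^ k) (y l) \<in> H n \<and> hnorm n ((D ^^ k) (y l)) \<le> embed_const ^ r * hnorm (n + r) (y l)" for l
  proof -
    have d: "(D ^^ k) (y l) \<in> H (n + (r - k))" "hnorm (n + (r - k)) ((D ^^ k) (y l)) \<le> hnorm (n + r) (y l)"
      using funpow_D_Hoelder[of "y l" "n + (r - k)" k] VH_component[OF assms(1)] unfolding eq[symmetric] by auto
    have "hnorm n ((D ^^ k) (y l)) \<le> embed_const ^ (r - k) * hnorm (n + (r - k)) ((D ^^ k) (y l))"
      using Hoelder_le_subset(2)[OF _ d(1), of n] by simp
    also have "\<dots> \<le> embed_const ^ r * hnorm (n + r) (y l)"
      using embed_const_ge d hnorm_nonneg[OF d(1)] by (intro mult_mono power_increasing) auto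
    finally show ?thesis using Hoelder_le_subset(1)[OF _ d(1), of n] by simp
  qed
  show "(\<lambda>l. (D ^^ k) (y l)) \<in> VH n"
    using * VH_beyond[OF assms(1)] by (intro VH_I) (auto simp: funpow_D_zero)
  show "vn n (\<lambda>l. (D ^^ k) (y l)) \<le> embed_const ^ r * vn (n + r) y"
    unfolding vnorm_def sum_distrib_left using * by (intro sum_mono) auto
qed

text \<open>\<open>L\<close> is \<open>Lop\<close> with the sum indexed by the order k = r - j and
  with \<open>D\<close> in place of \<open>dern\<close>. The truncation built into
  \<open>Lop\<close> is matched because \<open>L\<close> of canonical representatives vanishes off
  [a,b] and in the components from m on.\<close>

lemma Lop_eq_L:
  assumes "y \<in> VH (n + r)" "\<forall>k<r. A k \<epsilon> \<in> MH n"
  shows "Lop a b m r A \<epsilon> y = L (\<lambda>k. A k \<epsilon>) y"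
proof (intro ext)
  fix i t
  have reindex: "(\<Sum>j\<in>{1..r}. f (r - j)) = (\<Sum>k<r. f k)" for f :: "nat \<Rightarrow> complex"
    by (rule sum.reindex_bij_witness[of _ "\<lambda>k. r - k" "\<lambda>j. r - j"]) auto
  have out: "x i t = 0" if "x \<in> VH n" "\<not> (i < m \<and> t \<in> {a..b})" for x
    using VH_beyond[OF that(1), of i] Hoelder_outside[OF VH_component[OF that(1)], of t i] that(2) by (cases "i < m") auto
  have "L (\<lambda>k. A k \<epsilon>) y \<in> VH n" unfolding L_def
    by (intro VH_lincomb VH_sum mv_VH assms(1) assms(2)[rule_format] funpow_D_VH) auto
  then show "Lop a b m r A \<epsilon> y i t = L (\<lambda>k. A k \<epsilon>) y i t"
    using out[of "L (\<lambda>k. A k \<epsilon>) y"]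
      reindex[of "\<lambda>k. \<Sum>l<m. A k \<epsilon> i l t * (D ^^ k) (y l) t"]
    by (auto simp: Lop_def L_def lincomb_def mv_def dern_eq_funpow)
qed

lemma L_VH:
  assumes "\<forall>k<r. A k \<in> MH n" "y \<in> VH (n + r)"
  shows "L A y \<in> VH n"
  unfolding L_def by (intro VH_lincomb VH_sum mv_VH assms(2) assms(1)[rule_format] funpow_D_VH) auto

text \<open>The leading derivatives cancel, which leaves derivatives of order below r multiplied by
  coefficient differences. The factor in front of these differences is independent of both
  coefficient families, so the bound is uniform in \<epsilon>.\<close>

lemma L_perturb:
  assumes "\<forall>k<r. A k \<in> MH n" "\<forall>k<r. A' k \<in> MH n" "y \<in> VH (n + r)"
  shows "diffv (L A y) (L A' y) \<in> VH n"
    "vn n (diffv (L A y) (L A' y)) \<le>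
      mult_const n * embed_const ^ r * (\<Sum>k<r. mn n (\<lambda>i l t. A k i l t - A' k i l t)) * vn (n + r) y"
proof -
  let ?d = "\<lambda>k. (\<lambda>i l t. A k i l t - A' k i l t)"
  have d: "?d k \<in> MH n" if "k < r" for k using that assms(1,2) by (simp add: MH_diff)
  have eq: "diffv (L A y) (L A' y) = (\<lambda>i t. \<Sum>k<r. mv (?d k) (\<lambda>l. (D ^^ k) (y l)) i t)"
    by (auto simp: L_def lincomb_def mv_def fun_eq_iff left_diff_distrib simp flip: sum_subtractf intro!: sum.cong)
  show "diffv (L A y) (L A' y) \<in> VH n"
    by (intro VH_lincomb L_VH assms)
  have "vn n (diffv (L A y) (L A' y)) \<le> (\<Sum>k<r. vn n (mv (?d k) (\<lambda>l. (D ^^ k) (y l))))"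
    unfolding eq by (intro VH_sum mv_VH d funpow_D_VH assms) auto
  also have "\<dots> \<le> (\<Sum>k<r. mult_const n * mn n (?d k) * (embed_const ^ r * vn (n + r) y))"
  proof (rule sum_mono)
    fix k assume k: "k \<in> {..<r}"
    have "vn n (mv (?d k) (\<lambda>l. (D ^^ k) (y l))) \<le> mult_const n * mn n (?d k) * vn n (\<lambda>l. (D ^^ k) (y l))"
      using k by (intro mv_VH d funpow_D_VH assms) auto
    also have "\<dots> \<le> mult_const n * mn n (?d k) * (embed_const ^ r * vn (n + r) y)"
      using k mult_const_ge[of n] mn_nonneg[OF d, of k]
      by (intro mult_left_mono funpow_D_VH assms) auto
    finally show "vn n (mv (?d k) (\<lambda>l. (D ^^ k) (y l))) \<le> mult_const n * mn n (?d k) * (embed_const ^ r * vn (n + r) y)" .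
  qed
  also have "\<dots> = mult_const n * embed_const ^ r * (\<Sum>k<r. mn n (?d k)) * vn (n + r) y"
    by (simp add: sum_distrib_left sum_distrib_right mult_ac)
  finally show "vn n (diffv (L A y) (L A' y)) \<le> mult_const n * embed_const ^ r * (\<Sum>k<r. mn n (?d k)) * vn (n + r) y" .
qed

lemma funpow_D_lincomb_VH:
  assumes "y \<in> VH (n + r)" "z \<in> VH (n + r)" "k \<le> r"
  shows "(\<lambda>l. (D ^^ k) (lincomb p y q z l)) = lincomb p (\<lambda>l. (D ^^ k) (y l)) q (\<lambda>l. (D ^^ k) (z l))"
  unfolding lincomb_def
  using funpow_D_lincomb[of _ "n + (r - k)" k] VH_component[OF assms(1)] VH_component[OF assms(2)] assms(3)
  by simp

lemma L_lincomb:
  assumes "y \<in> VH (n + r)" "z \<in> VH (n + r)"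
  shows "L A (lincomb p y q z) = lincomb p (L A y) q (L A z)"
proof -
  have "(\<Sum>k<r. mv (A k) (\<lambda>l. (D ^^ k) (lincomb p y q z l)) i t) =
     (\<Sum>k<r. lincomb p (mv (A k) (\<lambda>l. (D ^^ k) (y l))) q (mv (A k) (\<lambda>l. (D ^^ k) (z l))) i t)" for i t
    by (intro sum.cong refl) (simp add: funpow_D_lincomb_VH[OF assms] mv_lincomb)
  then show ?thesis unfolding L_def funpow_D_lincomb_VH[OF assms order_refl]
    by (auto simp: lincomb_def fun_eq_iff sum.distrib sum_distrib_left algebra_simps)
qed

section \<open>Monomials and Cauchy data\<close>

text \<open>On [a,b] this is the function \<open>(t - a)\<^sup>k / k!\<close>.\<close>

definition tpow :: "nat \<Rightarrow> real \<Rightarrow> complex" where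
  "tpow k = (integ ^^ k) (\<lambda>t. if t \<in> {a..b} then 1 else 0)"

lemma one_Hoelder: "(\<lambda>t. if t \<in> {a..b} then 1 else 0) \<in> H n"
proof (cases n)
  case 0
  have "continuous_on {a..b} (\<lambda>t. if t \<in> {a..b} then 1 else 0 :: complex)"
    by (rule continuous_on_eq[of _ "\<lambda>t. 1"]) auto
  then show ?thesis using Hoelder_0I(1)[of "\<lambda>t. if t \<in> {a..b} then 1 else 0" 1 0] 0 by auto
next
  case (Suc k)
  have "((\<lambda>t. if t \<in> {a..b} then 1 else 0 :: complex) has_vector_derivative 0) (at t within {a..b})" if "t \<in> {a..b}" for t
    by (rule has_vector_derivative_transform[OF that, of _ "\<lambda>t. 1"]) auto
  then show ?thesis unfolding Suc
    by (intro Hoelder_SucI(1)[OF _ _ Hoelder_zero(1) _ order_refl, of _ 1]) auto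
qed

lemma D_one: "D (\<lambda>t. if t \<in> {a..b} then 1 else 0) = (\<lambda>t. 0)"
proof (rule D_eqI_fun)
  show "((\<lambda>t. if t \<in> {a..b} then 1 else 0 :: complex) has_vector_derivative 0) (at t within {a..b})" if "t \<in> {a..b}" for t
    by (rule has_vector_derivative_transform[OF that, of _ "\<lambda>t. 1"]) auto
qed auto

lemma tpow_Hoelder: "tpow k \<in> H n"
  using funpow_integ_Hoelder[OF one_Hoelder[of n], of k] Hoelder_le_subset(1)[of n "n + k"] by (simp add: tpow_def)

lemma D_tpow: "D (tpow k) = (if k = 0 then (\<lambda>t. 0) else tpow (k - 1))"
proof (cases k)
  case 0
  then show ?thesis using D_one by (simp add: tpow_def)
next
  case (Suc j)
  then show ?thesis using D_integ[OF tpow_Hoelder[of j 0]] by (simp add: tpow_def)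
qed

lemma funpow_D_tpow: "(D ^^ j) (tpow k) = (if j \<le> k then tpow (k - j) else (\<lambda>t. 0))"
proof (induction j arbitrary: k)
  case (Suc j)
  then show ?case by (cases k) (auto simp: funpow_Suc_right D_tpow funpow_D_zero simp del: funpow.simps(2))
qed simp

lemma tpow_start: "tpow k a = (if k = 0 then 1 else 0)"
  using a_less_b by (cases k) (auto simp: tpow_def integ_start)

text \<open>The Cauchy data at the left end point are stored as a vector of length r * m,
  the k-th derivative of the l-th component having index k * m + l.\<close>

definition cauchy :: "(nat \<Rightarrow> real \<Rightarrow> complex) \<Rightarrow> nat \<Rightarrow> complex" where
  "cauchy y = (\<lambda>s. if s < r * m then (D ^^ (s div m)) (y (s mod m)) a else 0)"

text \<open>The index is decoded as in \<open>cauchy\<close>, into degree s div m and component s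
  mod m, so that these functions form the basis dual to the Cauchy data.\<close>

definition mono_vec :: "nat \<Rightarrow> nat \<Rightarrow> real \<Rightarrow> complex" where
  "mono_vec s = (\<lambda>i. if i = s mod m then tpow (s div m) else (\<lambda>t. 0))"

lemma index_decode: "s < r * m \<Longrightarrow> s div m < r \<and> s mod m < m"
  by (metis less_mult_imp_div_less mod_less_divisor mult_0_right gr0I not_less0)

lemma cauchy_cvec: "cauchy y \<in> cvec (r * m)"
  by (auto simp: cauchy_def cvec_def)

lemma cauchy_lincomb:
  assumes "y \<in> VH (n + r)" "z \<in> VH (n + r)"
  shows "cauchy (lincomb p y q z) = (\<lambda>s. p * cauchy y s + q * cauchy z s)"
proof
  fix s
  show "cauchy (lincomb p y q z) s = p * cauchy y s + q * cauchy z s"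
  proof (cases "s < r * m")
    case True
    then have "s div m \<le> r" using index_decode by (simp add: less_imp_le)
    from fun_cong[OF fun_cong[OF funpow_D_lincomb_VH[OF assms this, of p q]]]
    have "(D ^^ (s div m)) (lincomb p y q z l) t = lincomb p (\<lambda>l. (D ^^ (s div m)) (y l)) q (\<lambda>l. (D ^^ (s div m)) (z l)) l t" for l t .
    then show ?thesis using True by (simp add: cauchy_def) (simp add: lincomb_def)
  qed (simp add: cauchy_def)
qed

lemma mono_vec_VH:
  assumes "s < r * m"
  shows "mono_vec s \<in> VH n"
  using index_decode[OF assms] by (intro VH_I) (auto simp: mono_vec_def tpow_Hoelder Hoelder_zero)

lemma cauchy_mono_vec:
  assumes "s < r * m"
  shows "cauchy (mono_vec s) = (\<lambda>s'. if s' = s then 1 else 0)"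
proof
  fix s'
  have "s' = s \<longleftrightarrow> s' div m = s div m \<and> s' mod m = s mod m"
    by (metis div_mult_mod_eq)
  then show "cauchy (mono_vec s) s' = (if s' = s then 1 else 0)"
    using assms by (auto simp: cauchy_def mono_vec_def funpow_D_tpow funpow_D_zero tpow_start)
qed

definition comb :: "nat \<Rightarrow> (nat \<Rightarrow> complex) \<Rightarrow> (nat \<Rightarrow> nat \<Rightarrow> real \<Rightarrow> complex) \<Rightarrow> nat \<Rightarrow> real \<Rightarrow> complex" where
  "comb N q P = (\<lambda>i t. \<Sum>s<N. q s * P s i t)"

lemma comb_0: "comb 0 q P = zerov"
  by (simp add: comb_def)

lemma comb_Suc: "comb (Suc N) q P = lincomb 1 (comb N q P) (q N) (P N)"
  by (simp add: comb_def lincomb_def)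

lemma comb_VH:
  assumes "\<And>s. s < N \<Longrightarrow> P s \<in> VH n"
  shows "comb N q P \<in> VH n" "vn n (comb N q P) \<le> (\<Sum>s<N. cmod (q s) * vn n (P s))"
proof -
  have "comb N q P \<in> VH n \<and> vn n (comb N q P) \<le> (\<Sum>s<N. cmod (q s) * vn n (P s))"
    using assms
  proof (induction N)
    case (Suc N)
    have "vn n (comb (Suc N) q P) \<le> vn n (comb N q P) + cmod (q N) * vn n (P N)"
      unfolding comb_Suc using VH_lincomb(2)[of "comb N q P" n "P N" 1 "q N"] Suc by simp
    then show ?case using Suc VH_lincomb(1) by (auto simp: comb_Suc)
  qed (simp add: comb_0 VH_zero)
  then show "comb N q P \<in> VH n" "vn n (comb N q P) \<le> (\<Sum>s<N. cmod (q s) * vn n (P s))" by auto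
qed

lemma comb_bound:
  assumes "\<And>s. s < N \<Longrightarrow> P s \<in> VH n"
  shows "vn n (comb N q P) \<le> cnorm N q * (\<Sum>s<N. vn n (P s))"
proof -
  have "vn n (comb N q P) \<le> (\<Sum>s<N. cmod (q s) * vn n (P s))" by (rule comb_VH[OF assms])
  also have "\<dots> \<le> (\<Sum>s<N. cnorm N q * vn n (P s))"
    using assms by (intro sum_mono mult_right_mono norm_le_cnorm vn_nonneg) auto
  finally show ?thesis by (simp add: sum_distrib_left)
qed

lemma L_zero: "L A zerov = zerov"
  using L_lincomb[OF VH_zero(1) VH_zero(1), of A 0 0] by (simp add: lincomb_def)

lemma cauchy_comb:
  assumes "\<And>s. s < N \<Longrightarrow> P s \<in> VH (n + r)"
  shows "cauchy (comb N q P) = (\<lambda>s'. \<Sum>s<N. q s * cauchy (P s) s')"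
  using assms
proof (induction N)
  case 0
  have "cauchy zerov = (\<lambda>s. 0)" using cauchy_lincomb[OF VH_zero(1) VH_zero(1), of 0 0] by (simp add: lincomb_def)
  then show ?case by (simp add: comb_0)
next
  case (Suc N)
  then show ?case
    using cauchy_lincomb[of "comb N q P" n "P N" 1 "q N"] comb_VH(1)[of N P "n + r" q] by (simp add: comb_Suc)
qed

lemma cauchy_comb_mono_vec:
  assumes "q \<in> cvec (r * m)"
  shows "cauchy (comb (r * m) q mono_vec) = q"
proof
  fix s'
  have "cauchy (comb (r * m) q mono_vec) s' = (\<Sum>s<r * m. q s * (if s' = s then 1 else 0))"
    using cauchy_comb[of "r * m" mono_vec 0 q] mono_vec_VH cauchy_mono_vec by simp
  also have "\<dots> = q s'" using assms by (auto simp: cvec_def if_distrib[of "\<lambda>x. _ * x"] sum.delta cong: if_cong)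
  finally show "cauchy (comb (r * m) q mono_vec) s' = q s'" .
qed

text \<open>Downward induction from k = r: a derivative that vanishes at a is the integral of the
  next one. Thus the highest derivative determines a function with zero Cauchy data.\<close>

lemma cauchy_zero_reconstruct:
  assumes "y \<in> VH (n + r)" "cauchy y = (\<lambda>s. 0)" "k \<le> r"
  shows "(integ ^^ (r - k)) ((D ^^ r) (y l)) = (D ^^ k) (y l)"
  using assms(3)
proof (induction rule: inc_induct)
  case base
  then show ?case by simp
next
  case (step k)
  have eq: "r - k = Suc (r - Suc k)" using step by simp
  have "(D ^^ k) (y l) \<in> H (Suc (n + (r - Suc k)))"
    using funpow_D_Hoelder[of "y l" "Suc (n + (r - Suc k))" k] VH_component[OF assms(1)] step by simp
  moreover have "(D ^^ k) (y l) a = 0"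
  proof (cases "l < m")
    case True
    have "k * m + l < Suc k * m" using True by simp
    also have "\<dots> \<le> r * m" using step by (intro mult_le_mono1) simp
    finally have "k * m + l < r * m" .
    then show ?thesis using fun_cong[OF assms(2), of "k * m + l"] True by (simp add: cauchy_def)
  qed (simp add: VH_beyond[OF assms(1)] funpow_D_zero)
  ultimately have "integ (D ((D ^^ k) (y l))) = (D ^^ k) (y l)" by (intro integ_D)
  then show ?case using step by (simp add: eq)
qed

lemma L_eq_volterra:
  assumes "y \<in> VH (n + r)" "cauchy y = (\<lambda>s. 0)"
  shows "L A y = lincomb 1 (\<lambda>i. (D ^^ r) (y i)) 1 (K A (\<lambda>i. (D ^^ r) (y i)))"
  unfolding L_def K_def using cauchy_zero_reconstruct[OF assms] by simp

lemma funpow_D_integ: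
  assumes "x \<in> H n" "k \<le> j"
  shows "(D ^^ k) ((integ ^^ j) x) = (integ ^^ (j - k)) x"
  using assms(2)
proof (induction k)
  case (Suc k)
  have eq: "j - k = Suc (j - Suc k)" using Suc.prems by simp
  have "D ((integ ^^ (j - k)) x) = (integ ^^ (j - Suc k)) x"
    unfolding eq funpow.simps o_apply
    by (rule D_integ[OF conjunct1[OF funpow_integ_Hoelder[OF assms(1)]]])
  then show ?case using Suc by simp
qed simp

text \<open>Subtracting the polynomial \<open>?p\<close> with the prescribed data leaves a problem
  with zero data; the highest derivative of its solution is found from the Volterra equation and
  integrated r times.\<close>

lemma cauchy_problem_solvable:
  assumes A: "\<forall>k<r. A k \<in> MH n" and f: "f \<in> VH n" and q: "q \<in> cvec (r * m)"
  shows "\<exists>y\<in>VH (n + r). L A y = f \<and> cauchy y = q"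
proof -
  let ?p = "comb (r * m) q mono_vec"
  have p: "?p \<in> VH (n + r)" by (intro comb_VH mono_vec_VH)
  have g: "diffv f (L A ?p) \<in> VH n" by (intro VH_lincomb L_VH A f p)
  obtain v where v: "v \<in> VH n" "lincomb 1 v 1 (K A v) = diffv f (L A ?p)"
    using volterra_solvable[OF A g] by blast
  let ?u = "\<lambda>l. (integ ^^ r) (v l)"
  have u: "?u \<in> VH (n + r)" by (rule funpow_integ_VH[OF v(1)])
  have Du: "(D ^^ r) (?u l) = v l" for l
    using funpow_D_integ[OF VH_component[OF v(1)] order_refl] by simp
  have cu: "cauchy ?u = (\<lambda>s. 0)"
  proof
    fix s
    have "(integ ^^ j) x a = 0" if "0 < j" for j x using that by (cases j) (auto simp: integ_start)
    then show "cauchy ?u s = 0"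
      using index_decode[of s] funpow_D_integ[OF VH_component[OF v(1)], of "s div m" r]
      by (auto simp: cauchy_def)
  qed
  have Lu: "L A ?u = diffv f (L A ?p)"
    using L_eq_volterra[OF u cu, of A] v(2) by (simp add: Du)
  have "L A (lincomb 1 ?u 1 ?p) = f"
    unfolding L_lincomb[OF u p] Lu by (simp add: lincomb_def)
  moreover have "cauchy (lincomb 1 ?u 1 ?p) = q"
    unfolding cauchy_lincomb[OF u p] cu cauchy_comb_mono_vec[OF q] by simp
  ultimately show ?thesis using VH_lincomb(1)[OF u p] by blast
qed

text \<open>\<open>L_perturb\<close> is applied against zero coefficients, for which the operator is
  the r-th derivative.\<close>

lemma L_bounded:
  assumes A: "\<forall>k<r. A k \<in> MH n"
  shows "\<exists>C\<ge>0. \<forall>y\<in>VH (n + r). vn n (L A y) \<le> C * vn (n + r) y"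
proof -
  define C where "C = embed_const ^ r + mult_const n * embed_const ^ r * (\<Sum>k<r. mn n (A k))"
  have z: "\<forall>k<r. (\<lambda>i l t. 0) \<in> MH n" by (auto simp: MHoelder_def Hoelder_zero)
  have "vn n (L A y) \<le> C * vn (n + r) y" if y: "y \<in> VH (n + r)" for y
  proof -
    have L0: "L (\<lambda>k i l t. 0) y = (\<lambda>i. (D ^^ r) (y i))"
      by (auto simp: L_def lincomb_def mv_def fun_eq_iff intro!: sum.neutral)
    have "vn n (L A y) \<le> vn n (L (\<lambda>k i l t. 0) y) + vn n (diffv (L A y) (L (\<lambda>k i l t. 0) y))"
      by (intro vn_triangle L_VH A z y)
    also have "\<dots> \<le> embed_const ^ r * vn (n + r) y + mult_const n * embed_const ^ r * (\<Sum>k<r. mn n (A k)) * vn (n + r) y"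
      using L_perturb(2)[OF A z y] funpow_D_VH(2)[OF y order_refl] by (simp add: L0)
    finally show ?thesis by (simp add: C_def distrib_right)
  qed
  moreover have "0 \<le> C" unfolding C_def
    using embed_const_ge mult_const_ge[of n] A by (intro add_nonneg_nonneg mult_nonneg_nonneg sum_nonneg mn_nonneg) auto
  ultimately show ?thesis by blast
qed

text \<open>The splitting of the existence proof, with norms: \<open>c\<close> handles the part with
  zero data, \<open>Z\<close> the monomials, and \<open>CL\<close> the operator on the polynomial
  part. Through the Volterra bound the constant depends on the coefficients.\<close>

lemma cauchy_problem_bound:
  assumes A: "\<forall>k<r. A k \<in> MH n"
  shows "\<exists>C\<ge>0. \<forall>y\<in>VH (n + r). vn (n + r) y \<le> C * (vn n (L A y) + cnorm (r * m) (cauchy y))"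
proof -
  obtain C where C: "0 \<le> C" "\<And>v. v \<in> VH n \<Longrightarrow> vn n v \<le> C * vn n (lincomb 1 v 1 (K A v))"
    using volterra_bound[OF A] by blast
  obtain CL where CL: "0 \<le> CL" "\<And>y. y \<in> VH (n + r) \<Longrightarrow> vn n (L A y) \<le> CL * vn (n + r) y"
    using L_bounded[OF A] by blast
  define c where "c = (1 + (b - a)) ^ r * C"
  define Z where "Z = (\<Sum>s<r * m. vn (n + r) (mono_vec s))"
  have c: "0 \<le> c" using C a_less_b by (simp add: c_def)
  have Z: "0 \<le> Z" unfolding Z_def by (intro sum_nonneg vn_nonneg mono_vec_VH) auto
  have "vn (n + r) y \<le> (c + (c * CL * Z + Z)) * (vn n (L A y) + cnorm (r * m) (cauchy y))" if y: "y \<in> VH (n + r)" for y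
  proof -
    define q where "q = cauchy y"
    let ?p = "comb (r * m) q mono_vec"
    have p: "?p \<in> VH (n + r)" by (intro comb_VH mono_vec_VH)
    have pn: "vn (n + r) ?p \<le> cnorm (r * m) q * Z" unfolding Z_def by (intro comb_bound mono_vec_VH)
    let ?u = "diffv y ?p"
    have u: "?u \<in> VH (n + r)" by (intro VH_lincomb y p)
    have cu: "cauchy ?u = (\<lambda>s. 0)"
      unfolding cauchy_lincomb[OF y p] using cauchy_comb_mono_vec[OF cauchy_cvec, of y] by (simp add: q_def)
    let ?v = "\<lambda>l. (D ^^ r) (?u l)"
    have v: "?v \<in> VH n" using funpow_D_VH[OF u order_refl] by simp
    have "?u = (\<lambda>l. (integ ^^ r) (?v l))" using cauchy_zero_reconstruct[OF u cu, of 0] by simp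
    then have "vn (n + r) ?u \<le> (1 + (b - a)) ^ r * vn n ?v"
      using funpow_integ_VH(2)[OF v, of r] by simp
    also have "\<dots> \<le> (1 + (b - a)) ^ r * (C * vn n (L A ?u))"
      using C(2)[OF v] L_eq_volterra[OF u cu, of A] a_less_b by (intro mult_left_mono) auto
    also have "\<dots> = c * vn n (L A ?u)" by (simp add: c_def)
    also have "\<dots> \<le> c * (vn n (L A y) + CL * (cnorm (r * m) q * Z))"
    proof (intro mult_left_mono c)
      have "vn n (L A ?u) \<le> vn n (L A y) + vn n (L A ?p)"
        unfolding L_lincomb[OF y p] using VH_lincomb(2)[OF L_VH[OF A y] L_VH[OF A p], of 1 "-1"] by simp
      also have "vn n (L A ?p) \<le> CL * (cnorm (r * m) q * Z)"
        using CL pn by (intro order_trans[OF CL(2)[OF p]] mult_left_mono) auto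
      finally show "vn n (L A ?u) \<le> vn n (L A y) + CL * (cnorm (r * m) q * Z)" by simp
    qed
    finally have "vn (n + r) ?u \<le> c * (vn n (L A y) + CL * (cnorm (r * m) q * Z))" .
    moreover have "vn (n + r) y \<le> vn (n + r) ?p + vn (n + r) ?u" by (rule vn_triangle[OF y p])
    moreover have "0 \<le> c * cnorm (r * m) q" "0 \<le> (c * CL * Z + Z) * vn n (L A y)"
      using c CL Z cnorm_ge_0 vn_nonneg[OF L_VH[OF A y]] by auto
    ultimately show ?thesis using pn by (simp add: q_def[symmetric] algebra_simps)
  qed
  moreover have "0 \<le> c + (c * CL * Z + Z)" using c CL Z by simp
  ultimately show ?thesis by blast
qed

section \<open>Continuous linear operators\<close>

abbreviation "bdd_op k N T \<equiv> cont_lin_op m k \<alpha> a b N T"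

lemma op_cvec: "bdd_op k N T \<Longrightarrow> y \<in> VH k \<Longrightarrow> T y \<in> cvec N"
  by (simp add: cont_lin_op_def)

lemma op_lincomb:
  "bdd_op k N T \<Longrightarrow> y \<in> VH k \<Longrightarrow> z \<in> VH k \<Longrightarrow> T (lincomb p y q z) = (\<lambda>i. p * T y i + q * T z i)"
  unfolding cont_lin_op_def lincomb_def by blast

lemma op_zero: "bdd_op k N T \<Longrightarrow> T zerov = (\<lambda>i. 0)"
  using op_lincomb[OF _ VH_zero(1) VH_zero(1), of k N T 0 0] by (simp add: lincomb_def)

lemma op_comb:
  assumes "bdd_op k N T" "\<And>s. s < j \<Longrightarrow> P s \<in> VH k"
  shows "T (comb j q P) = (\<lambda>i. \<Sum>s<j. q s * T (P s) i)"
  using assms(2)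
proof (induction j)
  case 0
  then show ?case using op_zero[OF assms(1)] by (simp add: comb_0)
next
  case (Suc j)
  then show ?case
    using op_lincomb[OF assms(1), of "comb j q P" "P j" 1 "q j"] comb_VH(1)[of j P k q] by (simp add: comb_Suc)
qed

text \<open>Continuity at 0 with tolerance 1 provides d. An element of positive norm is scaled to
  norm d / 2, which is the origin of the constant 2 / d.\<close>

lemma op_bounded:
  assumes T: "bdd_op k N T"
  shows "\<exists>\<beta>\<ge>0. \<forall>y\<in>VH k. cnorm N (T y) \<le> \<beta> * vn k y"
proof -
  have "\<forall>y\<in>VH k. \<forall>e>0. \<exists>d>0. \<forall>z\<in>VH k. vn k (\<lambda>i u. z i u - y i u) < d \<longrightarrow> cnorm N (\<lambda>i. T z i - T y i) < e"
    using T by (simp add: cont_lin_op_def)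
  from this[rule_format, OF VH_zero(1), of 1]
  obtain d where d: "0 < d" "\<And>z. z \<in> VH k \<Longrightarrow> vn k z < d \<Longrightarrow> cnorm N (T z) < 1"
    by (auto simp: op_zero[OF T])
  have "cnorm N (T y) \<le> 2 / d * vn k y" if y: "y \<in> VH k" for y
  proof (cases "vn k y = 0")
    case True
    then have "y = zerov" using vn_eq_0D[OF y] by simp
    then show ?thesis using True op_zero[OF T] by (simp add: cnorm_def)
  next
    case False
    then have pos: "0 < vn k y" using vn_nonneg[OF y] by simp
    define c where "c = d / (2 * vn k y)"
    have c: "0 < c" using pos d by (simp add: c_def)
    let ?z = "lincomb c y 0 zerov"
    have "vn k ?z \<le> c * vn k y"
      using VH_lincomb(2)[OF y VH_zero(1), of c 0] c by simp
    also have "\<dots> < d" using pos d by (simp add: c_def)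
    finally have "cnorm N (T ?z) < 1" by (intro d VH_lincomb y VH_zero)
    moreover have "cnorm N (T ?z) = c * cnorm N (T y)"
      unfolding op_lincomb[OF T y VH_zero(1)] using c by (simp add: cnorm_def norm_mult sum_distrib_left)
    ultimately have "c * cnorm N (T y) < 1" by simp
    then show ?thesis using pos d by (simp add: c_def field_simps)
  qed
  then show ?thesis using d by (intro exI[of _ "2 / d"]) auto
qed

section \<open>Operator norms and uniform boundedness\<close>

definition opnorm :: "nat \<Rightarrow> nat \<Rightarrow> ((nat \<Rightarrow> real \<Rightarrow> complex) \<Rightarrow> nat \<Rightarrow> complex) \<Rightarrow> real" where
  "opnorm k N T = Sup {cnorm N (T y) | y. y \<in> VH k \<and> vn k y \<le> 1}"

lemma
  assumes T: "bdd_op k N T"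
  shows opnorm_bound: "y \<in> VH k \<Longrightarrow> cnorm N (T y) \<le> opnorm k N T * vn k y"
    and opnorm_approx: "c < opnorm k N T \<Longrightarrow> \<exists>y\<in>VH k. vn k y \<le> 1 \<and> c < cnorm N (T y)"
proof -
  let ?S = "{cnorm N (T y) | y. y \<in> VH k \<and> vn k y \<le> 1}"
  obtain \<beta> where \<beta>: "0 \<le> \<beta>" "\<And>y. y \<in> VH k \<Longrightarrow> cnorm N (T y) \<le> \<beta> * vn k y"
    using op_bounded[OF T] by blast
  have "cnorm N (T y) \<le> \<beta>" if "y \<in> VH k" "vn k y \<le> 1" for y
    using \<beta>(2)[OF that(1)] mult_left_mono[OF that(2) \<beta>(1)] by simp
  then have bdd: "bdd_above ?S" by (intro bdd_aboveI[of _ \<beta>]) auto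
  have ne: "?S \<noteq> {}" using VH_zero[of k] by force
  show "\<exists>y\<in>VH k. vn k y \<le> 1 \<and> c < cnorm N (T y)" if "c < opnorm k N T"
    using that ne bdd unfolding opnorm_def by (subst (asm) less_cSup_iff) auto
  show "cnorm N (T y) \<le> opnorm k N T * vn k y" if y: "y \<in> VH k"
  proof (cases "vn k y = 0")
    case True
    then show ?thesis using \<beta>(2)[OF y] by simp
  next
    case False
    then have pos: "0 < vn k y" using vn_nonneg[OF y] by simp
    let ?z = "lincomb (1 / vn k y) y 0 zerov"
    have "vn k ?z \<le> 1" using VH_lincomb(2)[OF y VH_zero(1), of "1 / vn k y" 0] pos
      by (simp add: norm_divide)
    moreover have "?z \<in> VH k" by (intro VH_lincomb y VH_zero)
    ultimately have "cnorm N (T ?z) \<le> opnorm k N T" unfolding opnorm_def by (intro cSup_upper bdd) auto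
    moreover have "cnorm N (T ?z) = cnorm N (T y) / vn k y"
      unfolding op_lincomb[OF T y VH_zero(1)] using pos
      by (simp add: cnorm_def norm_divide sum_divide_distrib)
    ultimately have "cnorm N (T y) / vn k y \<le> opnorm k N T" by simp
    then show ?thesis using pos by (simp add: pos_divide_le_eq)
  qed
qed

text \<open>Banach--Steinhaus by Sokal's gliding hump: of x + d and x - d, one has an image under T
  at least as large as the image of d.\<close>

lemma uniform_boundedness:
  assumes T: "\<And>j. bdd_op k N (T j)" and pw: "\<And>y. y \<in> VH k \<Longrightarrow> \<exists>c. \<forall>j::nat. cnorm N (T j y) \<le> c"
  shows "\<exists>\<beta>. \<forall>j. \<forall>y\<in>VH k. cnorm N (T j y) \<le> \<beta> * vn k y"
proof (rule ccontr)
  assume neg: "\<not> ?thesis"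
  have "\<exists>j. c < opnorm k N (T j)" for c
  proof (rule ccontr)
    assume "\<not> ?thesis"
    then have "cnorm N (T j y) \<le> c * vn k y" if "y \<in> VH k" for j y
      using opnorm_bound[OF T that, of j] mult_right_mono[of "opnorm k N (T j)" c "vn k y"] vn_nonneg[OF that]
      by (auto simp: not_less intro: order_trans)
    then show False using neg by blast
  qed
  then have "\<forall>i::nat. \<exists>j. 4 ^ i < opnorm k N (T j)" by blast
  then obtain \<sigma> where \<sigma>: "\<And>i. 4 ^ i < opnorm k N (T (\<sigma> i))" by metis
  define M where "M i = opnorm k N (T (\<sigma> i))" for i
  have M: "4 ^ i < M i" "0 < M i" for i using \<sigma>[of i] by (auto simp: M_def intro: less_trans[of 0 "4 ^ i"])
  have "\<forall>i. \<exists>y\<in>VH k. vn k y \<le> 1 \<and> 3 / 4 * M i < cnorm N (T (\<sigma> i) y)"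
  proof
    fix i
    have "3 / 4 * M i < opnorm k N (T (\<sigma> i))" using M(2)[of i] by (simp add: M_def)
    then show "\<exists>y\<in>VH k. vn k y \<le> 1 \<and> 3 / 4 * M i < cnorm N (T (\<sigma> i) y)" by (rule opnorm_approx[OF T])
  qed
  then obtain u where u: "\<And>i. u i \<in> VH k" "\<And>i. vn k (u i) \<le> 1" "\<And>i. 3 / 4 * M i < cnorm N (T (\<sigma> i) (u i))"
    by metis
  \<comment> \<open>The operator norms exceed 4^i while the steps shrink like 3^-i: the steps are
    summable, yet their images grow at least like a multiple of (4/3)^i.\<close>
  define e where "e i = (1 / 3 :: real) ^ i" for i :: nat
  have e: "0 < e i" for i by (simp add: e_def)
  define step where "step i x = (if cnorm N (T (\<sigma> i) (lincomb 1 x (e i) (u i))) \<ge> e i * cnorm N (T (\<sigma> i) (u i))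
    then e i else - e i)" for i x
  define x where "x = rec_nat zerov (\<lambda>i x. lincomb 1 x (complex_of_real (step i x)) (u i))"
  have x_Suc: "x (Suc i) = lincomb 1 (x i) (step i (x i)) (u i)" for i by (simp add: x_def)
  have x: "x i \<in> VH k" for i
  proof (induction i)
    case (Suc i)
    then show ?case unfolding x_Suc by (intro VH_lincomb u)
  qed (simp add: x_def VH_zero)
  have step: "cnorm N (T (\<sigma> i) (x (Suc i))) \<ge> e i * cnorm N (T (\<sigma> i) (u i))" for i
  proof (cases "cnorm N (T (\<sigma> i) (lincomb 1 (x i) (e i) (u i))) \<ge> e i * cnorm N (T (\<sigma> i) (u i))")
    case True
    then show ?thesis unfolding x_Suc step_def by simp
  next
    case False
    let ?p = "lincomb 1 (x i) (e i) (u i)" and ?q = "lincomb 1 (x i) (- e i) (u i)"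
    \<comment> \<open>Twice the image of the increment is the difference of the images of the two
      candidates, so if the plus sign fails, the minus sign succeeds.\<close>
    have "2 * (e i * cnorm N (T (\<sigma> i) (u i))) = cnorm N (\<lambda>s. 1 * T (\<sigma> i) ?p s + (-1) * T (\<sigma> i) ?q s)"
      unfolding op_lincomb[OF T x u(1)] using e[of i]
      by (simp add: cnorm_def norm_mult sum_distrib_left algebra_simps flip: mult_2)
    also have "\<dots> \<le> cnorm N (T (\<sigma> i) ?p) + cnorm N (T (\<sigma> i) ?q)"
      using cnorm_lincomb[of N 1 "T (\<sigma> i) ?p" "-1" "T (\<sigma> i) ?q"] by simp
    finally show ?thesis using False unfolding x_Suc step_def by simp
  qed
  define w where "w i = lincomb (complex_of_real (step i (x i))) (u i) 0 zerov" for i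
  have w: "w i \<in> VH k" for i unfolding w_def by (intro VH_lincomb u VH_zero)
  have we: "vn k (w i) \<le> e i" for i
  proof -
    have "vn k (w i) \<le> e i * vn k (u i)"
      unfolding w_def using VH_lincomb(2)[OF u(1)[of i] VH_zero(1), of "complex_of_real (step i (x i))" 0] e[of i]
      by (simp add: step_def split: if_splits)
    also have "\<dots> \<le> e i * 1" using u e[of i] by (intro mult_left_mono) auto
    finally show ?thesis by simp
  qed
  have se: "summable e" unfolding e_def by (intro summable_geometric) auto
  obtain X where X: "X \<in> VH k" "\<And>j. vn k (diffv X (\<lambda>i t. \<Sum>l<j. w l i t)) \<le> (\<Sum>l. e (l + j))"
    using VH_series[OF w we se] by blast
  have x_sum: "x j = (\<lambda>i t. \<Sum>l<j. w l i t)" for j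
  proof (induction j)
    case (Suc j)
    then show ?case unfolding x_Suc by (simp add: lincomb_def w_def)
  qed (simp add: x_def)
  \<comment> \<open>All later steps together amount to at most half of \<open>e i\<close>. What
    survives of the hump is 3/4 - 1/2 = 1/4, hence the factor 4 below.\<close>
  have tail: "vn k (diffv X (x (Suc i))) \<le> 1 / 2 * e i" for i
  proof -
    have "(\<Sum>l. e (l + Suc i)) = (\<Sum>l. (1/3) ^ Suc i * (1/3) ^ l)"
      by (simp add: e_def power_add mult_ac)
    also have "\<dots> = (1/3) ^ Suc i * (1 / (1 - 1/3))"
      by (subst suminf_mult) (auto simp: suminf_geometric intro: summable_geometric)
    also have "\<dots> = 1 / 2 * e i" by (simp add: e_def)
    finally show ?thesis using X(2)[of "Suc i"] by (simp add: x_sum)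
  qed
  obtain c where c: "\<And>j. cnorm N (T j X) \<le> c" using pw[OF X(1)] by blast
  have "(4 / 3) ^ i \<le> 4 * c" for i
  proof -
    have d: "diffv X (x (Suc i)) \<in> VH k" by (intro VH_lincomb X x)
    have "e i * (3 / 4 * M i) \<le> e i * cnorm N (T (\<sigma> i) (u i))" using u(3)[of i] e[of i] by simp
    also have "\<dots> \<le> cnorm N (T (\<sigma> i) (x (Suc i)))" by (rule step)
    also have "\<dots> \<le> cnorm N (T (\<sigma> i) X) + cnorm N (\<lambda>s. T (\<sigma> i) (x (Suc i)) s - T (\<sigma> i) X s)"
      by (rule cnorm_triangle)
    also have "cnorm N (\<lambda>s. T (\<sigma> i) (x (Suc i)) s - T (\<sigma> i) X s) = cnorm N (T (\<sigma> i) (diffv X (x (Suc i))))"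
      unfolding op_lincomb[OF T X(1) x] by (subst cnorm_diff_comm) simp
    also have "\<dots> \<le> M i * vn k (diffv X (x (Suc i)))" unfolding M_def by (rule opnorm_bound[OF T d])
    also have "\<dots> \<le> M i * (1 / 2 * e i)" using M(2)[of i] by (intro mult_left_mono tail) auto
    finally have "e i * M i \<le> 4 * cnorm N (T (\<sigma> i) X)" by (simp add: algebra_simps)
    moreover have "e i * 4 ^ i \<le> e i * M i" using M(1)[of i] e[of i] by simp
    moreover have "e i * 4 ^ i = (4 / 3) ^ i" by (simp add: e_def flip: power_mult_distrib)
    ultimately show ?thesis using c[of "\<sigma> i"] by linarith
  qed
  moreover obtain i where "4 * c < (4 / 3 :: real) ^ i" using real_arch_pow[of "4 / 3" "4 * c"] by auto
  ultimately show False by (meson not_le)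
qed

section \<open>The boundary-value problem\<close>

text \<open>Testing with the monomials \<open>(t - a)\<^sup>j / j!\<close> in the l-th component recovers the columns
  of the coefficients one after the other.\<close>

lemma coefficient_recovery:
  "\<exists>c\<ge>0. \<forall>A A'. (\<forall>k<r. A k \<in> MH n) \<longrightarrow> (\<forall>k<r. A' k \<in> MH n) \<longrightarrow>
     (\<Sum>k<r. mn n (\<lambda>i l t. A k i l t - A' k i l t))
       \<le> c * (\<Sum>s<r * m. vn n (diffv (L A (mono_vec s)) (L A' (mono_vec s))))"
proof -
  define R where "R A A' = (\<Sum>s<r * m. vn n (diffv (L A (mono_vec s)) (L A' (mono_vec s))))" for A A'
  define d where "d A A' k i l = (\<lambda>t. A k i l t - A' k i l t :: complex)" for A A' :: "nat \<Rightarrow> nat \<Rightarrow> nat \<Rightarrow> real \<Rightarrow> complex" and k i l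
  have R_ge: "vn n (diffv (L A (mono_vec s)) (L A' (mono_vec s))) \<le> R A A'"
    if "s < r * m" "\<forall>k<r. A k \<in> MH n" "\<forall>k<r. A' k \<in> MH n" for s A A'
    unfolding R_def using that
    by (intro member_le_sum[of s "{..<r * m}" "\<lambda>s. vn n (diffv (L A (mono_vec s)) (L A' (mono_vec s)))"]
        vn_nonneg L_perturb mono_vec_VH) auto
  \<comment> \<open>The constant is chosen before the coefficient families, since it has to serve
    all \<epsilon> at once. The strong induction is on the degree: a test function of degree j
    involves the coefficients of index at most j.\<close>
  have rec: "\<exists>c\<ge>0. \<forall>A A'. (\<forall>k<r. A k \<in> MH n) \<longrightarrow> (\<forall>k<r. A' k \<in> MH n) \<longrightarrow>
     (\<forall>i<m. \<forall>l<m. hnorm n (d A A' j i l) \<le> c * R A A')" if "j < r" for j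
    using that
  proof (induction j rule: less_induct)
    case (less j)
    then have "\<forall>k\<in>{..<j}. \<exists>c\<ge>0. \<forall>A A'. (\<forall>k<r. A k \<in> MH n) \<longrightarrow> (\<forall>k<r. A' k \<in> MH n) \<longrightarrow>
     (\<forall>i<m. \<forall>l<m. hnorm n (d A A' k i l) \<le> c * R A A')" by auto
    then obtain c where c: "\<And>k. k < j \<Longrightarrow> 0 \<le> c k" and
      IH: "\<And>k A A' i l. k < j \<Longrightarrow> \<forall>k<r. A k \<in> MH n \<Longrightarrow> \<forall>k<r. A' k \<in> MH n \<Longrightarrow> i < m \<Longrightarrow> l < m \<Longrightarrow>
        hnorm n (d A A' k i l) \<le> c k * R A A'"
      unfolding bchoice_iff by (metis lessThan_iff)
    \<comment> \<open>The summand 1 stands for the test itself, the sum for the coefficients of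
      lower index that are subtracted, each multiplied by a monomial.\<close>
    define C where "C = 1 + (\<Sum>k<j. mult_const n * c k * hnorm n (tpow (j - k)))"
    have C: "0 \<le> C" unfolding C_def
      using c mult_const_ge[of n] by (intro add_nonneg_nonneg sum_nonneg mult_nonneg_nonneg hnorm_nonneg tpow_Hoelder) auto
    have "hnorm n (d A A' j i l) \<le> C * R A A'" if A: "\<forall>k<r. A k \<in> MH n" "\<forall>k<r. A' k \<in> MH n" and il: "i < m" "l < m" for A A' i l
    proof -
      define s where "s = j * m + l"
      have s: "s div m = j" "s mod m = l" using il by (auto simp: s_def)
      have "j * m + l < Suc j * m" using il by simp
      also have "\<dots> \<le> r * m" using less.prems by (intro mult_le_mono1) simp
      finally have s_less: "s < r * m" by (simp add: s_def)
      let ?\<rho> = "diffv (L A (mono_vec s)) (L A' (mono_vec s))"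
      have dH: "d A A' k i l \<in> H n" if "k < r" for k
        unfolding d_def using that A MH_component[OF MH_diff(1), of "A k" n "A' k" i l] by simp
      have \<rho>: "?\<rho> \<in> VH n" by (intro L_perturb A mono_vec_VH s_less)
      have eq: "?\<rho> i t = (\<Sum>k\<le>j. d A A' k i l t * tpow (j - k) t)" for t
      proof -
        have "?\<rho> i t = (\<Sum>k<r. \<Sum>l'<m. d A A' k i l' t * (D ^^ k) (mono_vec s l') t)"
          using il by (simp add: L_def lincomb_def mv_def d_def left_diff_distrib sum_subtractf)
        also have "\<dots> = (\<Sum>k<r. d A A' k i l t * (D ^^ k) (tpow j) t)"
        proof (rule sum.cong[OF refl])
          fix k
          have "(\<Sum>l'<m. d A A' k i l' t * (D ^^ k) (mono_vec s l') t) =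
            (\<Sum>l'<m. if l' = l then d A A' k i l' t * (D ^^ k) (tpow j) t else 0)"
            by (intro sum.cong refl) (auto simp: mono_vec_def s funpow_D_zero)
          then show "(\<Sum>l'<m. d A A' k i l' t * (D ^^ k) (mono_vec s l') t) = d A A' k i l t * (D ^^ k) (tpow j) t"
            using il by simp
        qed
        also have "\<dots> = (\<Sum>k\<le>j. d A A' k i l t * tpow (j - k) t)"
          using less.prems by (intro sum.mono_neutral_cong_right) (auto simp: funpow_D_tpow)
        finally show ?thesis .
      qed
      have "d A A' j i l t = 1 * ?\<rho> i t + (-1) * (\<Sum>k<j. d A A' k i l t * tpow (j - k) t)" for t
      proof -
        \<comment> \<open>\<open>tpow 0\<close> is the indicator of [a,b] rather than the constant
          1; the product is unchanged because the coefficients vanish outside.\<close>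
        have "d A A' j i l t * tpow 0 t = d A A' j i l t"
          using Hoelder_outside[OF dH[OF less.prems]] by (auto simp: tpow_def)
        then show ?thesis unfolding eq by (simp flip: lessThan_Suc_atMost)
      qed
      then have d_eq: "d A A' j i l = (\<lambda>t. 1 * ?\<rho> i t + (-1) * (\<Sum>k<j. d A A' k i l t * tpow (j - k) t))" by (rule ext)
      have pH: "(\<lambda>t. d A A' k i l t * tpow (j - k) t) \<in> H n" if "k < j" for k
        using that less.prems by (intro Hoelder_mult dH tpow_Hoelder) auto
      have sH: "(\<lambda>t. \<Sum>k<j. d A A' k i l t * tpow (j - k) t) \<in> H n" using pH by (intro Hoelder_sum) auto
      have "hnorm n (d A A' j i l) \<le> hnorm n (?\<rho> i) + hnorm n (\<lambda>t. \<Sum>k<j. d A A' k i l t * tpow (j - k) t)"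
        by (subst d_eq) (use Hoelder_lincomb(2)[OF VH_component[OF \<rho>] sH, where p = 1 and q = "-1"] in simp)
      also have "hnorm n (?\<rho> i) \<le> R A A'"
        using hnorm_le_vn[OF \<rho>, of i] R_ge[OF s_less A] by linarith
      also have "hnorm n (\<lambda>t. \<Sum>k<j. d A A' k i l t * tpow (j - k) t) \<le> (\<Sum>k<j. hnorm n (\<lambda>t. d A A' k i l t * tpow (j - k) t))"
        using pH by (intro Hoelder_sum) auto
      also have "\<dots> \<le> (\<Sum>k<j. mult_const n * (c k * R A A') * hnorm n (tpow (j - k)))"
      proof (rule sum_mono)
        fix k assume k: "k \<in> {..<j}"
        have "hnorm n (\<lambda>t. d A A' k i l t * tpow (j - k) t) \<le> mult_const n * hnorm n (d A A' k i l) * hnorm n (tpow (j - k))"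
          using k less.prems by (intro Hoelder_mult dH tpow_Hoelder) auto
        also have "\<dots> \<le> mult_const n * (c k * R A A') * hnorm n (tpow (j - k))"
          using k mult_const_ge[of n] A il by (intro mult_right_mono mult_left_mono IH hnorm_nonneg tpow_Hoelder) auto
        finally show "hnorm n (\<lambda>t. d A A' k i l t * tpow (j - k) t) \<le> mult_const n * (c k * R A A') * hnorm n (tpow (j - k))" .
      qed
      finally show ?thesis by (simp add: C_def algebra_simps sum_distrib_left)
    qed
    then show ?case using C by blast
  qed
  then have "\<forall>j\<in>{..<r}. \<exists>c\<ge>0. \<forall>A A'. (\<forall>k<r. A k \<in> MH n) \<longrightarrow> (\<forall>k<r. A' k \<in> MH n) \<longrightarrow>
     (\<forall>i<m. \<forall>l<m. hnorm n (d A A' j i l) \<le> c * R A A')" by auto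
  then obtain c where c: "\<And>k. k < r \<Longrightarrow> 0 \<le> c k" and
      c_bound: "\<And>k A A' i l. k < r \<Longrightarrow> \<forall>k<r. A k \<in> MH n \<Longrightarrow> \<forall>k<r. A' k \<in> MH n \<Longrightarrow> i < m \<Longrightarrow> l < m \<Longrightarrow>
        hnorm n (d A A' k i l) \<le> c k * R A A'"
    unfolding bchoice_iff by (metis lessThan_iff)
  have "(\<Sum>k<r. mn n (\<lambda>i l t. A k i l t - A' k i l t)) \<le> (\<Sum>k<r. real m * (real m * c k)) * R A A'"
    if A: "\<forall>k<r. A k \<in> MH n" "\<forall>k<r. A' k \<in> MH n" for A A'
    unfolding sum_distrib_right
  proof (rule sum_mono)
    fix k assume "k \<in> {..<r}"
    then have "mn n (\<lambda>i l t. A k i l t - A' k i l t) \<le> (\<Sum>i<m. \<Sum>l<m. c k * R A A')"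
      unfolding mnorm_def d_def[symmetric] using A by (intro sum_mono c_bound) auto
    then show "mn n (\<lambda>i l t. A k i l t - A' k i l t) \<le> real m * (real m * c k) * R A A'" by (simp add: mult_ac)
  qed
  moreover have "0 \<le> (\<Sum>k<r. real m * (real m * c k))" using c by (intro sum_nonneg) auto
  ultimately show ?thesis unfolding R_def by blast
qed

lemma L_comb:
  assumes "\<And>s. s < N \<Longrightarrow> P s \<in> VH (n + r)"
  shows "L A (comb N q P) = comb N q (\<lambda>s. L A (P s))"
  using assms
proof (induction N)
  case 0
  then show ?case by (simp add: comb_0 L_zero)
next
  case (Suc N)
  then show ?case
    using L_lincomb[of "comb N q P" n "P N" A 1 "q N"] comb_VH(1)[of N P "n + r" q] by (simp add: comb_Suc)
qed

lemma comb_zero: "comb N q (\<lambda>s. zerov) = zerov"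
  by (simp add: comb_def)

lemma comb_diff: "diffv (comb N q P) (comb N q Q) = comb N q (\<lambda>s. diffv (P s) (Q s))"
  by (simp add: comb_def lincomb_def sum_subtractf right_diff_distrib)

end

section \<open>The parameter-dependent problem and sufficiency\<close>

locale boundary_problem = hoelder_system +
  fixes n :: nat and \<epsilon>0 :: real
    and A :: "nat \<Rightarrow> real \<Rightarrow> nat \<Rightarrow> nat \<Rightarrow> real \<Rightarrow> complex"
    and B :: "real \<Rightarrow> (nat \<Rightarrow> real \<Rightarrow> complex) \<Rightarrow> (nat \<Rightarrow> complex)"
  assumes \<epsilon>0_pos: "0 < \<epsilon>0"
    and coeff: "\<epsilon> \<in> {0..<\<epsilon>0} \<Longrightarrow> \<forall>k<r. A k \<epsilon> \<in> MH n"
    and boundary: "\<epsilon> \<in> {0..<\<epsilon>0} \<Longrightarrow> bdd_op (n + r) (r * m) (B \<epsilon>)"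
begin

abbreviation "E \<equiv> VH (n + r)"
abbreviation "en \<equiv> vn (n + r)"
abbreviation "N \<equiv> r * m"
abbreviation "Le \<epsilon> \<equiv> L (\<lambda>k. A k \<epsilon>)"

text \<open>Gathers condition (I) into one scalar, the size of the perturbation of L;
  \<open>\<delta>_tendsto_iff\<close> recovers the separate limits.\<close>

definition \<delta> :: "real \<Rightarrow> real" where
  "\<delta> \<epsilon> = (\<Sum>k<r. mn n (\<lambda>i l t. A k \<epsilon> i l t - A k 0 i l t))"

definition M :: real where "M = mult_const n * embed_const ^ r"

lemma zero_in: "0 \<in> {0..<\<epsilon>0}"
  using \<epsilon>0_pos by simp

lemma \<delta>_nonneg: "\<epsilon> \<in> {0..<\<epsilon>0} \<Longrightarrow> 0 \<le> \<delta> \<epsilon>"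
  unfolding \<delta>_def using coeff[of \<epsilon>] coeff[OF zero_in] by (intro sum_nonneg mn_nonneg MH_diff) auto

lemma Le_perturb:
  assumes "\<epsilon> \<in> {0..<\<epsilon>0}" "y \<in> E"
  shows "vn n (diffv (Le \<epsilon> y) (Le 0 y)) \<le> M * \<delta> \<epsilon> * en y"
  using L_perturb(2)[OF coeff[OF assms(1)] coeff[OF zero_in] assms(2)] by (simp add: M_def \<delta>_def)

lemma Le_VH: "\<epsilon> \<in> {0..<\<epsilon>0} \<Longrightarrow> y \<in> E \<Longrightarrow> Le \<epsilon> y \<in> VH n"
  by (rule L_VH[OF coeff])

lemma Lop_eq_Le: "\<epsilon> \<in> {0..<\<epsilon>0} \<Longrightarrow> y \<in> E \<Longrightarrow> Lop a b m r A \<epsilon> y = Le \<epsilon> y"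
  by (rule Lop_eq_L) (use coeff in auto)

text \<open>If no bound held near 0, there would be parameters tending to 0 along which the
  operators are unbounded. Along such a sequence the limit (II) gives pointwise boundedness,
  contradicting the uniform boundedness principle.\<close>

lemma boundary_bounded_near_0:
  assumes II: "\<And>y. y \<in> E \<Longrightarrow> ((\<lambda>\<epsilon>. cnorm N (\<lambda>i. B \<epsilon> y i - B 0 y i)) \<longlongrightarrow> 0) (at_right 0)"
  shows "\<exists>\<beta>\<ge>0. \<exists>\<epsilon>2>0. \<forall>\<epsilon>\<in>{0..<\<epsilon>2}. \<forall>y\<in>E. cnorm N (B \<epsilon> y) \<le> \<beta> * en y"
proof -
  have "\<exists>\<beta>\<ge>0. \<exists>\<epsilon>2>0. \<forall>\<epsilon>\<in>{0<..<\<epsilon>2}. \<forall>y\<in>E. cnorm N (B \<epsilon> y) \<le> \<beta> * en y"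
  proof (rule ccontr)
    assume neg: "\<not> ?thesis"
    \<comment> \<open>The minimum keeps the parameters where \<open>B\<close> is a continuous
      operator and forces the sequence to tend to 0 from the right.\<close>
    have "\<exists>\<epsilon>\<in>{0<..<min \<epsilon>0 (1 / real (Suc j))}. \<exists>y\<in>E. real j * en y < cnorm N (B \<epsilon> y)" for j
    proof (rule ccontr)
      assume "\<not> ?thesis"
      then have "\<forall>\<epsilon>\<in>{0<..<min \<epsilon>0 (1 / real (Suc j))}. \<forall>y\<in>E. cnorm N (B \<epsilon> y) \<le> real j * en y"
        by (meson not_le)
      moreover have "0 < min \<epsilon>0 (1 / real (Suc j))" using \<epsilon>0_pos by simp
      ultimately show False using neg of_nat_0_le_iff by blast
    qed
    then obtain \<eta> y where \<eta>: "\<And>j. \<eta> j \<in> {0<..<min \<epsilon>0 (1 / real (Suc j))}"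
      and y: "\<And>j. y j \<in> E" "\<And>j. real j * en (y j) < cnorm N (B (\<eta> j) (y j))" by metis
    have "filterlim \<eta> (at_right 0) sequentially"
      unfolding filterlim_at
    proof
      show "\<eta> \<longlonglongrightarrow> 0"
      proof (rule Lim_null_comparison)
        show "\<forall>\<^sub>F j in sequentially. norm (\<eta> j) \<le> 1 / real (Suc j)"
          using \<eta> by (intro always_eventually allI) (simp add: less_imp_le)
        show "(\<lambda>j. 1 / real (Suc j)) \<longlonglongrightarrow> 0" by (rule LIMSEQ_Suc[OF lim_1_over_n])
      qed
      show "\<forall>\<^sub>F j in sequentially. \<eta> j \<in> {0<..} \<and> \<eta> j \<noteq> 0" using \<eta> by (intro always_eventually allI) (metis greaterThanLessThan_iff greaterThan_iff less_irrefl)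
    qed
    then have conv: "(\<lambda>j. cnorm N (\<lambda>i. B (\<eta> j) z i - B 0 z i)) \<longlonglongrightarrow> 0" if "z \<in> E" for z
      using filterlim_compose[OF II[OF that]] by blast
    have T: "bdd_op (n + r) N (B (\<eta> j))" for j using \<eta>[of j] by (intro boundary) auto
    have "\<exists>\<beta>. \<forall>j. \<forall>y\<in>E. cnorm N (B (\<eta> j) y) \<le> \<beta> * en y"
    proof (rule uniform_boundedness[OF T])
      fix z assume z: "z \<in> E"
      obtain K where K: "\<And>j. norm (cnorm N (\<lambda>i. B (\<eta> j) z i - B 0 z i)) \<le> K"
        using convergent_imp_Bseq[OF convergentI[OF conv[OF z]]] unfolding Bseq_def by blast
      have "cnorm N (B (\<eta> j) z) \<le> cnorm N (B 0 z) + K" for j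
        using cnorm_triangle[of N "B (\<eta> j) z" "B 0 z"] K[of j] by simp
      then show "\<exists>c. \<forall>j. cnorm N (B (\<eta> j) z) \<le> c" by blast
    qed
    then obtain \<beta> where \<beta>: "\<And>j y. y \<in> E \<Longrightarrow> cnorm N (B (\<eta> j) y) \<le> \<beta> * en y" by blast
    obtain j where "\<beta> \<le> real j" using real_arch_simple by blast
    then have "\<beta> * en (y j) \<le> real j * en (y j)" using vn_nonneg[OF y(1)] by (rule mult_right_mono)
    then show False using y(2)[of j] \<beta>[OF y(1), of j j] by linarith
  qed
  then obtain \<beta> \<epsilon>2 where \<beta>: "0 \<le> \<beta>" "0 < \<epsilon>2" "\<And>\<epsilon> y. \<epsilon> \<in> {0<..<\<epsilon>2} \<Longrightarrow> y \<in> E \<Longrightarrow> cnorm N (B \<epsilon> y) \<le> \<beta> * en y"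
    by blast
  \<comment> \<open>The one-sided limit says nothing about the value at 0, so \<epsilon> = 0 gets a
    bound of its own, and the sum of both constants serves everywhere.\<close>
  obtain \<beta>0 where \<beta>0: "0 \<le> \<beta>0" "\<And>y. y \<in> E \<Longrightarrow> cnorm N (B 0 y) \<le> \<beta>0 * en y"
    using op_bounded[OF boundary[OF zero_in]] by blast
  have "cnorm N (B \<epsilon> y) \<le> (\<beta> + \<beta>0) * en y" if "\<epsilon> \<in> {0..<\<epsilon>2}" "y \<in> E" for \<epsilon> y
  proof -
    have "0 \<le> \<beta> * en y" "0 \<le> \<beta>0 * en y" using \<beta>(1) \<beta>0(1) vn_nonneg[OF that(2)] by auto
    then show ?thesis
      using \<beta>(3)[of \<epsilon> y] \<beta>0(2)[of y] that by (cases "\<epsilon> = 0") (auto simp: distrib_right)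
  qed
  then show ?thesis using \<beta> \<beta>0 by (intro exI[of _ "\<beta> + \<beta>0"]) auto
qed

text \<open>Unit Cauchy data make the coefficient vector of a combination equal to its Cauchy data,
  so every Cauchy vector is attained by a homogeneous solution depending linearly on it.\<close>

lemma fundamental_system:
  assumes "\<epsilon> \<in> {0..<\<epsilon>0}"
  obtains P where "\<And>s. s < N \<Longrightarrow> P s \<in> E" "\<And>q. q \<in> cvec N \<Longrightarrow> cauchy (comb N q P) = q"
    "\<And>q. Le \<epsilon> (comb N q P) = zerov"
proof -
  have "\<forall>s. \<exists>y\<in>E. Le \<epsilon> y = zerov \<and> (s < N \<longrightarrow> cauchy y = (\<lambda>s'. if s' = s then 1 else 0))"
  proof
    fix s
    have "(\<lambda>s'. if s' = s \<and> s < N then 1 else 0) \<in> cvec N" by (auto simp: cvec_def)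
    from cauchy_problem_solvable[OF coeff[OF assms] VH_zero(1) this]
    show "\<exists>y\<in>E. Le \<epsilon> y = zerov \<and> (s < N \<longrightarrow> cauchy y = (\<lambda>s'. if s' = s then 1 else 0))" by auto
  qed
  then obtain P where P: "\<And>s. P s \<in> E" "\<And>s. Le \<epsilon> (P s) = zerov"
    "\<And>s. s < N \<Longrightarrow> cauchy (P s) = (\<lambda>s'. if s' = s then 1 else 0)" by metis
  show ?thesis
  proof
    show "Le \<epsilon> (comb N q P) = zerov" for q
      using L_comb[of N P n] P comb_zero by simp
    show "cauchy (comb N q P) = q" if q: "q \<in> cvec N" for q
    proof
      fix s'
      have "cauchy (comb N q P) s' = (\<Sum>s<N. q s * (if s' = s then 1 else 0))"
        using cauchy_comb[of N P n q] P by simp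
      also have "\<dots> = q s'" using q by (auto simp: cvec_def if_distrib[of "\<lambda>x. _ * x"] cong: if_cong)
      finally show "cauchy (comb N q P) s' = q s'" .
    qed
  qed (rule P)
qed

text \<open>Let p solve L(0)p = 0 with the Cauchy data q of y. The difference y - p has zero data
  and is bounded by L(0)y, and \<open>\<beta>\<close> carries this bound over to its boundary
  values. For p, condition (0) bounds q by B(0)p, and \<eta> measures the exchange of B(0) and
  B(\<epsilon>) on the kernel. The remaining exchange of L(0) and L(\<epsilon>) costs a small
  multiple of the norm of y.\<close>

lemma uniform_estimate:
  assumes zero: "\<And>y. y \<in> E \<Longrightarrow> Le 0 y = zerov \<Longrightarrow> B 0 y = (\<lambda>i. 0) \<Longrightarrow> y = zerov"
    and I: "(\<delta> \<longlongrightarrow> 0) (at_right 0)"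
    and II: "\<And>y. y \<in> E \<Longrightarrow> ((\<lambda>\<epsilon>. cnorm N (\<lambda>i. B \<epsilon> y i - B 0 y i)) \<longlongrightarrow> 0) (at_right 0)"
  shows "\<exists>C\<ge>0. \<exists>\<epsilon>1>0. \<epsilon>1 < \<epsilon>0 \<and> (\<forall>\<epsilon>\<in>{0..<\<epsilon>1}. \<forall>y\<in>E. en y \<le> C * (vn n (Le \<epsilon> y) + cnorm N (B \<epsilon> y)))"
proof -
  obtain \<beta> \<epsilon>2 where \<beta>: "0 \<le> \<beta>" "0 < \<epsilon>2" "\<And>\<epsilon> y. \<epsilon> \<in> {0..<\<epsilon>2} \<Longrightarrow> y \<in> E \<Longrightarrow> cnorm N (B \<epsilon> y) \<le> \<beta> * en y"
    using boundary_bounded_near_0[OF II] by blast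
  obtain C0 where C0: "0 \<le> C0" "\<And>y. y \<in> E \<Longrightarrow> en y \<le> C0 * (vn n (Le 0 y) + cnorm N (cauchy y))"
    using cauchy_problem_bound[OF coeff[OF zero_in]] by blast
  obtain P where P: "\<And>s. s < N \<Longrightarrow> P s \<in> E" "\<And>q. q \<in> cvec N \<Longrightarrow> cauchy (comb N q P) = q"
    "\<And>q. Le 0 (comb N q P) = zerov"
    using fundamental_system[OF zero_in] by blast
  have PE: "comb N q P \<in> E" for q by (intro comb_VH P)
  have BP: "B 0 (comb N q P) = (\<lambda>i. \<Sum>s<N. q s * B 0 (P s) i)" for q
    by (rule op_comb[OF boundary[OF zero_in] P(1)])
  have "\<forall>q\<in>cvec N. (\<forall>i<N. (\<Sum>s<N. q s * B 0 (P s) i) = 0) \<longrightarrow> q = (\<lambda>s. 0)"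
  proof (intro ballI impI)
    fix q assume q: "q \<in> cvec N" "\<forall>i<N. (\<Sum>s<N. q s * B 0 (P s) i) = 0"
    have "B 0 (comb N q P) \<in> cvec N" by (rule op_cvec[OF boundary[OF zero_in] PE])
    then have "B 0 (comb N q P) i = 0" for i
      using q(2) unfolding BP cvec_def by (cases "i < N") auto
    then have "B 0 (comb N q P) = (\<lambda>i. 0)" by (rule ext)
    then have "comb N q P = zerov" by (rule zero[OF PE P(3)])
    then show "q = (\<lambda>s. 0)" using P(2)[OF q(1)] cauchy_comb[of 0 P 0 q] by (simp add: comb_0)
  qed
  from injective_system_bound[OF this] obtain \<kappa> where \<kappa>: "0 \<le> \<kappa>"
    "\<And>q. q \<in> cvec N \<Longrightarrow> cnorm N q \<le> \<kappa> * cnorm N (B 0 (comb N q P))"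
    unfolding BP by blast
  define \<eta> where "\<eta> \<epsilon> = (\<Sum>s<N. cnorm N (\<lambda>i. B \<epsilon> (P s) i - B 0 (P s) i))" for \<epsilon>
  have "(\<eta> \<longlongrightarrow> (\<Sum>s<N. 0)) (at_right 0)"
    unfolding \<eta>_def[abs_def] by (intro tendsto_sum II P) auto
  then have \<eta>_lim: "(\<eta> \<longlongrightarrow> 0) (at_right 0)" by simp
  have \<eta>0: "\<eta> 0 = 0" by (simp add: \<eta>_def cnorm_def)
  have \<delta>0: "\<delta> 0 = 0" by (simp add: \<delta>_def mnorm_def Hoelder_zero)
  \<comment> \<open>\<open>C0\<close> turns X + Q into a bound for y. Inserting the bound for Q
    produces the coefficients \<open>2 * \<kappa>\<close> at Y and
    \<open>1 + 2 * \<kappa> * \<beta> * C0\<close> at X; C1 dominates both.\<close>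
  define C1 where "C1 = C0 * (1 + 2 * \<kappa> * \<beta> * C0 + 2 * \<kappa>)"
  have C1: "0 \<le> C1" unfolding C1_def using C0(1) \<kappa>(1) \<beta>(1) by simp
  \<comment> \<open>Two absorptions are prepared, each with factor 1/2: \<eta> for the Cauchy data
    Q, and \<delta> for the norm of y.\<close>
  have "\<forall>\<^sub>F \<epsilon> in at_right 0. \<kappa> * \<eta> \<epsilon> < 1 / 2 \<and> C1 * (M * \<delta> \<epsilon>) < 1 / 2"
  proof (rule eventually_conj)
    show "\<forall>\<^sub>F \<epsilon> in at_right 0. \<kappa> * \<eta> \<epsilon> < 1 / 2"
      using tendsto_mult_right_zero[OF \<eta>_lim, of \<kappa>] by (rule order_tendstoD) simp
    show "\<forall>\<^sub>F \<epsilon> in at_right 0. C1 * (M * \<delta> \<epsilon>) < 1 / 2"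
      using tendsto_mult_right_zero[OF tendsto_mult_right_zero[OF I, of M], of C1] by (rule order_tendstoD) simp
  qed
  then obtain \<epsilon>3 where \<epsilon>3: "0 < \<epsilon>3" "\<And>\<epsilon>. 0 < \<epsilon> \<Longrightarrow> \<epsilon> < \<epsilon>3 \<Longrightarrow> \<kappa> * \<eta> \<epsilon> < 1 / 2 \<and> C1 * (M * \<delta> \<epsilon>) < 1 / 2"
    unfolding eventually_at_right_field by blast
  define \<epsilon>1 where "\<epsilon>1 = min (\<epsilon>0 / 2) (min \<epsilon>2 \<epsilon>3)"
  have \<epsilon>1: "0 < \<epsilon>1" "\<epsilon>1 < \<epsilon>0" "\<epsilon>1 \<le> \<epsilon>2" "\<epsilon>1 \<le> \<epsilon>3" using \<epsilon>0_pos \<beta> \<epsilon>3 by (auto simp: \<epsilon>1_def)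
  have "en y \<le> 2 * C1 * (vn n (Le \<epsilon> y) + cnorm N (B \<epsilon> y))" if \<epsilon>: "\<epsilon> \<in> {0..<\<epsilon>1}" and y: "y \<in> E" for \<epsilon> y
  proof -
    have \<epsilon>': "\<epsilon> \<in> {0..<\<epsilon>0}" "\<epsilon> \<in> {0..<\<epsilon>2}" using \<epsilon> \<epsilon>1 by auto
    \<comment> \<open>For \<epsilon> = 0, which the one-sided limits do not cover, both quantities
      vanish outright.\<close>
    have small: "\<kappa> * \<eta> \<epsilon> < 1 / 2" "C1 * (M * \<delta> \<epsilon>) < 1 / 2"
      using \<epsilon>3(2)[of \<epsilon>] \<epsilon> \<epsilon>1 \<eta>0 \<delta>0 by (cases "\<epsilon> = 0"; simp)+
    define q where "q = cauchy y"
    have q: "q \<in> cvec N" by (simp add: q_def cauchy_cvec)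
    let ?p = "comb N q P"
    define Q where "Q = cnorm N q"
    define X where "X = vn n (Le 0 y)"
    define Y where "Y = cnorm N (B \<epsilon> y)"
    have nn: "0 \<le> Q" "0 \<le> X" "0 \<le> Y" "0 \<le> en y"
      using cnorm_ge_0 vn_nonneg[OF Le_VH[OF zero_in y]] vn_nonneg[OF y] by (auto simp: Q_def X_def Y_def)
    have yp: "diffv y ?p \<in> E" by (intro VH_lincomb y PE)
    have "cauchy (diffv y ?p) = (\<lambda>s. 0)" unfolding cauchy_lincomb[OF y PE] P(2)[OF q] by (simp add: q_def)
    moreover have "Le 0 (diffv y ?p) = Le 0 y" unfolding L_lincomb[OF y PE] P(3) by (simp add: lincomb_def)
    ultimately have yp_le: "en (diffv y ?p) \<le> C0 * X" using C0(2)[OF yp] by (simp add: X_def cnorm_def)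
    have "cnorm N (\<lambda>i. B 0 ?p i - B \<epsilon> ?p i) \<le> Q * \<eta> \<epsilon>"
    proof -
      have BP\<epsilon>: "B \<epsilon> ?p = (\<lambda>i. \<Sum>s<N. q s * B \<epsilon> (P s) i)"
        by (rule op_comb[OF boundary[OF \<epsilon>'(1)] P(1)])
      have "cnorm N (\<lambda>i. B 0 ?p i - B \<epsilon> ?p i) = cnorm N (\<lambda>i. \<Sum>s<N. q s * (B 0 (P s) i - B \<epsilon> (P s) i))"
        unfolding BP BP\<epsilon> by (simp add: right_diff_distrib sum_subtractf)
      also have "\<dots> \<le> (\<Sum>i<N. \<Sum>s<N. cmod (q s) * cmod (B 0 (P s) i - B \<epsilon> (P s) i))"
        unfolding cnorm_def norm_mult[symmetric] by (intro sum_mono norm_sum)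
      also have "\<dots> = (\<Sum>s<N. \<Sum>i<N. cmod (q s) * cmod (B 0 (P s) i - B \<epsilon> (P s) i))" by (rule sum.swap)
      also have "\<dots> = (\<Sum>s<N. cmod (q s) * cnorm N (\<lambda>i. B \<epsilon> (P s) i - B 0 (P s) i))"
        by (simp add: cnorm_def sum_distrib_left norm_minus_commute)
      also have "\<dots> \<le> (\<Sum>s<N. Q * cnorm N (\<lambda>i. B \<epsilon> (P s) i - B 0 (P s) i))"
        unfolding Q_def by (intro sum_mono mult_right_mono norm_le_cnorm cnorm_ge_0) auto
      finally show ?thesis by (simp add: \<eta>_def sum_distrib_left)
    qed
    then have "cnorm N (B 0 ?p) \<le> cnorm N (B \<epsilon> ?p) + Q * \<eta> \<epsilon>"
      using cnorm_triangle[of N "B 0 ?p" "B \<epsilon> ?p"] by linarith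
    moreover have "cnorm N (B \<epsilon> ?p) \<le> Y + \<beta> * (C0 * X)"
    proof -
      have "cnorm N (B \<epsilon> ?p) \<le> Y + cnorm N (\<lambda>i. B \<epsilon> ?p i - B \<epsilon> y i)" unfolding Y_def by (rule cnorm_triangle)
      also have "cnorm N (\<lambda>i. B \<epsilon> ?p i - B \<epsilon> y i) = cnorm N (B \<epsilon> (diffv y ?p))"
        unfolding op_lincomb[OF boundary[OF \<epsilon>'(1)] y PE] by (subst cnorm_diff_comm) simp
      also have "\<dots> \<le> \<beta> * (C0 * X)"
        using yp_le \<beta>(1) by (intro order_trans[OF \<beta>(3)[OF \<epsilon>'(2) yp]] mult_left_mono) auto
      finally show ?thesis by simp
    qed
    ultimately have "\<kappa> * cnorm N (B 0 ?p) \<le> \<kappa> * (Y + \<beta> * (C0 * X) + Q * \<eta> \<epsilon>)"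
      using \<kappa>(1) by (intro mult_left_mono) auto
    then have "Q \<le> \<kappa> * (Y + \<beta> * (C0 * X)) + (\<kappa> * \<eta> \<epsilon>) * Q"
      using \<kappa>(2)[OF q] by (simp add: Q_def algebra_simps)
    moreover have "(\<kappa> * \<eta> \<epsilon>) * Q \<le> 1 / 2 * Q" using small nn by (intro mult_right_mono) auto
    ultimately have Q_le: "Q \<le> 2 * \<kappa> * Y + 2 * \<kappa> * \<beta> * C0 * X" by (simp add: algebra_simps)
    have "en y \<le> C0 * (X + Q)" using C0(2)[OF y] by (simp add: X_def Q_def q_def)
    also have "\<dots> \<le> C0 * (X + (2 * \<kappa> * Y + 2 * \<kappa> * \<beta> * C0 * X))"
      using Q_le C0(1) by (intro mult_left_mono) auto
    also have "\<dots> \<le> C1 * (X + Y)"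
    proof -
      \<comment> \<open>Adding these terms completes the bracket, so that C0 times it becomes C1 *
        (X + Y).\<close>
      have "0 \<le> 2 * \<kappa> * X + (1 + 2 * \<kappa> * \<beta> * C0) * Y" using \<kappa>(1) \<beta>(1) C0(1) nn by simp
      then have "C0 * (X + (2 * \<kappa> * Y + 2 * \<kappa> * \<beta> * C0 * X)) \<le>
          C0 * (X + (2 * \<kappa> * Y + 2 * \<kappa> * \<beta> * C0 * X) + (2 * \<kappa> * X + (1 + 2 * \<kappa> * \<beta> * C0) * Y))"
        using C0(1) by (intro mult_left_mono) auto
      also have "\<dots> = C1 * (X + Y)" by (simp add: C1_def algebra_simps)
      finally show ?thesis .
    qed
    also have "X \<le> vn n (Le \<epsilon> y) + M * \<delta> \<epsilon> * en y"
      unfolding X_def using vn_triangle[OF Le_VH[OF zero_in y] Le_VH[OF \<epsilon>'(1) y]] Le_perturb[OF \<epsilon>'(1) y]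
        vn_diff_comm[OF Le_VH[OF zero_in y] Le_VH[OF \<epsilon>'(1) y]] by linarith
    finally have "en y \<le> C1 * (vn n (Le \<epsilon> y) + M * \<delta> \<epsilon> * en y + Y)"
      using C1 by (simp add: mult_left_mono)
    then have "en y \<le> C1 * (vn n (Le \<epsilon> y) + Y) + C1 * (M * \<delta> \<epsilon>) * en y" by (simp add: algebra_simps)
    moreover have "C1 * (M * \<delta> \<epsilon>) * en y \<le> 1 / 2 * en y" using small nn by (intro mult_right_mono) auto
    ultimately show ?thesis by (simp add: Y_def)
  qed
  then show ?thesis using C1 \<epsilon>1 by (intro exI[of _ "2 * C1"]) auto
qed

text \<open>The estimate gives injectivity, hence an injective square matrix of boundary values of a
  fundamental system, and such a matrix is also surjective. A solution of L(\<epsilon>)y = f with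
  zero Cauchy data is then corrected by a homogeneous solution to meet the boundary
  condition.\<close>

lemma solvable_of_estimate:
  assumes \<epsilon>: "\<epsilon> \<in> {0..<\<epsilon>0}" and est: "\<And>y. y \<in> E \<Longrightarrow> en y \<le> C * (vn n (Le \<epsilon> y) + cnorm N (B \<epsilon> y))"
    and f: "f \<in> VH n" and c: "c \<in> cvec N"
  shows "\<exists>!y. y \<in> E \<and> Le \<epsilon> y = f \<and> B \<epsilon> y = c"
proof (rule ex_ex1I)
  note Bop = boundary[OF \<epsilon>]
  have inj: "y = zerov" if "y \<in> E" "Le \<epsilon> y = zerov" "B \<epsilon> y = (\<lambda>i. 0)" for y
    using est[OF that(1)] that vn_eq_0D[OF that(1)] by (simp add: VH_zero cnorm_def)
  obtain P where P: "\<And>s. s < N \<Longrightarrow> P s \<in> E" "\<And>q. q \<in> cvec N \<Longrightarrow> cauchy (comb N q P) = q"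
    "\<And>q. Le \<epsilon> (comb N q P) = zerov"
    using fundamental_system[OF \<epsilon>] by blast
  have PE: "comb N q P \<in> E" for q by (intro comb_VH P)
  have BP: "B \<epsilon> (comb N q P) = (\<lambda>i. \<Sum>s<N. q s * B \<epsilon> (P s) i)" for q by (rule op_comb[OF Bop P(1)])
  have Bc: "B \<epsilon> (comb N q P) i = 0" if "N \<le> i" for q i
    using op_cvec[OF Bop PE] that by (simp add: cvec_def)
  have inj_mat: "\<forall>q\<in>cvec N. (\<forall>i<N. (\<Sum>s<N. q s * B \<epsilon> (P s) i) = 0) \<longrightarrow> q = (\<lambda>s. 0)"
  proof (intro ballI impI)
    fix q assume q: "q \<in> cvec N" "\<forall>i<N. (\<Sum>s<N. q s * B \<epsilon> (P s) i) = 0"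
    have "B \<epsilon> (comb N q P) i = 0" for i
      using q(2) Bc[of i q] by (cases "i < N") (auto simp: BP)
    then have "B \<epsilon> (comb N q P) = (\<lambda>i. 0)" by (rule ext)
    then have "comb N q P = zerov" by (rule inj[OF PE P(3)])
    then show "q = (\<lambda>s. 0)" using P(2)[OF q(1)] cauchy_comb[of 0 P 0 q] by (simp add: comb_0)
  qed
  obtain y0 where y0: "y0 \<in> E" "Le \<epsilon> y0 = f"
    using cauchy_problem_solvable[OF coeff[OF \<epsilon>] f, of "\<lambda>s. 0"] by (auto simp: cvec_def)
  obtain q where q: "q \<in> cvec N" "\<And>i. i < N \<Longrightarrow> (\<Sum>s<N. q s * B \<epsilon> (P s) i) = c i - B \<epsilon> y0 i"
    using injective_system_solvable[OF inj_mat, of "\<lambda>i. c i - B \<epsilon> y0 i"] by blast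
  let ?y = "lincomb 1 y0 1 (comb N q P)"
  have "Le \<epsilon> ?y = f" unfolding L_lincomb[OF y0(1) PE] P(3) y0(2) by (simp add: lincomb_def)
  moreover have "B \<epsilon> ?y i = c i" for i
  proof (cases "i < N")
    case True
    then show ?thesis unfolding op_lincomb[OF Bop y0(1) PE] using q(2)[OF True] by (simp add: BP)
  next
    case False
    then show ?thesis
      using op_cvec[OF Bop VH_lincomb(1)[OF y0(1) PE, of 1 1 q]] c by (simp add: cvec_def)
  qed
  ultimately show "\<exists>y. y \<in> E \<and> Le \<epsilon> y = f \<and> B \<epsilon> y = c"
    using VH_lincomb(1)[OF y0(1) PE] by blast
  fix y z assume yz: "y \<in> E \<and> Le \<epsilon> y = f \<and> B \<epsilon> y = c" "z \<in> E \<and> Le \<epsilon> z = f \<and> B \<epsilon> z = c"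
  then have "Le \<epsilon> (diffv y z) = zerov" "B \<epsilon> (diffv y z) = (\<lambda>i. 0)"
    using L_lincomb[of y n z _ 1 "-1"] op_lincomb[OF Bop, of y z 1 "-1"] by (auto simp: lincomb_def)
  moreover have "diffv y z \<in> E" using yz by (intro VH_lincomb) auto
  ultimately have "diffv y z = zerov" using inj by blast
  then show "y = z" by (simp add: lincomb_def fun_eq_iff)
qed

text \<open>The estimate is applied to y(\<epsilon>) - y(0). Its images under L(\<epsilon>) and
  B(\<epsilon>) are the change of the data minus the change of the operator on y(0); as y(0) is a
  fixed element, the strong convergence (II) suffices for the latter.\<close>

lemma continuity_of_estimate:
  assumes \<epsilon>1: "0 < \<epsilon>1" "\<epsilon>1 < \<epsilon>0" "0 \<le> C"
    and est: "\<And>\<epsilon> y. \<epsilon> \<in> {0..<\<epsilon>1} \<Longrightarrow> y \<in> E \<Longrightarrow> en y \<le> C * (vn n (Le \<epsilon> y) + cnorm N (B \<epsilon> y))"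
    and I: "(\<delta> \<longlongrightarrow> 0) (at_right 0)"
    and II: "\<And>y. y \<in> E \<Longrightarrow> ((\<lambda>\<epsilon>. cnorm N (\<lambda>i. B \<epsilon> y i - B 0 y i)) \<longlongrightarrow> 0) (at_right 0)"
    and y: "\<And>\<epsilon>. \<epsilon> \<in> {0..<\<epsilon>1} \<Longrightarrow> y \<epsilon> \<in> E"
    and f: "((\<lambda>\<epsilon>. vn n (diffv (Le \<epsilon> (y \<epsilon>)) (Le 0 (y 0)))) \<longlongrightarrow> 0) (at_right 0)"
    and c: "((\<lambda>\<epsilon>. cnorm N (\<lambda>i. B \<epsilon> (y \<epsilon>) i - B 0 (y 0) i)) \<longlongrightarrow> 0) (at_right 0)"
  shows "((\<lambda>\<epsilon>. en (diffv (y \<epsilon>) (y 0))) \<longlongrightarrow> 0) (at_right 0)"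
proof (rule Lim_null_comparison)
  let ?b = "\<lambda>\<epsilon>. C * ((vn n (diffv (Le \<epsilon> (y \<epsilon>)) (Le 0 (y 0))) + M * \<delta> \<epsilon> * en (y 0)) +
    (cnorm N (\<lambda>i. B \<epsilon> (y \<epsilon>) i - B 0 (y 0) i) + cnorm N (\<lambda>i. B \<epsilon> (y 0) i - B 0 (y 0) i)))"
  have y0: "y 0 \<in> E" using y \<epsilon>1 by simp
  have "(?b \<longlongrightarrow> C * ((0 + M * 0 * en (y 0)) + (0 + 0))) (at_right 0)"
    by (intro tendsto_intros f c I II y0)
  then show "(?b \<longlongrightarrow> 0) (at_right 0)" by simp
  have "\<forall>\<^sub>F \<epsilon> in at_right 0. \<epsilon> \<in> {0<..<\<epsilon>1}" using \<epsilon>1 by (intro eventually_at_right_real)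
  then show "\<forall>\<^sub>F \<epsilon> in at_right 0. norm (en (diffv (y \<epsilon>) (y 0))) \<le> ?b \<epsilon>"
  proof (rule eventually_mono)
    fix \<epsilon> assume "\<epsilon> \<in> {0<..<\<epsilon>1}"
    then have \<epsilon>: "\<epsilon> \<in> {0..<\<epsilon>1}" "\<epsilon> \<in> {0..<\<epsilon>0}" using \<epsilon>1 by auto
    note ye = y[OF \<epsilon>(1)]
    have d: "diffv (y \<epsilon>) (y 0) \<in> E" by (intro VH_lincomb ye y0)
    have LV: "Le \<epsilon> (y \<epsilon>) \<in> VH n" "Le 0 (y 0) \<in> VH n" "Le \<epsilon> (y 0) \<in> VH n"
      using Le_VH \<epsilon> ye y0 zero_in by auto
    have "Le \<epsilon> (diffv (y \<epsilon>) (y 0)) = diffv (diffv (Le \<epsilon> (y \<epsilon>)) (Le 0 (y 0))) (diffv (Le \<epsilon> (y 0)) (Le 0 (y 0)))"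
      unfolding L_lincomb[OF ye y0] by (simp add: lincomb_def)
    then have "vn n (Le \<epsilon> (diffv (y \<epsilon>) (y 0))) \<le>
        vn n (diffv (Le \<epsilon> (y \<epsilon>)) (Le 0 (y 0))) + vn n (diffv (Le \<epsilon> (y 0)) (Le 0 (y 0)))"
      using VH_lincomb(2)[OF VH_lincomb(1)[OF LV(1,2), of 1 "-1"] VH_lincomb(1)[OF LV(3,2), of 1 "-1"], of 1 "-1"] by simp
    then have L_le: "vn n (Le \<epsilon> (diffv (y \<epsilon>) (y 0))) \<le>
        vn n (diffv (Le \<epsilon> (y \<epsilon>)) (Le 0 (y 0))) + M * \<delta> \<epsilon> * en (y 0)"
      using Le_perturb[OF \<epsilon>(2) y0] by linarith
    have "B \<epsilon> (diffv (y \<epsilon>) (y 0)) = (\<lambda>i. 1 * (B \<epsilon> (y \<epsilon>) i - B 0 (y 0) i) + (-1) * (B \<epsilon> (y 0) i - B 0 (y 0) i))"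
      unfolding op_lincomb[OF boundary[OF \<epsilon>(2)] ye y0] by simp
    then have B_le: "cnorm N (B \<epsilon> (diffv (y \<epsilon>) (y 0))) \<le>
        cnorm N (\<lambda>i. B \<epsilon> (y \<epsilon>) i - B 0 (y 0) i) + cnorm N (\<lambda>i. B \<epsilon> (y 0) i - B 0 (y 0) i)"
      using cnorm_lincomb[of N 1 "\<lambda>i. B \<epsilon> (y \<epsilon>) i - B 0 (y 0) i" "-1" "\<lambda>i. B \<epsilon> (y 0) i - B 0 (y 0) i"] by simp
    have "en (diffv (y \<epsilon>) (y 0)) \<le> ?b \<epsilon>"
      using L_le B_le \<epsilon>1(3) by (intro order_trans[OF est[OF \<epsilon>(1) d]] mult_left_mono add_mono) auto
    then show "norm (en (diffv (y \<epsilon>) (y 0))) \<le> ?b \<epsilon>" using vn_nonneg[OF d] by simp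
  qed
qed

lemma sufficiency:
  assumes zero: "\<And>y. y \<in> E \<Longrightarrow> Le 0 y = zerov \<Longrightarrow> B 0 y = (\<lambda>i. 0) \<Longrightarrow> y = zerov"
    and I: "(\<delta> \<longlongrightarrow> 0) (at_right 0)"
    and II: "\<And>y. y \<in> E \<Longrightarrow> ((\<lambda>\<epsilon>. cnorm N (\<lambda>i. B \<epsilon> y i - B 0 y i)) \<longlongrightarrow> 0) (at_right 0)"
  shows "cont_dep a b m r n \<alpha> \<epsilon>0 A B"
proof -
  obtain C \<epsilon>1 where C: "0 \<le> C" and \<epsilon>1: "0 < \<epsilon>1" "\<epsilon>1 < \<epsilon>0" and
    est: "\<And>\<epsilon> y. \<epsilon> \<in> {0..<\<epsilon>1} \<Longrightarrow> y \<in> E \<Longrightarrow> en y \<le> C * (vn n (Le \<epsilon> y) + cnorm N (B \<epsilon> y))"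
    using uniform_estimate[OF zero I II] by blast
  have in0: "\<epsilon> \<in> {0..<\<epsilon>0}" if "\<epsilon> \<in> {0..<\<epsilon>1}" for \<epsilon> using that \<epsilon>1 by auto
  show ?thesis unfolding cont_dep_def
  proof (intro exI[of _ \<epsilon>1] conjI ballI allI impI)
    fix \<epsilon> f c assume \<epsilon>: "\<epsilon> \<in> {0..<\<epsilon>1}" and fc: "f \<in> VH n" "c \<in> cvec N"
    have "(y \<in> E \<and> Lop a b m r A \<epsilon> y = f \<and> B \<epsilon> y = c) \<longleftrightarrow> (y \<in> E \<and> Le \<epsilon> y = f \<and> B \<epsilon> y = c)" for y
      using Lop_eq_Le[OF in0[OF \<epsilon>]] by auto
    then show "\<exists>!y. y \<in> E \<and> Lop a b m r A \<epsilon> y = f \<and> B \<epsilon> y = c"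
      using solvable_of_estimate[OF in0[OF \<epsilon>] est[OF \<epsilon>] fc] by simp
  next
    fix f c y
    assume y: "\<forall>\<epsilon>\<in>{0..<\<epsilon>1}. f \<epsilon> \<in> VH n \<and> c \<epsilon> \<in> cvec N \<and> y \<epsilon> \<in> E \<and> Lop a b m r A \<epsilon> (y \<epsilon>) = f \<epsilon> \<and> B \<epsilon> (y \<epsilon>) = c \<epsilon>"
      and f: "((\<lambda>\<epsilon>. vn n (\<lambda>i t. f \<epsilon> i t - f 0 i t)) \<longlongrightarrow> 0) (at_right 0)"
      and c: "((\<lambda>\<epsilon>. cnorm N (\<lambda>i. c \<epsilon> i - c 0 i)) \<longlongrightarrow> 0) (at_right 0)"
    have yE: "y \<epsilon> \<in> E" "Le \<epsilon> (y \<epsilon>) = f \<epsilon>" "B \<epsilon> (y \<epsilon>) = c \<epsilon>" if "\<epsilon> \<in> {0..<\<epsilon>1}" for \<epsilon>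
      using y that Lop_eq_Le[OF in0[OF that], of "y \<epsilon>"] by auto
    have z: "0 \<in> {0..<\<epsilon>1}" using \<epsilon>1 by simp
    have ev: "\<forall>\<^sub>F \<epsilon> in at_right 0. \<epsilon> \<in> {0<..<\<epsilon>1}" using \<epsilon>1 by (intro eventually_at_right_real)
    have "((\<lambda>\<epsilon>. en (diffv (y \<epsilon>) (y 0))) \<longlongrightarrow> 0) (at_right 0)"
    proof (rule continuity_of_estimate[OF \<epsilon>1 C est I II yE(1)])
      show "((\<lambda>\<epsilon>. vn n (diffv (Le \<epsilon> (y \<epsilon>)) (Le 0 (y 0)))) \<longlongrightarrow> 0) (at_right 0)"
        by (rule Lim_transform_eventually[OF f], rule eventually_mono[OF ev]) (auto simp: yE z diffv_eq)
      show "((\<lambda>\<epsilon>. cnorm N (\<lambda>i. B \<epsilon> (y \<epsilon>) i - B 0 (y 0) i)) \<longlongrightarrow> 0) (at_right 0)"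
        by (rule Lim_transform_eventually[OF c], rule eventually_mono[OF ev]) (auto simp: yE z)
    qed
    then show "((\<lambda>\<epsilon>. en (\<lambda>i t. y \<epsilon> i t - y 0 i t)) \<longlongrightarrow> 0) (at_right 0)" by (simp add: diffv_eq)
  qed (use \<epsilon>1 in auto)
qed

text \<open>\<open>cont_dep\<close> in the shape used for necessity: expressed by \<open>Le\<close>,
  and with existence and convergence of the solution family joined, so that convergent data yield a
  convergent family at once.\<close>

definition well_posed :: "real \<Rightarrow> bool" where
  "well_posed \<epsilon>1 \<longleftrightarrow> 0 < \<epsilon>1 \<and> \<epsilon>1 < \<epsilon>0 \<and>
    (\<forall>\<epsilon>\<in>{0..<\<epsilon>1}. \<forall>y\<in>E. \<forall>z\<in>E. Le \<epsilon> y = Le \<epsilon> z \<longrightarrow> B \<epsilon> y = B \<epsilon> z \<longrightarrow> y = z) \<and>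
    (\<forall>f c. (\<forall>\<epsilon>\<in>{0..<\<epsilon>1}. f \<epsilon> \<in> VH n \<and> c \<epsilon> \<in> cvec N) \<longrightarrow>
       ((\<lambda>\<epsilon>. vn n (diffv (f \<epsilon>) (f 0))) \<longlongrightarrow> 0) (at_right 0) \<longrightarrow>
       ((\<lambda>\<epsilon>. cnorm N (\<lambda>i. c \<epsilon> i - c 0 i)) \<longlongrightarrow> 0) (at_right 0) \<longrightarrow>
       (\<exists>y. (\<forall>\<epsilon>\<in>{0..<\<epsilon>1}. y \<epsilon> \<in> E \<and> Le \<epsilon> (y \<epsilon>) = f \<epsilon> \<and> B \<epsilon> (y \<epsilon>) = c \<epsilon>) \<and>
         ((\<lambda>\<epsilon>. en (diffv (y \<epsilon>) (y 0))) \<longlongrightarrow> 0) (at_right 0)))"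

lemma well_posed_unique:
  assumes "well_posed \<epsilon>1" "\<epsilon> \<in> {0..<\<epsilon>1}" "y \<in> E" "z \<in> E" "Le \<epsilon> y = Le \<epsilon> z" "B \<epsilon> y = B \<epsilon> z"
  shows "y = z"
  using assms unfolding well_posed_def by meson

lemma well_posed_solution:
  assumes wp: "well_posed \<epsilon>1" and f: "\<And>\<epsilon>. \<epsilon> \<in> {0..<\<epsilon>1} \<Longrightarrow> f \<epsilon> \<in> VH n"
    and c: "\<And>\<epsilon>. \<epsilon> \<in> {0..<\<epsilon>1} \<Longrightarrow> c \<epsilon> \<in> cvec N"
    and f_lim: "((\<lambda>\<epsilon>. vn n (diffv (f \<epsilon>) (f 0))) \<longlongrightarrow> 0) (at_right 0)"
    and c_lim: "((\<lambda>\<epsilon>. cnorm N (\<lambda>i. c \<epsilon> i - c 0 i)) \<longlongrightarrow> 0) (at_right 0)"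
  shows "\<exists>y. (\<forall>\<epsilon>\<in>{0..<\<epsilon>1}. y \<epsilon> \<in> E \<and> Le \<epsilon> (y \<epsilon>) = f \<epsilon> \<and> B \<epsilon> (y \<epsilon>) = c \<epsilon>) \<and>
         ((\<lambda>\<epsilon>. en (diffv (y \<epsilon>) (y 0))) \<longlongrightarrow> 0) (at_right 0)"
proof -
  have "\<forall>f c. (\<forall>\<epsilon>\<in>{0..<\<epsilon>1}. f \<epsilon> \<in> VH n \<and> c \<epsilon> \<in> cvec N) \<longrightarrow>
       ((\<lambda>\<epsilon>. vn n (diffv (f \<epsilon>) (f 0))) \<longlongrightarrow> 0) (at_right 0) \<longrightarrow>
       ((\<lambda>\<epsilon>. cnorm N (\<lambda>i. c \<epsilon> i - c 0 i)) \<longlongrightarrow> 0) (at_right 0) \<longrightarrow>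
       (\<exists>y. (\<forall>\<epsilon>\<in>{0..<\<epsilon>1}. y \<epsilon> \<in> E \<and> Le \<epsilon> (y \<epsilon>) = f \<epsilon> \<and> B \<epsilon> (y \<epsilon>) = c \<epsilon>) \<and>
         ((\<lambda>\<epsilon>. en (diffv (y \<epsilon>) (y 0))) \<longlongrightarrow> 0) (at_right 0))"
    using wp unfolding well_posed_def by (elim conjE)
  from this[rule_format, OF _ f_lim c_lim] show ?thesis using f c by blast
qed

lemma cont_dep_well_posed:
  assumes cd: "cont_dep a b m r n \<alpha> \<epsilon>0 A B"
  shows "\<exists>\<epsilon>1. well_posed \<epsilon>1"
proof -
  obtain \<epsilon>1 where \<epsilon>1: "0 < \<epsilon>1" "\<epsilon>1 < \<epsilon>0"
    and ex: "\<forall>\<epsilon>\<in>{0..<\<epsilon>1}. \<forall>f\<in>VH n. \<forall>c\<in>cvec N. \<exists>!y. y \<in> E \<and> Lop a b m r A \<epsilon> y = f \<and> B \<epsilon> y = c"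
    and cont: "\<forall>f c y. (\<forall>\<epsilon>\<in>{0..<\<epsilon>1}. f \<epsilon> \<in> VH n \<and> c \<epsilon> \<in> cvec N \<and> y \<epsilon> \<in> E \<and>
                  Lop a b m r A \<epsilon> (y \<epsilon>) = f \<epsilon> \<and> B \<epsilon> (y \<epsilon>) = c \<epsilon>) \<longrightarrow>
         ((\<lambda>\<epsilon>. vn n (\<lambda>i t. f \<epsilon> i t - f 0 i t)) \<longlongrightarrow> 0) (at_right 0) \<longrightarrow>
         ((\<lambda>\<epsilon>. cnorm N (\<lambda>i. c \<epsilon> i - c 0 i)) \<longlongrightarrow> 0) (at_right 0) \<longrightarrow>
         ((\<lambda>\<epsilon>. en (\<lambda>i t. y \<epsilon> i t - y 0 i t)) \<longlongrightarrow> 0) (at_right 0)"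
    using cd unfolding cont_dep_def by (elim exE conjE) (rule that)
  have in0: "\<epsilon> \<in> {0..<\<epsilon>0}" if "\<epsilon> \<in> {0..<\<epsilon>1}" for \<epsilon> using that \<epsilon>1 by auto
  have "well_posed \<epsilon>1"
    unfolding well_posed_def
  proof (intro conjI ballI allI impI \<epsilon>1)
    fix \<epsilon> y z assume *: "\<epsilon> \<in> {0..<\<epsilon>1}" "y \<in> E" "z \<in> E" "Le \<epsilon> y = Le \<epsilon> z" "B \<epsilon> y = B \<epsilon> z"
    have "\<exists>!y. y \<in> E \<and> Lop a b m r A \<epsilon> y = Le \<epsilon> z \<and> B \<epsilon> y = B \<epsilon> z"
      using * in0 by (intro ex[rule_format] Le_VH op_cvec[OF boundary]) auto
    then show "y = z" using * Lop_eq_Le[OF in0[OF *(1)]] by metis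
  next
    fix f c
    assume fc: "\<forall>\<epsilon>\<in>{0..<\<epsilon>1}. f \<epsilon> \<in> VH n \<and> c \<epsilon> \<in> cvec N"
      and lim: "((\<lambda>\<epsilon>. vn n (diffv (f \<epsilon>) (f 0))) \<longlongrightarrow> 0) (at_right 0)"
       "((\<lambda>\<epsilon>. cnorm N (\<lambda>i. c \<epsilon> i - c 0 i)) \<longlongrightarrow> 0) (at_right 0)"
    have "\<forall>\<epsilon>\<in>{0..<\<epsilon>1}. \<exists>y. y \<in> E \<and> Lop a b m r A \<epsilon> y = f \<epsilon> \<and> B \<epsilon> y = c \<epsilon>"
      using ex fc by blast
    then obtain y where y: "\<forall>\<epsilon>\<in>{0..<\<epsilon>1}. y \<epsilon> \<in> E \<and> Lop a b m r A \<epsilon> (y \<epsilon>) = f \<epsilon> \<and> B \<epsilon> (y \<epsilon>) = c \<epsilon>"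
      unfolding bchoice_iff by blast
    have "((\<lambda>\<epsilon>. en (\<lambda>i t. y \<epsilon> i t - y 0 i t)) \<longlongrightarrow> 0) (at_right 0)"
      by (rule cont[rule_format, of f c]) (use y fc lim in \<open>auto simp: diffv_eq\<close>)
    moreover have "\<forall>\<epsilon>\<in>{0..<\<epsilon>1}. y \<epsilon> \<in> E \<and> Le \<epsilon> (y \<epsilon>) = f \<epsilon> \<and> B \<epsilon> (y \<epsilon>) = c \<epsilon>"
      using y Lop_eq_Le in0 by auto
    ultimately show "\<exists>y. (\<forall>\<epsilon>\<in>{0..<\<epsilon>1}. y \<epsilon> \<in> E \<and> Le \<epsilon> (y \<epsilon>) = f \<epsilon> \<and> B \<epsilon> (y \<epsilon>) = c \<epsilon>) \<and>
         ((\<lambda>\<epsilon>. en (diffv (y \<epsilon>) (y 0))) \<longlongrightarrow> 0) (at_right 0)"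
      by (auto simp: diffv_eq)
  qed
  then show ?thesis by blast
qed

section \<open>Necessity of the three conditions\<close>

context
  assumes cd: "cont_dep a b m r n \<alpha> \<epsilon>0 A B"
begin

lemma necessity_0:
  assumes "y \<in> E" "Le 0 y = zerov" "B 0 y = (\<lambda>i. 0)"
  shows "y = zerov"
proof -
  obtain \<epsilon>1 where wp: "well_posed \<epsilon>1" using cont_dep_well_posed[OF cd] by blast
  then have "0 \<in> {0..<\<epsilon>1}" by (simp add: well_posed_def)
  from well_posed_unique[OF wp this assms(1) VH_zero(1)] show ?thesis
    using assms L_zero op_zero[OF boundary[OF zero_in]] by simp
qed

text \<open>The norm of L(\<epsilon>) is estimated by that of L(0) plus
  \<open>M * \<delta> \<epsilon>\<close>, which puts \<delta> on both sides of the inequality. The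
  factor \<eta>, the total error of the test solutions, tends to 0 and allows \<delta> to be
  absorbed.\<close>

lemma necessity_I: "(\<delta> \<longlongrightarrow> 0) (at_right 0)"
proof -
  obtain \<epsilon>1 where wp: "well_posed \<epsilon>1" using cont_dep_well_posed[OF cd] by blast
  then have \<epsilon>1: "0 < \<epsilon>1" "\<epsilon>1 < \<epsilon>0" by (auto simp: well_posed_def)
  note uniq = well_posed_unique[OF wp] and solve = well_posed_solution[OF wp]
  have z1: "0 \<in> {0..<\<epsilon>1}" using \<epsilon>1 by simp
  have in0: "\<epsilon> \<in> {0..<\<epsilon>0}" if "\<epsilon> \<in> {0..<\<epsilon>1}" for \<epsilon> using that \<epsilon>1 by auto
  \<comment> \<open>Right side and boundary values are both frozen at \<epsilon> = 0, so the
    hypotheses on convergence of the data hold trivially.\<close>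
  have "\<forall>s\<in>{..<N}. \<exists>y. (\<forall>\<epsilon>\<in>{0..<\<epsilon>1}. y \<epsilon> \<in> E \<and> Le \<epsilon> (y \<epsilon>) = Le 0 (mono_vec s) \<and> B \<epsilon> (y \<epsilon>) = B 0 (mono_vec s)) \<and>
         ((\<lambda>\<epsilon>. en (diffv (y \<epsilon>) (y 0))) \<longlongrightarrow> 0) (at_right 0)"
  proof
    fix s assume "s \<in> {..<N}"
    then have z: "mono_vec s \<in> E" by (simp add: mono_vec_VH)
    show "\<exists>y. (\<forall>\<epsilon>\<in>{0..<\<epsilon>1}. y \<epsilon> \<in> E \<and> Le \<epsilon> (y \<epsilon>) = Le 0 (mono_vec s) \<and> B \<epsilon> (y \<epsilon>) = B 0 (mono_vec s)) \<and>
         ((\<lambda>\<epsilon>. en (diffv (y \<epsilon>) (y 0))) \<longlongrightarrow> 0) (at_right 0)"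
      by (rule solve) (use Le_VH[OF zero_in z] op_cvec[OF boundary[OF zero_in] z] in
        \<open>auto simp: diffv_eq VH_zero cnorm_def\<close>)
  qed
  then obtain y where y: "\<And>s \<epsilon>. s < N \<Longrightarrow> \<epsilon> \<in> {0..<\<epsilon>1} \<Longrightarrow>
      y s \<epsilon> \<in> E \<and> Le \<epsilon> (y s \<epsilon>) = Le 0 (mono_vec s) \<and> B \<epsilon> (y s \<epsilon>) = B 0 (mono_vec s)"
    and lim: "\<And>s. s < N \<Longrightarrow> ((\<lambda>\<epsilon>. en (diffv (y s \<epsilon>) (y s 0))) \<longlongrightarrow> 0) (at_right 0)"
    unfolding bchoice_iff by (metis lessThan_iff)
  have y0: "y s 0 = mono_vec s" if "s < N" for s
    using y[OF that z1] uniq[OF z1 _ mono_vec_VH[OF that], of "y s 0"] by simp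
  define \<eta> where "\<eta> \<epsilon> = (\<Sum>s<N. en (diffv (y s \<epsilon>) (y s 0)))" for \<epsilon>
  have "(\<eta> \<longlongrightarrow> (\<Sum>s<N. 0)) (at_right 0)" unfolding \<eta>_def[abs_def] by (intro tendsto_sum lim) auto
  then have \<eta>_lim: "(\<eta> \<longlongrightarrow> 0) (at_right 0)" by simp
  obtain c where c: "0 \<le> c" "\<And>A A'. \<forall>k<r. A k \<in> MH n \<Longrightarrow> \<forall>k<r. A' k \<in> MH n \<Longrightarrow>
     (\<Sum>k<r. mn n (\<lambda>i l t. A k i l t - A' k i l t))
       \<le> c * (\<Sum>s<N. vn n (diffv (L A (mono_vec s)) (L A' (mono_vec s))))"
    using coefficient_recovery[of n] by blast
  obtain CL where CL: "0 \<le> CL" "\<And>y. y \<in> E \<Longrightarrow> vn n (Le 0 y) \<le> CL * en y"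
    using L_bounded[OF coeff[OF zero_in]] by blast
  have \<delta>_le: "\<delta> \<epsilon> \<le> c * ((CL + M * \<delta> \<epsilon>) * \<eta> \<epsilon>)" if \<epsilon>: "\<epsilon> \<in> {0..<\<epsilon>1}" for \<epsilon>
  proof -
    have "vn n (diffv (Le \<epsilon> (mono_vec s)) (Le 0 (mono_vec s))) \<le> (CL + M * \<delta> \<epsilon>) * en (diffv (y s \<epsilon>) (y s 0))" if s: "s < N" for s
    proof -
      let ?e = "diffv (mono_vec s) (y s \<epsilon>)"
      have mE: "mono_vec s \<in> E" using s by (rule mono_vec_VH)
      have yE: "y s \<epsilon> \<in> E" using y[OF s \<epsilon>] by simp
      have e: "?e \<in> E" by (intro VH_lincomb mE yE)
      have "diffv (Le \<epsilon> (mono_vec s)) (Le 0 (mono_vec s)) = Le \<epsilon> ?e"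
        unfolding L_lincomb[OF mE yE] using y[OF s \<epsilon>] by simp
      moreover have "vn n (Le \<epsilon> ?e) \<le> vn n (Le 0 ?e) + M * \<delta> \<epsilon> * en ?e"
        using vn_triangle[OF Le_VH[OF in0[OF \<epsilon>] e] Le_VH[OF zero_in e]] Le_perturb[OF in0[OF \<epsilon>] e] by linarith
      moreover have "vn n (Le 0 ?e) \<le> CL * en ?e" by (rule CL(2)[OF e])
      moreover have "en ?e = en (diffv (y s \<epsilon>) (y s 0))" unfolding y0[OF s] by (rule vn_diff_comm[OF mE yE])
      ultimately show ?thesis by (simp add: distrib_right)
    qed
    then have "(\<Sum>s<N. vn n (diffv (Le \<epsilon> (mono_vec s)) (Le 0 (mono_vec s)))) \<le>
        (\<Sum>s<N. (CL + M * \<delta> \<epsilon>) * en (diffv (y s \<epsilon>) (y s 0)))" by (intro sum_mono) auto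
    then show ?thesis
      using c(2)[OF coeff[OF in0[OF \<epsilon>]] coeff[OF zero_in]] c(1)
      unfolding \<delta>_def[symmetric] \<eta>_def sum_distrib_left[symmetric]
      by (meson mult_left_mono order_trans)
  qed
  have \<eta>_small: "\<forall>\<^sub>F \<epsilon> in at_right 0. c * M * \<eta> \<epsilon> < 1 / 2"
    using tendsto_mult_right_zero[OF \<eta>_lim, of "c * M"] by (rule order_tendstoD) simp
  have ev: "\<forall>\<^sub>F \<epsilon> in at_right 0. \<epsilon> \<in> {0<..<\<epsilon>1}" using \<epsilon>1 by (intro eventually_at_right_real)
  show ?thesis
  proof (rule Lim_null_comparison)
    show "((\<lambda>\<epsilon>. 2 * (c * CL) * \<eta> \<epsilon>) \<longlongrightarrow> 0) (at_right 0)" using tendsto_mult_right_zero[OF \<eta>_lim] .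
    show "\<forall>\<^sub>F \<epsilon> in at_right 0. norm (\<delta> \<epsilon>) \<le> 2 * (c * CL) * \<eta> \<epsilon>"
      using \<eta>_small ev
    proof eventually_elim
      case (elim \<epsilon>)
      then have \<epsilon>: "\<epsilon> \<in> {0..<\<epsilon>1}" by auto
      have nn: "0 \<le> \<delta> \<epsilon>" by (rule \<delta>_nonneg[OF in0[OF \<epsilon>]])
      \<comment> \<open>Absorption: at most half of \<delta> reappears on the right, which leaves
        twice the remaining term as majorant.\<close>
      have "c * M * \<eta> \<epsilon> * \<delta> \<epsilon> \<le> 1 / 2 * \<delta> \<epsilon>" using elim(1) nn by (intro mult_right_mono) auto
      then show ?case using \<delta>_le[OF \<epsilon>] nn by (simp add: algebra_simps)
    qed
  qed
qed

text \<open>The vector d = B(\<epsilon>)z - B(0)z is the coordinate vector of z - y(\<epsilon>) in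
  the homogeneous solutions dual to B(\<epsilon>). To bound it by z - y(\<epsilon>), the dual
  solutions are replaced by those at \<epsilon> = 0, from which the bounded operator B(0) reads off
  d; the replacement error is a small multiple of the norm of d.\<close>

lemma necessity_II:
  assumes z: "z \<in> E"
  shows "((\<lambda>\<epsilon>. cnorm N (\<lambda>i. B \<epsilon> z i - B 0 z i)) \<longlongrightarrow> 0) (at_right 0)"
proof -
  obtain \<epsilon>1 where wp: "well_posed \<epsilon>1" using cont_dep_well_posed[OF cd] by blast
  then have \<epsilon>1: "0 < \<epsilon>1" "\<epsilon>1 < \<epsilon>0" by (auto simp: well_posed_def)
  note uniq = well_posed_unique[OF wp] and solve = well_posed_solution[OF wp]
  have z1: "0 \<in> {0..<\<epsilon>1}" using \<epsilon>1 by simp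
  have in0: "\<epsilon> \<in> {0..<\<epsilon>0}" if "\<epsilon> \<in> {0..<\<epsilon>1}" for \<epsilon> using that \<epsilon>1 by auto
  have ev: "\<forall>\<^sub>F \<epsilon> in at_right 0. \<epsilon> \<in> {0<..<\<epsilon>1}" using \<epsilon>1 by (intro eventually_at_right_real)
  have Lz: "((\<lambda>\<epsilon>. vn n (diffv (Le \<epsilon> z) (Le 0 z))) \<longlongrightarrow> 0) (at_right 0)"
  proof (rule Lim_null_comparison)
    have "((\<lambda>\<epsilon>. M * \<delta> \<epsilon> * en z) \<longlongrightarrow> M * 0 * en z) (at_right 0)" by (intro tendsto_intros necessity_I)
    then show "((\<lambda>\<epsilon>. M * \<delta> \<epsilon> * en z) \<longlongrightarrow> 0) (at_right 0)" by simp
    show "\<forall>\<^sub>F \<epsilon> in at_right 0. norm (vn n (diffv (Le \<epsilon> z) (Le 0 z))) \<le> M * \<delta> \<epsilon> * en z"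
      using ev
    proof (rule eventually_mono)
      fix \<epsilon> assume "\<epsilon> \<in> {0<..<\<epsilon>1}"
      then have \<epsilon>: "\<epsilon> \<in> {0..<\<epsilon>0}" using \<epsilon>1 by auto
      have "0 \<le> vn n (diffv (Le \<epsilon> z) (Le 0 z))" by (intro vn_nonneg VH_lincomb Le_VH \<epsilon> zero_in z)
      then show "norm (vn n (diffv (Le \<epsilon> z) (Le 0 z))) \<le> M * \<delta> \<epsilon> * en z" using Le_perturb[OF \<epsilon> z] by simp
    qed
  qed
  \<comment> \<open>The right side follows \<epsilon> while the boundary values stay at B(0)z, so z
    - y(\<epsilon>) is a homogeneous solution. Convergence of this right side is supplied by
    condition (I), already established.\<close>
  have "\<exists>y. (\<forall>\<epsilon>\<in>{0..<\<epsilon>1}. y \<epsilon> \<in> E \<and> Le \<epsilon> (y \<epsilon>) = Le \<epsilon> z \<and> B \<epsilon> (y \<epsilon>) = B 0 z) \<and>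
         ((\<lambda>\<epsilon>. en (diffv (y \<epsilon>) (y 0))) \<longlongrightarrow> 0) (at_right 0)"
    by (rule solve[of "\<lambda>\<epsilon>. Le \<epsilon> z" "\<lambda>\<epsilon>. B 0 z"])
       (use Le_VH[OF in0 z] op_cvec[OF boundary[OF zero_in] z] Lz in \<open>auto simp: cnorm_def\<close>)
  then obtain y where y: "\<And>\<epsilon>. \<epsilon> \<in> {0..<\<epsilon>1} \<Longrightarrow> y \<epsilon> \<in> E \<and> Le \<epsilon> (y \<epsilon>) = Le \<epsilon> z \<and> B \<epsilon> (y \<epsilon>) = B 0 z"
    and y_lim: "((\<lambda>\<epsilon>. en (diffv (y \<epsilon>) (y 0))) \<longlongrightarrow> 0) (at_right 0)" by blast
  have y0: "y 0 = z" using y[OF z1] uniq[OF z1 _ z, of "y 0"] by simp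
  define unit where "unit s = (\<lambda>i. if i = s then 1 else 0 :: complex)" for s :: nat
  have unit: "unit s \<in> cvec N" if "s < N" for s using that by (auto simp: unit_def cvec_def)
  \<comment> \<open>The dual solutions have constant data, so they converge as \<epsilon> tends to
    0; their total deviation from the limit is the \<zeta> introduced below.\<close>
  have "\<forall>s\<in>{..<N}. \<exists>y. (\<forall>\<epsilon>\<in>{0..<\<epsilon>1}. y \<epsilon> \<in> E \<and> Le \<epsilon> (y \<epsilon>) = zerov \<and> B \<epsilon> (y \<epsilon>) = unit s) \<and>
         ((\<lambda>\<epsilon>. en (diffv (y \<epsilon>) (y 0))) \<longlongrightarrow> 0) (at_right 0)"
    by (intro ballI solve) (use unit in \<open>auto simp: VH_zero diffv_eq cnorm_def\<close>)
  then obtain Y where Y: "\<And>s \<epsilon>. s < N \<Longrightarrow> \<epsilon> \<in> {0..<\<epsilon>1} \<Longrightarrow> Y s \<epsilon> \<in> E \<and> Le \<epsilon> (Y s \<epsilon>) = zerov \<and> B \<epsilon> (Y s \<epsilon>) = unit s"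
    and Y_lim: "\<And>s. s < N \<Longrightarrow> ((\<lambda>\<epsilon>. en (diffv (Y s \<epsilon>) (Y s 0))) \<longlongrightarrow> 0) (at_right 0)"
    unfolding bchoice_iff by (metis lessThan_iff)
  have Y_comb: "comb N d (\<lambda>s. Y s \<epsilon>) \<in> E" "Le \<epsilon> (comb N d (\<lambda>s. Y s \<epsilon>)) = zerov"
      "d \<in> cvec N \<Longrightarrow> B \<epsilon> (comb N d (\<lambda>s. Y s \<epsilon>)) = d"
    if \<epsilon>: "\<epsilon> \<in> {0..<\<epsilon>1}" for d \<epsilon>
  proof -
    have YE: "Y s \<epsilon> \<in> E" if "s < N" for s using Y[OF that \<epsilon>] by simp
    show "comb N d (\<lambda>s. Y s \<epsilon>) \<in> E" by (intro comb_VH YE)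
    have "Le \<epsilon> (comb N d (\<lambda>s. Y s \<epsilon>)) = comb N d (\<lambda>s. Le \<epsilon> (Y s \<epsilon>))" by (rule L_comb[OF YE])
    also have "\<dots> = zerov" using Y[OF _ \<epsilon>] by (simp add: comb_def)
    finally show "Le \<epsilon> (comb N d (\<lambda>s. Y s \<epsilon>)) = zerov" .
    assume d: "d \<in> cvec N"
    have "B \<epsilon> (comb N d (\<lambda>s. Y s \<epsilon>)) = (\<lambda>i. \<Sum>s<N. d s * B \<epsilon> (Y s \<epsilon>) i)"
      by (rule op_comb[OF boundary[OF in0[OF \<epsilon>]] YE])
    also have "\<dots> = (\<lambda>i. \<Sum>s<N. d s * (if i = s then 1 else 0))"
      using Y[OF _ \<epsilon>] by (simp add: unit_def)
    also have "\<dots> = d" using d by (auto simp: cvec_def fun_eq_iff if_distrib[of "\<lambda>x. _ * x"] cong: if_cong)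
    finally show "B \<epsilon> (comb N d (\<lambda>s. Y s \<epsilon>)) = d" .
  qed
  define \<zeta> where "\<zeta> \<epsilon> = (\<Sum>s<N. en (diffv (Y s \<epsilon>) (Y s 0)))" for \<epsilon>
  have "(\<zeta> \<longlongrightarrow> (\<Sum>s<N. 0)) (at_right 0)" unfolding \<zeta>_def[abs_def] by (intro tendsto_sum Y_lim) auto
  then have \<zeta>_lim: "(\<zeta> \<longlongrightarrow> 0) (at_right 0)" by simp
  obtain \<beta> where \<beta>: "0 \<le> \<beta>" "\<And>y. y \<in> E \<Longrightarrow> cnorm N (B 0 y) \<le> \<beta> * en y"
    using op_bounded[OF boundary[OF zero_in]] by blast
  have \<zeta>_small: "\<forall>\<^sub>F \<epsilon> in at_right 0. \<beta> * \<zeta> \<epsilon> < 1 / 2"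
    using tendsto_mult_right_zero[OF \<zeta>_lim, of \<beta>] by (rule order_tendstoD) simp
  show ?thesis
  proof (rule Lim_null_comparison)
    show "((\<lambda>\<epsilon>. 2 * \<beta> * en (diffv (y \<epsilon>) (y 0))) \<longlongrightarrow> 0) (at_right 0)"
      using tendsto_mult_right_zero[OF y_lim] .
    show "\<forall>\<^sub>F \<epsilon> in at_right 0. norm (cnorm N (\<lambda>i. B \<epsilon> z i - B 0 z i)) \<le> 2 * \<beta> * en (diffv (y \<epsilon>) (y 0))"
      using \<zeta>_small ev
    proof eventually_elim
      case (elim \<epsilon>)
      then have \<epsilon>: "\<epsilon> \<in> {0..<\<epsilon>1}" by auto
      note Bop = boundary[OF in0[OF \<epsilon>]]
      have yE: "y \<epsilon> \<in> E" using y[OF \<epsilon>] by simp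
      let ?u = "diffv z (y \<epsilon>)"
      have u: "?u \<in> E" by (intro VH_lincomb z yE)
      define d where "d = B \<epsilon> ?u"
      have d: "d \<in> cvec N" unfolding d_def by (rule op_cvec[OF Bop u])
      have d_eq: "d = (\<lambda>i. B \<epsilon> z i - B 0 z i)"
        unfolding d_def op_lincomb[OF Bop z yE] using y[OF \<epsilon>] by simp
      have "Le \<epsilon> ?u = zerov" unfolding L_lincomb[OF z yE] using y[OF \<epsilon>] by (simp add: lincomb_def)
      then have u_eq: "?u = comb N d (\<lambda>s. Y s \<epsilon>)"
        using Y_comb[OF \<epsilon>, of d] d by (intro uniq[OF \<epsilon> u Y_comb(1)[OF \<epsilon>]]) (auto simp: d_def)
      have Y0: "comb N d (\<lambda>s. Y s 0) \<in> E" by (rule Y_comb[OF z1])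
      \<comment> \<open>The coordinates belong to \<epsilon> but are recovered at 0, since the
        combination of the limiting dual solutions has boundary value d under B(0).\<close>
      have "cnorm N d = cnorm N (B 0 (comb N d (\<lambda>s. Y s 0)))" using Y_comb(3)[OF z1 d] by simp
      also have "\<dots> \<le> \<beta> * en (comb N d (\<lambda>s. Y s 0))" by (rule \<beta>(2)[OF Y0])
      also have "\<dots> \<le> \<beta> * (en ?u + cnorm N d * \<zeta> \<epsilon>)"
      proof (intro mult_left_mono \<beta>)
        have "en (diffv ?u (comb N d (\<lambda>s. Y s 0))) \<le> cnorm N d * \<zeta> \<epsilon>"
          unfolding u_eq comb_diff \<zeta>_def using Y \<epsilon> z1 by (intro comb_bound VH_lincomb) auto
        then show "en (comb N d (\<lambda>s. Y s 0)) \<le> en ?u + cnorm N d * \<zeta> \<epsilon>"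
          using vn_triangle[OF Y0 u] vn_diff_comm[OF Y0 u] by simp
      qed
      finally have "cnorm N d \<le> \<beta> * en ?u + \<beta> * \<zeta> \<epsilon> * cnorm N d" by (simp add: algebra_simps)
      moreover have "\<beta> * \<zeta> \<epsilon> * cnorm N d \<le> 1 / 2 * cnorm N d"
        using elim(1) cnorm_ge_0 by (intro mult_right_mono) auto
      moreover have "en ?u = en (diffv (y \<epsilon>) (y 0))" unfolding y0 by (rule vn_diff_comm[OF z yE])
      ultimately have "cnorm N d \<le> 2 * \<beta> * en (diffv (y \<epsilon>) (y 0))" by simp
      then show ?case using cnorm_ge_0[of N d] by (simp add: d_eq)
    qed
  qed
qed

end

lemma cont_dep_iff:
  "cont_dep a b m r n \<alpha> \<epsilon>0 A B \<longleftrightarrow>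
    (\<forall>y\<in>E. Le 0 y = zerov \<and> B 0 y = (\<lambda>i. 0) \<longrightarrow> y = zerov) \<and> (\<delta> \<longlongrightarrow> 0) (at_right 0) \<and>
    (\<forall>y\<in>E. ((\<lambda>\<epsilon>. cnorm N (\<lambda>i. B \<epsilon> y i - B 0 y i)) \<longlongrightarrow> 0) (at_right 0))"
  using necessity_0 necessity_I necessity_II sufficiency by blast

text \<open>For \<epsilon> in the admissible range all summands of \<delta> are nonnegative, so each
  of them is dominated by the sum.\<close>

lemma \<delta>_tendsto_iff:
  "(\<delta> \<longlongrightarrow> 0) (at_right 0) \<longleftrightarrow>
    (\<forall>k<r. ((\<lambda>\<epsilon>. mn n (\<lambda>i l t. A k \<epsilon> i l t - A k 0 i l t)) \<longlongrightarrow> 0) (at_right 0))"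
proof (intro iffI allI impI)
  assume *: "\<forall>k<r. ((\<lambda>\<epsilon>. mn n (\<lambda>i l t. A k \<epsilon> i l t - A k 0 i l t)) \<longlongrightarrow> 0) (at_right 0)"
  have "(\<delta> \<longlongrightarrow> (\<Sum>k<r. 0)) (at_right 0)" unfolding \<delta>_def[abs_def] using * by (intro tendsto_sum) auto
  then show "(\<delta> \<longlongrightarrow> 0) (at_right 0)" by simp
next
  fix k assume \<delta>: "(\<delta> \<longlongrightarrow> 0) (at_right 0)" and k: "k < r"
  let ?d = "\<lambda>k \<epsilon> i l t. A k \<epsilon> i l t - A k 0 i l t"
  show "((\<lambda>\<epsilon>. mn n (?d k \<epsilon>)) \<longlongrightarrow> 0) (at_right 0)"
  proof (rule Lim_null_comparison[OF _ \<delta>])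
    have "\<forall>\<^sub>F \<epsilon> in at_right 0. \<epsilon> \<in> {0<..<\<epsilon>0}" using \<epsilon>0_pos by (intro eventually_at_right_real)
    then show "\<forall>\<^sub>F \<epsilon> in at_right 0. norm (mn n (?d k \<epsilon>)) \<le> \<delta> \<epsilon>"
    proof (rule eventually_mono)
      fix \<epsilon> assume "\<epsilon> \<in> {0<..<\<epsilon>0}"
      then have nn: "0 \<le> mn n (?d k \<epsilon>)" if "k < r" for k
        using coeff[of \<epsilon>] coeff[OF zero_in] that by (intro mn_nonneg MH_diff) auto
      show "norm (mn n (?d k \<epsilon>)) \<le> \<delta> \<epsilon>"
        unfolding \<delta>_def using nn[OF k] member_le_sum[of k "{..<r}" "\<lambda>k. mn n (?d k \<epsilon>)"] nn k by auto
    qed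
  qed
qed

end

theorem mainTheorem1:
  fixes a b \<alpha> \<epsilon>0 :: real
    and m r n :: nat
    and A :: "nat \<Rightarrow> real \<Rightarrow> nat \<Rightarrow> nat \<Rightarrow> real \<Rightarrow> complex"
    and B :: "real \<Rightarrow> (nat \<Rightarrow> real \<Rightarrow> complex) \<Rightarrow> (nat \<Rightarrow> complex)"
  assumes "a < b" and "1 \<le> m" and "2 \<le> r" and "0 < \<alpha>" and "\<alpha> \<le> 1" and "0 < \<epsilon>0"
    and "\<forall>\<epsilon>\<in>{0..<\<epsilon>0}. \<forall>k<r. A k \<epsilon> \<in> MHoelder m n \<alpha> a b"
    and "\<forall>\<epsilon>\<in>{0..<\<epsilon>0}. cont_lin_op m (n + r) \<alpha> a b (r * m) (B \<epsilon>)"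
  shows "cont_dep a b m r n \<alpha> \<epsilon>0 A B \<longleftrightarrow>
    ((\<forall>y\<in>VHoelder m (n + r) \<alpha> a b.
        Lop a b m r A 0 y = (\<lambda>i t. 0) \<and> B 0 y = (\<lambda>i. 0) \<longrightarrow> y = (\<lambda>i t. 0)) \<and>
     (\<forall>k<r. ((\<lambda>\<epsilon>. mnorm m n \<alpha> a b (\<lambda>i l t. A k \<epsilon> i l t - A k 0 i l t)) \<longlongrightarrow> 0) (at_right 0)) \<and>
     (\<forall>y\<in>VHoelder m (n + r) \<alpha> a b.
        ((\<lambda>\<epsilon>. cnorm (r * m) (\<lambda>i. B \<epsilon> y i - B 0 y i)) \<longlongrightarrow> 0) (at_right 0)))"
proof -
  interpret boundary_problem a b \<alpha> m r n \<epsilon>0 A B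
    by unfold_locales (use assms in auto)
  have "(\<forall>y\<in>E. Lop a b m r A 0 y = zerov \<and> B 0 y = (\<lambda>i. 0) \<longrightarrow> y = zerov) \<longleftrightarrow>
      (\<forall>y\<in>E. Le 0 y = zerov \<and> B 0 y = (\<lambda>i. 0) \<longrightarrow> y = zerov)"
    using Lop_eq_Le[OF zero_in] by auto
  then show ?thesis unfolding cont_dep_iff \<delta>_tendsto_iff by simp
qed

end
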